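(* There exist a sequence of viscosities $\nu_m>0$ with $\nu_m\downarrow 0$, forces $f^{\nu_m}\in C^\infty(\mathbb T^3\times[0,1];\mathbb R^3)$, and a single initial datum $u_0\in C^\infty(\mathbb T^3;\mathbb R^3)$ (independent of $m$) such that $$\sup_m \|f^{\nu_m}\|_{C([0,1];C^\alpha(\mathbb T^3))}<\infty\qquad\text{for all }\alpha\in(0,1),$$ and such that for every $m$ there is a unique smooth solution $u^{\nu_m}\in C^\infty(\mathbb T^3\times[0,1];\mathbb R^3)$ of the forced incompressible Navier–Stokes equations on $\mathbb T^3\times[0,1]$ with viscosity $\nu_m$, force $f^{\nu_m}$ and initial datum $u_0$, and these solutions satisfy $$\liminf_{m\to\infty}\ \nu_m\int_0^1\int_{\mathbb T^3}|\nabla u^{\nu_m}(x,t)|^2\,dx\,dt>0.$$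
   Context: $\mathbb T^3=\mathbb R^3/\mathbb Z^3$ is the three-dimensional torus. The forced incompressible Navier–Stokes equations with viscosity $\nu>0$, force $f^\nu:\mathbb T^3\times[0,1]\to\mathbb R^3$ and initial datum $u_0^\nu$ are $$\partial_t u^\nu+u^\nu\cdot\nabla u^\nu+\nabla p^\nu=\nu\Delta u^\nu+f^\nu,\qquad \operatorname{div}u^\nu=0,\qquad u^\nu(\cdot,0)=u_0^\nu,$$ on $\mathbb T^3\times[0,1]$, where $u^\nu$ is the velocity and $p^\nu:\mathbb T^3\times[0,1]\to\mathbb R$ is the pressure. Solutions are classical: $u^\nu,p^\nu,f^\nu$ are smooth. Uniqueness refers to the velocity $u^\nu$. *)

theory Defs
  imports "HOL-Analysis.Analysis"
begin

text \<open>
  Functions on the torus are represented by functions on \<open>real^3\<close> that are 1-periodic in each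
  coordinate; integration over the torus is integration over the unit cube. Time-dependent
  functions are written \<open>g t x\<close>, and only their values for \<open>t \<in> {0..1}\<close> matter.
\<close>

definition periodic :: "(real^3 \<Rightarrow> 'b) \<Rightarrow> bool" where
  "periodic g \<longleftrightarrow> (\<forall>x i. g (x + axis i 1) = g x)"

text \<open>
  Class \<open>C\<^sup>k\<close> on a set \<open>S\<close>, by iterating directional derivatives (this keeps the type of the
  function fixed along the recursion). Derivatives are taken within \<open>S\<close>, hence one-sided at the
  boundary; they are unique for the two sets used below, \<open>UNIV\<close> and \<open>{0..1} \<times> UNIV\<close>, because
  these are convex with nonempty interior.
\<close>

primrec C_k_on :: "nat \<Rightarrow> 'a::euclidean_space set \<Rightarrow> ('a \<Rightarrow> 'b::real_normed_vector) \<Rightarrow> bool" where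
  "C_k_on 0 S f \<longleftrightarrow> continuous_on S f"
| "C_k_on (Suc k) S f \<longleftrightarrow>
     f differentiable_on S \<and> (\<forall>v. C_k_on k S (\<lambda>x. frechet_derivative f (at x within S) v))"

definition smooth_on :: "'a::euclidean_space set \<Rightarrow> ('a \<Rightarrow> 'b::real_normed_vector) \<Rightarrow> bool" where
  "smooth_on S f \<longleftrightarrow> (\<forall>k. C_k_on k S f)"

definition smooth_torus :: "(real^3 \<Rightarrow> 'b::real_normed_vector) \<Rightarrow> bool" where
  "smooth_torus g \<longleftrightarrow> periodic g \<and> smooth_on UNIV g"

definition smooth_torus_time :: "(real \<Rightarrow> real^3 \<Rightarrow> 'b::real_normed_vector) \<Rightarrow> bool" where
  "smooth_torus_time g \<longleftrightarrow>
     (\<forall>t\<in>{0..1}. periodic (g t)) \<and> smooth_on ({0..1} \<times> UNIV) (\<lambda>(t, x). g t x)"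

definition partial_deriv :: "3 \<Rightarrow> (real^3 \<Rightarrow> 'b::real_normed_vector) \<Rightarrow> real^3 \<Rightarrow> 'b" where
  "partial_deriv i g x = frechet_derivative g (at x) (axis i 1)"

definition gradient :: "(real^3 \<Rightarrow> real) \<Rightarrow> real^3 \<Rightarrow> real^3" where
  "gradient g x = (\<chi> i. partial_deriv i g x)"

definition divergence :: "(real^3 \<Rightarrow> real^3) \<Rightarrow> real^3 \<Rightarrow> real" where
  "divergence v x = (\<Sum>i\<in>UNIV. partial_deriv i v x $ i)"

definition laplacian :: "(real^3 \<Rightarrow> real^3) \<Rightarrow> real^3 \<Rightarrow> real^3" where
  "laplacian v x = (\<Sum>i\<in>UNIV. partial_deriv i (partial_deriv i v) x)"

definition advection :: "(real^3 \<Rightarrow> real^3) \<Rightarrow> (real^3 \<Rightarrow> real^3) \<Rightarrow> real^3 \<Rightarrow> real^3" where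
  "advection v w x = (\<Sum>i\<in>UNIV. (v x $ i) *\<^sub>R partial_deriv i w x)"

definition time_deriv :: "(real \<Rightarrow> real^3 \<Rightarrow> real^3) \<Rightarrow> real \<Rightarrow> real^3 \<Rightarrow> real^3" where
  "time_deriv u t x = vector_derivative (\<lambda>s. u s x) (at t within {0..1})"

definition navier_stokes_solution ::
  "real \<Rightarrow> (real \<Rightarrow> real^3 \<Rightarrow> real^3) \<Rightarrow> (real^3 \<Rightarrow> real^3) \<Rightarrow>
   (real \<Rightarrow> real^3 \<Rightarrow> real^3) \<Rightarrow> (real \<Rightarrow> real^3 \<Rightarrow> real) \<Rightarrow> bool" where
  "navier_stokes_solution \<nu> f u0 u p \<longleftrightarrow>
     smooth_torus_time u \<and> smooth_torus_time p \<and>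
     (\<forall>t\<in>{0..1}. \<forall>x.
        time_deriv u t x + advection (u t) (u t) x + gradient (p t) x
          = \<nu> *\<^sub>R laplacian (u t) x + f t x \<and>
        divergence (u t) x = 0) \<and>
     (\<forall>x. u 0 x = u0 x)"

text \<open>
  The norm of \<open>C\<^sup>\<alpha>\<close> with values in \<open>ennreal\<close>, so that it is infinite when a supremum is. For
  periodic \<open>g\<close> the Euclidean distance on \<open>real^3\<close> gives the same seminorm as the quotient
  distance of the torus, which is the minimum of \<open>dist x y\<close> over representatives.
\<close>

definition holder_norm :: "real \<Rightarrow> (real^3 \<Rightarrow> real^3) \<Rightarrow> ennreal" where
  "holder_norm \<alpha> g =
     (SUP x. ennreal (norm (g x))) +
     (SUP (x, y)\<in>{(x, y). x \<noteq> y}. ennreal (dist (g x) (g y) / dist x y powr \<alpha>))"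

definition C_holder_norm :: "real \<Rightarrow> (real \<Rightarrow> real^3 \<Rightarrow> real^3) \<Rightarrow> ennreal" where
  "C_holder_norm \<alpha> f = (SUP t\<in>{0..1}. holder_norm \<alpha> (f t))"

text \<open>Here \<open>|\<nabla>u|\<^sup>2\<close> is the squared Frobenius norm of the velocity gradient.\<close>

definition dissipation :: "real \<Rightarrow> (real \<Rightarrow> real^3 \<Rightarrow> real^3) \<Rightarrow> real" where
  "dissipation \<nu> u =
     \<nu> * integral {0..1} (\<lambda>t. integral (cbox 0 1)
            (\<lambda>x. \<Sum>i\<in>UNIV. (norm (partial_deriv i (u t) x))\<^sup>2))"

end

theory Submission
  imports Defs
begin

text \<open>
  The flow is two-and-a-half-dimensional: \<open>u = (V\<^sub>1, V\<^sub>2, \<theta>)\<close> with zero pressure, all components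
  depending only on \<open>(x\<^sub>1, x\<^sub>2, t)\<close>. The planar part \<open>V\<close> runs through finitely many shears,
  alternating in direction, active on consecutive time intervals accumulating at \<open>t = 1/2\<close>;
  since only one shear acts at a time, \<open>V\<close> has no self-advection and the force it needs is its
  time derivative minus its viscous term. The shear profiles are trigonometric polynomials close
  to triangle waves of frequency \<open>2\<^sup>q\<close> whose displacement has slope \<open>s\<^sub>q\<close> of polynomial size in
  \<open>q\<close>. So the force is bounded in every \<open>C\<^sup>\<alpha>\<close> with \<open>\<alpha> < 1\<close>, whereas the gradient of a
  transported scalar grows up to \<open>\<lambda>\<^sub>Q = s\<^sub>0 \<cdots> s\<^sub>Q\<^sub>-\<^sub>1\<close>. The viscosity is \<open>\<nu> = \<lambda>\<^sub>Q\<^sup>-\<^sup>2\<close>.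

  Transport by the \<open>Q\<close> shears alone turns \<open>sin (2 \<pi> x\<^sub>1)\<close> into \<open>\<Psi>\<close>, whose averages over segments
  of length \<open>1 / \<lambda>\<^sub>Q\<close> are small in \<open>L\<^sup>1\<close> although the \<open>L\<^sup>2\<close> norm is conserved. If the advected
  and diffused scalar \<open>\<theta>\<close> dissipated little, an energy estimate would keep it close to \<open>\<Psi>\<close>,
  hence far from its own averages over such segments, which forces \<open>|\<nabla>\<theta>| \<ge> c \<lambda>\<^sub>Q\<close> in \<open>L\<^sup>1\<close>
  during \<open>[1/2, 1]\<close> and so a dissipation bounded below.

  Parabolic existence theory is avoided: \<open>\<theta>\<close> is a Picard iterate, a finite sum of waves \<open>c(t) sin (\<kappa> \<bullet> x + \<beta>)\<close>,
  and its tiny residual becomes the third component of the force.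
\<close>

section \<open>Integration over the torus\<close>

text \<open>Two requirements pull against each other. Forces bounded in every
  \<open>C^\<alpha>\<close> with \<open>\<alpha> < 1\<close> allow slopes of polynomial size at
  frequency \<open>2 ^ q\<close>, since \<open>2 ^ (- q * (1 - \<alpha>))\<close> beats every
  polynomial; mixing needs its errors, of order \<open>slope q\<close> to the power
  \<open>- 1 / 2\<close>, to be summable. A slope growing like \<open>(q + 1) ^ 4\<close> meets
  both. Triangle waves are used because their slope is \<open>\<plusminus> s\<close> almost
  everywhere: the shear turns a short segment into nearly a segment of \<open>s\<close> times the
  length in the other direction, so averages over the former are averages over the latter one stage
  earlier.

  Averages are compared rather than gradients because the energy estimate controls the scalar in
  \<open>L^2\<close> only, where averages are continuous and gradients are not. The size of
  \<open>\<nu>\<close> is forced from both sides: the cross term of \<open>\<nabla>\<theta>\<close>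
  with \<open>\<nabla>\<Psi>\<close>, the latter of order \<open>\<lambda>\<close>, is controlled by
  the dissipation if \<open>\<nu>\<close> is at most of order \<open>\<lambda> ^ (-2)\<close>, and a
  gradient of order \<open>\<lambda>\<close> dissipates an amount of order one if
  \<open>\<nu>\<close> is at least of that order.\<close>

definition torus_int :: "(real^3 \<Rightarrow> real) \<Rightarrow> real" where
  "torus_int F = integral (cbox 0 1) F"

abbreviation ee :: "3 \<Rightarrow> real^3" where "ee i \<equiv> axis i 1"

lemma integrable_on_unit_cube [intro]:
  "continuous_on UNIV F \<Longrightarrow> (F :: real^3 \<Rightarrow> real) integrable_on cbox 0 1"
  by (meson continuous_on_subset integrable_continuous subset_UNIV)

lemma torus_int_add: "continuous_on UNIV F \<Longrightarrow> continuous_on UNIV G \<Longrightarrow>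
    torus_int (\<lambda>x. F x + G x) = torus_int F + torus_int G"
  unfolding torus_int_def by (intro integral_add) auto

lemma torus_int_diff: "continuous_on UNIV F \<Longrightarrow> continuous_on UNIV G \<Longrightarrow>
    torus_int (\<lambda>x. F x - G x) = torus_int F - torus_int G"
  unfolding torus_int_def by (intro integral_diff) auto

lemma torus_int_sum: "finite I \<Longrightarrow> (\<And>i. i \<in> I \<Longrightarrow> continuous_on UNIV (F i)) \<Longrightarrow>
    torus_int (\<lambda>x. \<Sum>i\<in>I. F i x) = (\<Sum>i\<in>I. torus_int (F i))"
  unfolding torus_int_def by (intro integral_sum) auto

lemma torus_int_cmult: "torus_int (\<lambda>x. c * F x) = c * torus_int F"
  unfolding torus_int_def by simp

lemma content_unit_cube: "Henstock_Kurzweil_Integration.content (cbox (0::real^3) 1) = 1"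
  by (simp add: content_cbox_cart interval_eq_empty_cart)

lemma torus_int_const: "torus_int (\<lambda>x. c) = c"
  unfolding torus_int_def by (simp add: content_unit_cube)

lemma torus_int_mono: "continuous_on UNIV F \<Longrightarrow> continuous_on UNIV G \<Longrightarrow> (\<And>x. F x \<le> G x) \<Longrightarrow>
    torus_int F \<le> torus_int G"
  unfolding torus_int_def by (intro integral_le) auto

lemma torus_int_nonneg: "continuous_on UNIV F \<Longrightarrow> (\<And>x. 0 \<le> F x) \<Longrightarrow> 0 \<le> torus_int F"
  unfolding torus_int_def by (intro integral_nonneg) auto

lemma torus_int_continuous_param:
  assumes "continuous_on (U \<times> UNIV) (\<lambda>(s, x). F s x)"
  shows "continuous_on U (\<lambda>s. torus_int (F s))"
  unfolding torus_int_def
  by (rule integral_continuous_on_param) (rule continuous_on_subset[OF assms], auto)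

lemma torus_int_swap:
  fixes a b :: real
  assumes "continuous_on ({a..b} \<times> UNIV) (\<lambda>(s, x). F s x)"
  shows "integral {a..b} (\<lambda>s. torus_int (F s)) = torus_int (\<lambda>x. integral {a..b} (\<lambda>s. F s x))"
proof -
  have "continuous_on (cbox (a, 0) (b, 1)) (\<lambda>(s, x). F s x)"
    by (rule continuous_on_subset[OF assms]) (auto simp: cbox_Pair_eq)
  from integral_swap_continuous[OF this] show ?thesis
    by (simp add: torus_int_def)
qed

section \<open>Translation and shear invariance of the integral\<close>

lemma periodic_nat: "periodic g \<Longrightarrow> g (x + real n *\<^sub>R ee i) = g x"
proof (induction n arbitrary: x)
  case (Suc n)
  have "g (x + real (Suc n) *\<^sub>R ee i) = g ((x + real n *\<^sub>R ee i) + ee i)"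
    by (simp add: algebra_simps)
  then show ?case using Suc by (simp add: periodic_def)
qed simp

lemma periodic_int:
  assumes "periodic g"
  shows "g (x + of_int n *\<^sub>R ee i) = g x"
proof (cases "n \<ge> 0")
  case True
  then show ?thesis using periodic_nat[OF assms, of x "nat n" i] by simp
next
  case False
  then show ?thesis using periodic_nat[OF assms, of "x + of_int n *\<^sub>R ee i" "nat (- n)" i]
    by (simp add: algebra_simps)
qed

text \<open>The translated cube sticks out past \<open>x $ i = 1\<close>. The overhang is cut off
  and moved back by one period, where it fills the gap left at the opposite face.\<close>

lemma torus_int_shift_unit:
  fixes F :: "real^3 \<Rightarrow> real"
  assumes cont: "continuous_on UNIV F" and per: "periodic F" and s: "0 \<le> s" "s \<le> 1"
  shows "torus_int (\<lambda>x. F (x + s *\<^sub>R ee i)) = torus_int F"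
proof -
  define e where "e = ee i"
  have eB: "e \<in> Basis" by (simp add: e_def axis_in_Basis_iff)
  have int: "F integrable_on cbox a b" for a b
    by (meson cont continuous_on_subset integrable_continuous subset_UNIV)
  have dot: "x \<bullet> e = x $ i" for x by (simp add: e_def inner_axis)
  have e_nth: "e $ j = (if j = i then 1 else 0)" for j by (simp add: e_def axis_def)
  have "integral (cbox 0 1) (\<lambda>x. F (x + s *\<^sub>R e)) = integral (cbox (s *\<^sub>R e) (1 + s *\<^sub>R e)) F"
    using integral_shift_cbox[of "s *\<^sub>R e" "s *\<^sub>R e" "1 + s *\<^sub>R e" F] by simp
  also have "\<dots> = integral (cbox (s *\<^sub>R e) (1 + s *\<^sub>R e) \<inter> {x. x\<bullet>e \<le> 1}) F
      + integral (cbox (s *\<^sub>R e) (1 + s *\<^sub>R e) \<inter> {x. x\<bullet>e \<ge> 1}) F"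
    by (rule integral_split[OF int eB])
  also have "cbox (s *\<^sub>R e) (1 + s *\<^sub>R e) \<inter> {x. x\<bullet>e \<le> 1} = cbox (s *\<^sub>R e) 1"
    using s exhaust_3[of i] by (auto simp: set_eq_iff mem_box_cart dot e_nth forall_3)
  also have "cbox (s *\<^sub>R e) (1 + s *\<^sub>R e) \<inter> {x. x\<bullet>e \<ge> 1} = cbox e (1 + s *\<^sub>R e)"
    using s exhaust_3[of i] by (auto simp: set_eq_iff mem_box_cart dot e_nth forall_3)
  also have "integral (cbox e (1 + s *\<^sub>R e)) F = integral (cbox 0 (1 + s *\<^sub>R e - e)) (\<lambda>x. F (x + e))"
    using integral_shift_cbox[of "e" "e" "1 + s *\<^sub>R e" F] by simp
  also have "(\<lambda>x. F (x + e)) = F" using per by (auto simp: periodic_def e_def)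
  also have "cbox 0 (1 + s *\<^sub>R e - e) = cbox 0 1 \<inter> {x. x\<bullet>e \<le> s}"
    using s exhaust_3[of i] by (auto simp: set_eq_iff mem_box_cart dot e_nth forall_3)
  also have "cbox (s *\<^sub>R e) 1 = cbox 0 1 \<inter> {x. x\<bullet>e \<ge> s}"
    using s exhaust_3[of i] by (auto simp: set_eq_iff mem_box_cart dot e_nth forall_3)
  also have "integral (cbox 0 1 \<inter> {x. s \<le> x \<bullet> e}) F + integral (cbox 0 1 \<inter> {x. x \<bullet> e \<le> s}) F
     = integral (cbox 0 1) F"
    using integral_split[OF int eB, of 0 1 s] by simp
  finally show ?thesis by (simp add: torus_int_def e_def)
qed

lemma torus_int_shift:
  fixes F :: "real^3 \<Rightarrow> real"
  assumes cont: "continuous_on UNIV F" and per: "periodic F"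
  shows "torus_int (\<lambda>x. F (x + s *\<^sub>R ee i)) = torus_int F"
proof -
  have "F (x + s *\<^sub>R ee i) = F (x + frac s *\<^sub>R ee i)" for x
  proof -
    have "x + s *\<^sub>R ee i = (x + frac s *\<^sub>R ee i) + of_int \<lfloor>s\<rfloor> *\<^sub>R ee i"
      by (simp add: frac_def algebra_simps)
    then show ?thesis using periodic_int[OF per] by metis
  qed
  then show ?thesis
    using torus_int_shift_unit[OF assms, of "frac s" i] frac_ge_0[of s] frac_lt_1[of s] by simp
qed

text \<open>Fubini and translation invariance. Statements on the torus are reduced with it to
  one-variable statements on lines parallel to an axis.\<close>

lemma torus_int_average:
  fixes F :: "real^3 \<Rightarrow> real"
  assumes cont: "continuous_on UNIV F" and per: "periodic F"
  shows "torus_int (\<lambda>x. integral {0..1} (\<lambda>s. F (x + s *\<^sub>R ee i))) = torus_int F"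
proof -
  have "continuous_on ({0..1} \<times> UNIV) (\<lambda>(s, x). F (x + s *\<^sub>R ee i))"
    unfolding split_def
    by (rule continuous_on_compose2[OF cont]) (auto intro!: continuous_intros)
  from torus_int_swap[OF this] show ?thesis
    by (simp add: torus_int_shift[OF cont per])
qed

lemma integral_periodic_shift_real:
  fixes f :: "real \<Rightarrow> real"
  assumes cont: "continuous_on UNIV f" and per: "\<And>x. f (x + 1) = f x"
  shows "integral {0..1} (\<lambda>s. f (c + s)) = integral {0..1} f"
proof -
  \<comment> \<open>The function of one variable is lifted to the torus so that
    \<open>periodic_int\<close> supplies its integer periods.\<close>
  define F :: "real^3 \<Rightarrow> real" where "F = (\<lambda>x. f (x $ 1))"
  have cF: "continuous_on UNIV F"
    unfolding F_def by (rule continuous_on_compose2[OF cont]) (auto intro!: continuous_intros)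
  have pF: "periodic F" unfolding periodic_def F_def by (auto simp: axis_def per)
  have fi: "f (x + of_int n) = f x" for x n
    using periodic_int[OF pF, of "x *\<^sub>R ee 1" n 1] by (simp add: F_def axis_def)
  have cont': "f integrable_on {a..b}" for a b
    by (metis cont continuous_on_subset integrable_continuous_real subset_UNIV)
  have unit: "integral {0..1} (\<lambda>s. f (c + s)) = integral {0..1} f" if c: "0 \<le> c" "c \<le> 1" for c
  proof -
    have "integral {0..1} (\<lambda>s. f (c + s)) = integral {c..1 + c} f"
      using integral_shift_real_ivl[of c c "1+c" f] by (simp add: add.commute)
    also have "\<dots> = integral {c..1} f + integral {1..1+c} f"
      using c by (intro Henstock_Kurzweil_Integration.integral_combine[symmetric] cont') auto
    also have "integral {1..1+c} f = integral {0..c} f"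
      using integral_shift_real_ivl[of 1 1 "1+c" f] by (simp add: per)
    also have "integral {c..1} f + integral {0..c} f = integral {0..1} f"
      using c Henstock_Kurzweil_Integration.integral_combine[of 0 c 1 f] cont' by auto
    finally show ?thesis .
  qed
  have "f (c + s) = f (frac c + s)" for s
    using fi[of "frac c + s" "\<lfloor>c\<rfloor>"] by (simp add: frac_def algebra_simps)
  then show ?thesis using unit[of "frac c"] frac_ge_0[of c] frac_lt_1[of c] by simp
qed

text \<open>On a line parallel to \<open>ee i\<close> the coordinate \<open>x $ j\<close> is
  constant, so there the shear is a translation of a periodic function and leaves the average over
  the line unchanged.\<close>

lemma torus_int_shear:
  fixes F :: "real^3 \<Rightarrow> real"
  assumes cont: "continuous_on UNIV F" and per: "periodic F"
    and g: "continuous_on UNIV g" "\<And>y. g (y + 1) = g y" and ij: "i \<noteq> j"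
  shows "torus_int (\<lambda>x. F (x + g (x $ j) *\<^sub>R ee i)) = torus_int F"
proof -
  let ?G = "\<lambda>x. F (x + g (x $ j) *\<^sub>R ee i)"
  have cG: "continuous_on UNIV ?G"
    by (rule continuous_on_compose2[OF cont])
      (auto intro!: continuous_intros continuous_on_compose2[OF g(1)])
  have pG: "periodic ?G"
    unfolding periodic_def
  proof (intro allI)
    fix x k
    have "g ((x + ee k) $ j) = g (x $ j)" by (cases "k = j") (auto simp: axis_def g)
    moreover have "x + ee k + g (x $ j) *\<^sub>R ee i = (x + g (x $ j) *\<^sub>R ee i) + ee k" by simp
    ultimately show "F (x + ee k + g ((x + ee k) $ j) *\<^sub>R ee i) = F (x + g (x $ j) *\<^sub>R ee i)"
      using per unfolding periodic_def by metis
  qed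
  have "torus_int ?G = torus_int (\<lambda>x. integral {0..1} (\<lambda>s. ?G (x + s *\<^sub>R ee i)))"
    by (rule torus_int_average[OF cG pG, symmetric])
  also have "(\<lambda>x. integral {0..1} (\<lambda>s. ?G (x + s *\<^sub>R ee i)))
      = (\<lambda>x. integral {0..1} (\<lambda>s. F (x + s *\<^sub>R ee i)))"
  proof
    fix x
    define f where "f = (\<lambda>s. F (x + s *\<^sub>R ee i))"
    have "continuous_on UNIV f" unfolding f_def
      by (rule continuous_on_compose2[OF cont]) (auto intro!: continuous_intros)
    moreover have "f (s + 1) = f s" for s
    proof -
      have "x + (s + 1) *\<^sub>R ee i = (x + s *\<^sub>R ee i) + ee i" by (simp add: algebra_simps)
      then show ?thesis using per unfolding f_def periodic_def by metis
    qed
    ultimately have "integral {0..1} (\<lambda>s. f (g (x $ j) + s)) = integral {0..1} f"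
      by (rule integral_periodic_shift_real)
    moreover have "?G (x + s *\<^sub>R ee i) = f (g (x $ j) + s)" for s
    proof -
      have "(x + s *\<^sub>R ee i) $ j = x $ j" using ij by (simp add: axis_def)
      moreover have "x + s *\<^sub>R ee i + g (x $ j) *\<^sub>R ee i = x + (g (x $ j) + s) *\<^sub>R ee i"
        by (simp add: algebra_simps)
      ultimately show ?thesis unfolding f_def by metis
    qed
    ultimately show "integral {0..1} (\<lambda>s. ?G (x + s *\<^sub>R ee i)) = integral {0..1} (\<lambda>s. F (x + s *\<^sub>R ee i))"
      by (simp add: f_def)
  qed
  also have "torus_int \<dots> = torus_int F" by (rule torus_int_average[OF cont per])
  finally show ?thesis .
qed

text \<open>This is integration by parts on the torus; the fluxes of both energy estimates are
  removed with it. Only a derivative along a line at \<open>h = 0\<close> is asked for, so it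
  applies to slices of abstract smooth functions as well as to explicit wave sums.\<close>

lemma torus_int_partial_zero:
  fixes F F' :: "real^3 \<Rightarrow> real"
  assumes per: "periodic F" and cont: "continuous_on UNIV F'"
    and D: "\<And>x. ((\<lambda>h. F (x + h *\<^sub>R ee i)) has_real_derivative F' x) (at 0)"
  shows "torus_int F' = 0"
proof -
  have perF': "periodic F'"
    unfolding periodic_def
  proof (intro allI)
    fix x k
    have "(\<lambda>h. F (x + ee k + h *\<^sub>R ee i)) = (\<lambda>h. F (x + h *\<^sub>R ee i))"
    proof
      fix h
      have "x + ee k + h *\<^sub>R ee i = (x + h *\<^sub>R ee i) + ee k" by simp
      then show "F (x + ee k + h *\<^sub>R ee i) = F (x + h *\<^sub>R ee i)" using per unfolding periodic_def by metis
    qed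
    then show "F' (x + ee k) = F' x" using D[of "x + ee k"] D[of x] DERIV_unique by metis
  qed
  have "integral {0..1} (\<lambda>s. F' (x + s *\<^sub>R ee i)) = 0" for x
  proof -
    have "((\<lambda>s. F (x + s *\<^sub>R ee i)) has_real_derivative F' (x + s *\<^sub>R ee i)) (at s)" for s
    proof -
      have "((\<lambda>h. F (x + s *\<^sub>R ee i + h *\<^sub>R ee i)) has_real_derivative F' (x + s *\<^sub>R ee i)) (at 0)"
        by (rule D)
      then have "((\<lambda>h. F (x + (h + s) *\<^sub>R ee i)) has_real_derivative F' (x + s *\<^sub>R ee i)) (at 0)"
        by (simp add: algebra_simps)
      then show ?thesis using DERIV_shift[of "\<lambda>s. F (x + s *\<^sub>R ee i)" _ 0 s] by (simp add: add.commute)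
    qed
    then have "((\<lambda>s. F' (x + s *\<^sub>R ee i)) has_integral F (x + 1 *\<^sub>R ee i) - F (x + 0 *\<^sub>R ee i)) {0..1}"
      by (intro fundamental_theorem_of_calculus)
        (auto simp: has_real_derivative_iff_has_vector_derivative[symmetric] intro:
            has_field_derivative_at_within)
    moreover have "F (x + 1 *\<^sub>R ee i) - F (x + 0 *\<^sub>R ee i) = 0" using per by (simp add: periodic_def)
    ultimately show ?thesis by (simp add: integral_unique)
  qed
  then have "torus_int (\<lambda>x. integral {0..1} (\<lambda>s. F' (x + s *\<^sub>R ee i))) = 0" by (simp add: torus_int_def)
  then show ?thesis using torus_int_average[OF cont perF'] by simp
qed

lemma torus_int_has_derivative:
  fixes F F' :: "real \<Rightarrow> real^3 \<Rightarrow> real"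
  assumes D: "\<And>t x. t \<in> {0..1} \<Longrightarrow> ((\<lambda>t. F t x) has_real_derivative F' t x) (at t within {0..1})"
    and c: "\<And>t. t \<in> {0..1} \<Longrightarrow> continuous_on UNIV (F t)"
    and c': "continuous_on ({0..1} \<times> UNIV) (\<lambda>(t, x). F' t x)"
    and t: "t \<in> {0..1}"
  shows "((\<lambda>t. torus_int (F t)) has_real_derivative torus_int (F' t)) (at t within {0..1})"
  unfolding torus_int_def has_real_derivative_iff_has_vector_derivative
  by (rule leibniz_rule_vector_derivative)
    (use assms in \<open>auto simp: has_real_derivative_iff_has_vector_derivative
      intro: continuous_on_subset\<close>)

text \<open>The unit cube has measure one, so this is nonnegativity of the variance of
  \<open>\<bar>F x\<bar>\<close>.\<close>

lemma torus_int_cauchy_schwarz: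
  assumes c: "continuous_on UNIV F"
  shows "(torus_int (\<lambda>x. \<bar>F x\<bar>))\<^sup>2 \<le> torus_int (\<lambda>x. (F x)\<^sup>2)"
proof -
  define a where "a = torus_int (\<lambda>x. \<bar>F x\<bar>)"
  have "0 \<le> torus_int (\<lambda>x. (\<bar>F x\<bar> - a)\<^sup>2)"
    by (rule torus_int_nonneg) (auto intro!: continuous_intros c)
  also have "(\<lambda>x. (\<bar>F x\<bar> - a)\<^sup>2) = (\<lambda>x. (F x)\<^sup>2 + a\<^sup>2 - (2 * a) * \<bar>F x\<bar>)"
    by (auto simp: power2_eq_square algebra_simps)
  also have "torus_int \<dots> = torus_int (\<lambda>x. (F x)\<^sup>2) + a\<^sup>2 - (2 * a) * a"
    unfolding a_def
    by (simp add: torus_int_diff torus_int_add torus_int_cmult torus_int_const continuous_intros c)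
  finally show ?thesis by (simp add: a_def power2_eq_square)
qed

lemma torus_int_zero_imp_zero:
  fixes F :: "real^3 \<Rightarrow> real"
  assumes cont: "continuous_on UNIV F" and per: "periodic F" and pos: "\<And>x. 0 \<le> F x"
    and z: "torus_int F = 0"
  shows "F x = 0"
proof -
  have z: "F x = 0" if "x \<in> cbox 0 1" for x
    using integral_cbox_eq_0_iff[of 0 1 F] that z pos cont
    by (auto simp: torus_int_def content_unit_cube interval_ne_empty_cart continuous_on_subset)
  define y where "y = (\<chi> i. frac (x $ i))"
  have xy: "F (z + of_int n *\<^sub>R ee i) = F z" for z n i by (rule periodic_int[OF per])
  have "x = ((y + of_int \<lfloor>x $ 1\<rfloor> *\<^sub>R ee 1) + of_int \<lfloor>x $ 2\<rfloor> *\<^sub>R ee 2) + of_int \<lfloor>x $ 3\<rfloor> *\<^sub>R ee 3"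
    by (simp add: vec_eq_iff forall_3 y_def axis_def frac_def)
  then have "F x = F y" using xy by metis
  moreover have "y \<in> cbox 0 1" by (auto simp: mem_box_cart y_def frac_lt_1 less_imp_le)
  ultimately show ?thesis using z by simp
qed

section \<open>Smooth functions on space-time\<close>

text \<open>The hypothesis of \<open>frechet_derivative_unique_within\<close>, imposed at every point of \<open>S\<close>.\<close>

definition unique_deriv_set :: "'a::euclidean_space set \<Rightarrow> bool" where
  "unique_deriv_set S \<longleftrightarrow>
     (\<forall>x\<in>S. \<forall>i\<in>Basis. \<forall>e>0. \<exists>d. 0 < \<bar>d\<bar> \<and> \<bar>d\<bar> < e \<and> x + d *\<^sub>R i \<in> S)"

abbreviation spacetime :: "(real \<times> (real^3)) set" where "spacetime \<equiv> {0..1} \<times> UNIV"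

lemma unique_deriv_set_UNIV: "unique_deriv_set UNIV"
proof -
  have "\<exists>d. 0 < \<bar>d\<bar> \<and> \<bar>d\<bar> < e" if "e > 0" for e :: real
    using that by (intro exI[of _ "e/2"]) auto
  then show ?thesis by (auto simp: unique_deriv_set_def)
qed

lemma unique_deriv_set_spacetime: "unique_deriv_set spacetime"
  unfolding unique_deriv_set_def
proof (intro ballI allI impI)
  fix x i :: "real \<times> (real^3)" and e :: real
  assume x: "x \<in> spacetime" and i: "i \<in> Basis" and e: "e > 0"
  \<comment> \<open>A step of length at most \<open>1/2\<close>, to the right from the left half and
    to the left from the right half, stays in \<open>{0..1}\<close> even when it starts at an
    endpoint.\<close>
  define d where "d = min (e/2) (1/2)"
  have d: "d > 0" "d < e" "d \<le> 1/2" using e by (auto simp: d_def)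
  have fi: "fst i = 0 \<or> fst i = 1" using i by (auto simp: Basis_prod_def)
  show "\<exists>d. 0 < \<bar>d\<bar> \<and> \<bar>d\<bar> < e \<and> x + d *\<^sub>R i \<in> spacetime"
  proof (cases "fst x \<le> 1/2")
    case True
    then show ?thesis using x d fi
      by (intro exI[of _ d]) (auto simp: mem_Times_iff)
  next
    case False
    then show ?thesis using x d fi
      by (intro exI[of _ "-d"]) (auto simp: mem_Times_iff)
  qed
qed

lemma frechet_derivative_within_eq:
  assumes "unique_deriv_set S" "x \<in> S" "(f has_derivative f') (at x within S)"
  shows "frechet_derivative f (at x within S) = f'"
proof -
  have "(f has_derivative frechet_derivative f (at x within S)) (at x within S)"
    using assms(3) frechet_derivative_works differentiableI by blast
  then show ?thesis
    by (rule frechet_derivative_unique_within[OF _ assms(3)])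
      (use assms(1,2) in \<open>auto simp: unique_deriv_set_def\<close>)
qed

lemma frechet_derivative_within_cong:
  assumes "\<And>x. x \<in> S \<Longrightarrow> f x = g x" "x \<in> S"
  shows "frechet_derivative f (at x within S) = frechet_derivative g (at x within S)"
proof -
  have "(f has_derivative f') (at x within S) \<longleftrightarrow> (g has_derivative f') (at x within S)" for f'
    using assms by (metis has_derivative_transform)
  then show ?thesis by (simp add: frechet_derivative_def)
qed

lemma C_k_on_cong:
  assumes "\<And>x. x \<in> S \<Longrightarrow> f x = g x" "C_k_on k S f"
  shows "C_k_on k S g"
  using assms
proof (induction k arbitrary: f g)
  case 0
  then show ?case using continuous_on_cong by fastforce
next
  case (Suc k)
  have "g differentiable_on S"
    using Suc.prems unfolding differentiable_on_def differentiable_def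
    by (metis C_k_on.simps(2) differentiable_def differentiable_on_def has_derivative_transform)
  moreover have "C_k_on k S (\<lambda>x. frechet_derivative g (at x within S) v)" for v
    by (rule Suc.IH[of "\<lambda>x. frechet_derivative f (at x within S) v"])
      (use Suc.prems frechet_derivative_within_cong[of S f g] in auto)
  ultimately show ?case by simp
qed

text \<open>The recursion of \<open>C_k_on\<close> refers to the chosen
  \<open>frechet_derivative\<close>. Where derivatives are unique, an explicit derivative may stand
  in for it; the closure properties below rest on this rule.\<close>

lemma C_k_on_SucI:
  assumes S: "unique_deriv_set S"
    and D: "\<And>x. x \<in> S \<Longrightarrow> (f has_derivative f' x) (at x within S)"
    and C: "\<And>v. C_k_on k S (\<lambda>x. f' x v)"
  shows "C_k_on (Suc k) S f"
proof -
  have "C_k_on k S (\<lambda>x. frechet_derivative f (at x within S) v)" for v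
    by (rule C_k_on_cong[OF _ C[of v]]) (metis D S frechet_derivative_within_eq)
  moreover have "f differentiable_on S"
    using D by (auto simp: differentiable_on_def intro: differentiableI)
  ultimately show ?thesis by simp
qed

lemma C_k_on_has_derivative:
  assumes "C_k_on (Suc k) S f" "x \<in> S"
  shows "(f has_derivative frechet_derivative f (at x within S)) (at x within S)"
  using assms by (simp add: differentiable_on_def frechet_derivative_works)

lemma C_k_on_add:
  assumes S: "unique_deriv_set S" and "C_k_on k S f" "C_k_on k S g"
  shows "C_k_on k S (\<lambda>x. f x + g x)"
  using assms(2,3)
proof (induction k arbitrary: f g)
  case 0
  then show ?case by (auto intro: continuous_on_add)
next
  case (Suc k)
  show ?case
    by (rule C_k_on_SucI[OF S, where f' = "\<lambda>x v. frechet_derivative f (at x within S) v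
        + frechet_derivative g (at x within S) v"])
      (use Suc in \<open>auto intro!: has_derivative_add C_k_on_has_derivative\<close>)
qed

lemma C_k_on_linear_comp:
  assumes S: "unique_deriv_set S" and L: "bounded_linear L" and "C_k_on k S f"
  shows "C_k_on k S (\<lambda>x. L (f x))"
  using assms(3)
proof (induction k arbitrary: f)
  case 0
  then show ?case using L by (auto intro: bounded_linear.continuous_on)
next
  case (Suc k)
  show ?case
    by (rule C_k_on_SucI[OF S, where f' = "\<lambda>x v. L (frechet_derivative f (at x within S) v)"])
      (use Suc L in \<open>auto intro!: bounded_linear.has_derivative[OF L] C_k_on_has_derivative\<close>)
qed

lemma C_k_on_const: "C_k_on k S (\<lambda>x. c)" if "unique_deriv_set S"
proof (induction k arbitrary: c)
  case (Suc k)
  show ?case by (rule C_k_on_SucI[OF that, where f' = "\<lambda>x v. 0"]) (auto intro: Suc)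
qed auto

lemma smooth_on_directional:
  assumes "smooth_on S f" shows "smooth_on S (\<lambda>x. frechet_derivative f (at x within S) v)"
  using assms unfolding smooth_on_def by (metis C_k_on.simps(2))

lemma smooth_on_has_derivative:
  assumes "smooth_on S f" "x \<in> S"
  shows "(f has_derivative frechet_derivative f (at x within S)) (at x within S)"
  using assms C_k_on_has_derivative unfolding smooth_on_def by blast

section \<open>Slices of a smooth function on space-time and their derivatives\<close>

context
  fixes u :: "real \<Rightarrow> real^3 \<Rightarrow> 'b::real_normed_vector"
  assumes u: "smooth_torus_time u"
begin

lemma smooth_time_continuous: "continuous_on spacetime (\<lambda>(t, x). u t x)"
  using u unfolding smooth_torus_time_def smooth_on_def by (metis C_k_on.simps(1))

text \<open>Smoothness is defined by differentiating jointly in time and space, one-sidedly at the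
  ends of the time interval, whereas \<open>partial_deriv\<close> differentiates a single slice. The
  chain rule along the embedding of the slice links the two.\<close>

lemma smooth_time_space_derivative:
  assumes t: "t \<in> {0..1}"
  shows "(u t has_derivative
    (\<lambda>\<xi>. frechet_derivative (\<lambda>(t, x). u t x) (at (t, x) within spacetime) (0, \<xi>))) (at x)"
proof -
  have "((\<lambda>(t, x). u t x) has_derivative
     frechet_derivative (\<lambda>(t, x). u t x) (at (t, x) within spacetime)) (at (t, x) within spacetime)"
    using u t by (intro smooth_on_has_derivative) (auto simp: smooth_torus_time_def)
  then have "((\<lambda>(t, x). u t x) has_derivative
     frechet_derivative (\<lambda>(t, x). u t x) (at (t, x) within spacetime)) (at (t, x) within (\<lambda>x. (t, x)) ` UNIV)"
    by (rule has_derivative_subset) (use t in auto)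
  then have "((\<lambda>(t, x). u t x) \<circ> (\<lambda>x. (t, x)) has_derivative
     frechet_derivative (\<lambda>(t, x). u t x) (at (t, x) within spacetime) \<circ> (\<lambda>\<xi>. (0, \<xi>))) (at x)"
    by (intro diff_chain_within) (auto intro!: derivative_eq_intros)
  then show ?thesis by (simp add: o_def)
qed

lemma smooth_time_partial_eq:
  assumes t: "t \<in> {0..1}"
  shows "partial_deriv i (u t) x =
    frechet_derivative (\<lambda>(t, x). u t x) (at (t, x) within spacetime) (0, ee i)"
  unfolding partial_deriv_def
  using frechet_derivative_at[OF smooth_time_space_derivative[OF t]] by metis

lemma smooth_time_has_space_derivative:
  assumes t: "t \<in> {0..1}"
  shows "(u t has_derivative frechet_derivative (u t) (at x)) (at x)"
  using smooth_time_space_derivative[OF t] frechet_derivative_works differentiableI by blast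

lemma smooth_time_time_derivative:
  assumes t: "t \<in> {0..1}"
  shows "((\<lambda>s. u s x) has_vector_derivative
    frechet_derivative (\<lambda>(t, x). u t x) (at (t, x) within spacetime) (1, 0)) (at t within {0..1})"
proof -
  let ?D = "frechet_derivative (\<lambda>(t, x). u t x) (at (t, x) within spacetime)"
  have D: "((\<lambda>(t, x). u t x) has_derivative ?D) (at (t, x) within spacetime)"
    using u t by (intro smooth_on_has_derivative) (auto simp: smooth_torus_time_def)
  then have "((\<lambda>(t, x). u t x) has_derivative ?D) (at (t, x) within (\<lambda>s. (s, x)) ` {0..1})"
    by (rule has_derivative_subset) auto
  then have "((\<lambda>(t, x). u t x) \<circ> (\<lambda>s. (s, x)) has_derivative ?D \<circ> (\<lambda>\<tau>. (\<tau>, 0))) (at t within {0..1})"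
    by (intro diff_chain_within) (auto intro!: derivative_eq_intros)
  moreover have "?D \<circ> (\<lambda>\<tau>. (\<tau>, 0)) = (\<lambda>\<tau>. \<tau> *\<^sub>R ?D (1, 0))"
  proof
    fix \<tau>
    show "(?D \<circ> (\<lambda>\<tau>. (\<tau>, 0))) \<tau> = \<tau> *\<^sub>R ?D (1, 0)"
      using linear_scale[OF has_derivative_linear[OF D], of \<tau> "(1, 0)"] by simp
  qed
  ultimately show ?thesis unfolding has_vector_derivative_def by (simp only: o_def prod.case)
qed

lemma smooth_time_partial: "smooth_torus_time (\<lambda>t. partial_deriv i (u t))"
proof -
  have "periodic (partial_deriv i (u t))" if t: "t \<in> {0..1}" for t
    unfolding periodic_def
  proof (intro allI)
    fix x k
    have "(\<lambda>y. u t (y + ee k)) = u t"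
      using u t by (auto simp: smooth_torus_time_def periodic_def)
    moreover have "(u t \<circ> (\<lambda>y. y + ee k) has_derivative
        frechet_derivative (u t) (at (x + ee k)) \<circ> (\<lambda>\<xi>. \<xi>)) (at x)"
      by (rule diff_chain_at) (auto intro!: derivative_eq_intros smooth_time_has_space_derivative[OF t])
    ultimately have "(u t has_derivative frechet_derivative (u t) (at (x + ee k))) (at x)"
      by (simp add: o_def)
    then show "partial_deriv i (u t) (x + ee k) = partial_deriv i (u t) x"
      unfolding partial_deriv_def using frechet_derivative_at by metis
  qed
  moreover have "smooth_on spacetime (\<lambda>(t, x). partial_deriv i (u t) x)"
    unfolding smooth_on_def
  proof
    fix k
    have "C_k_on k spacetime (\<lambda>z. frechet_derivative (\<lambda>(t, x). u t x) (at z within spacetime) (0, ee i))"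
      using u smooth_on_directional unfolding smooth_torus_time_def smooth_on_def by metis
    then show "C_k_on k spacetime (\<lambda>(t, x). partial_deriv i (u t) x)"
      by (rule C_k_on_cong[rotated]) (auto simp: smooth_time_partial_eq)
  qed
  ultimately show ?thesis by (simp add: smooth_torus_time_def)
qed

lemma smooth_time_partial_line:
  assumes t: "t \<in> {0..1}"
  shows "((\<lambda>h. u t (x + h *\<^sub>R ee i)) has_vector_derivative partial_deriv i (u t) x) (at 0)"
proof -
  have "(u t \<circ> (\<lambda>h. x + h *\<^sub>R ee i) has_derivative
      frechet_derivative (u t) (at x) \<circ> (\<lambda>h. h *\<^sub>R ee i)) (at 0)"
    by (rule diff_chain_at) (auto intro!: derivative_eq_intros smooth_time_has_space_derivative[OF t])
  moreover have "frechet_derivative (u t) (at x) (h *\<^sub>R ee i)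
      = h *\<^sub>R frechet_derivative (u t) (at x) (ee i)" for h
    by (rule linear_scale[OF has_derivative_linear[OF smooth_time_has_space_derivative[OF t]]])
  ultimately show ?thesis
    by (simp add: o_def has_vector_derivative_def partial_deriv_def)
qed

lemma smooth_time_slice_continuous: "t \<in> {0..1} \<Longrightarrow> continuous_on UNIV (u t)"
  using continuous_on_compose2[OF smooth_time_continuous, of UNIV "\<lambda>x. (t, x)"]
  by (simp add: image_subset_iff continuous_on_Pair)

lemma smooth_time_periodic: "t \<in> {0..1} \<Longrightarrow> periodic (u t)"
  using u by (simp add: smooth_torus_time_def)

end

lemma smooth_time_deriv_eq:
  fixes u :: "real \<Rightarrow> real^3 \<Rightarrow> real^3"
  assumes u: "smooth_torus_time u" and t: "t \<in> {0..1}"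
  shows "time_deriv u t x = frechet_derivative (\<lambda>(t, x). u t x) (at (t, x) within spacetime) (1, 0)"
  unfolding time_deriv_def
  by (rule vector_derivative_within_closed_interval[of 0 1 t "\<lambda>s. u s x"])
    (use smooth_time_time_derivative[OF u t, of x] t in auto)

lemma smooth_time_deriv:
  fixes u :: "real \<Rightarrow> real^3 \<Rightarrow> real^3"
  assumes u: "smooth_torus_time u" and t: "t \<in> {0..1}"
  shows "((\<lambda>s. u s x) has_vector_derivative time_deriv u t x) (at t within {0..1})"
  unfolding smooth_time_deriv_eq[OF u t] by (rule smooth_time_time_derivative[OF u t])

lemma smooth_time_deriv_continuous:
  fixes u :: "real \<Rightarrow> real^3 \<Rightarrow> real^3"
  assumes u: "smooth_torus_time u"
  shows "continuous_on spacetime (\<lambda>(t, x). time_deriv u t x)"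
proof -
  have "smooth_on spacetime (\<lambda>z. frechet_derivative (\<lambda>(t, x). u t x) (at z within spacetime) (1, 0))"
    using u by (intro smooth_on_directional) (simp add: smooth_torus_time_def)
  then have "continuous_on spacetime (\<lambda>z. frechet_derivative (\<lambda>(t, x). u t x) (at z within spacetime) (1, 0))"
    unfolding smooth_on_def by (metis C_k_on.simps(1))
  then show ?thesis
    by (rule continuous_on_eq) (auto simp: smooth_time_deriv_eq[OF u])
qed

section \<open>Uniqueness of the velocity\<close>

lemma inner_has_real_derivative:
  assumes "(f has_vector_derivative f') (at t within S)" "(g has_vector_derivative g') (at t within S)"
  shows "((\<lambda>h. f h \<bullet> g h) has_real_derivative (f' \<bullet> g t + f t \<bullet> g')) (at t within S)"
  using bounded_bilinear.has_vector_derivative[OF bounded_bilinear_inner assms]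
  by (simp add: has_real_derivative_iff_has_vector_derivative add.commute)

lemma nth_has_real_derivative:
  assumes "(f has_vector_derivative f') (at t within S)"
  shows "((\<lambda>h. f h $ i) has_real_derivative f' $ i) (at t within S)"
  using bounded_linear.has_vector_derivative[OF bounded_linear_vec_nth assms]
  by (simp add: has_real_derivative_iff_has_vector_derivative)

text \<open>Integrated comparison with derivatives taken within the interval, hence one-sided at its
  ends. It carries the estimates of energies, kernels and amplitudes below, Gronwall arguments
  included.\<close>

lemma derivative_le_imp_le:
  fixes f g :: "real \<Rightarrow> real"
  assumes ab: "a \<le> b"
    and "\<And>s. s \<in> {a..b} \<Longrightarrow> (f has_real_derivative f' s) (at s within {a..b})"
    and "\<And>s. s \<in> {a..b} \<Longrightarrow> (g has_real_derivative g' s) (at s within {a..b})"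
    and "\<And>s. s \<in> {a..b} \<Longrightarrow> f' s \<le> g' s"
  shows "f b - f a \<le> g b - g a"
proof (rule has_integral_le)
  show "(f' has_integral f b - f a) {a..b}"
    by (intro fundamental_theorem_of_calculus)
      (use assms in \<open>auto simp: has_real_derivative_iff_has_vector_derivative\<close>)
  show "(g' has_integral g b - g a) {a..b}"
    by (intro fundamental_theorem_of_calculus)
      (use assms in \<open>auto simp: has_real_derivative_iff_has_vector_derivative\<close>)
qed (use assms in auto)

lemma periodic_reduce:
  fixes x :: "real^3"
  obtains y where "y \<in> cbox 0 1" "\<And>g :: real^3 \<Rightarrow> 'b. periodic g \<Longrightarrow> g x = g y"
proof
  define y where "y = (\<chi> i. frac (x $ i))"
  show "y \<in> cbox 0 1" by (auto simp: mem_box_cart y_def frac_lt_1 less_imp_le)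
  fix g :: "real^3 \<Rightarrow> 'b" assume "periodic g"
  then have "g (z + of_int n *\<^sub>R ee i) = g z" for z n i by (rule periodic_int)
  moreover have "x = ((y + of_int \<lfloor>x $ 1\<rfloor> *\<^sub>R ee 1) + of_int \<lfloor>x $ 2\<rfloor> *\<^sub>R ee 2) + of_int \<lfloor>x $ 3\<rfloor> *\<^sub>R ee 3"
    by (simp add: vec_eq_iff forall_3 y_def axis_def frac_def)
  ultimately show "g x = g y" by metis
qed

text \<open>Periodicity reduces the bound to the compact set
  \<open>{0..1} \<times> cbox 0 1\<close>.\<close>

lemma smooth_time_bounded:
  fixes g :: "real \<Rightarrow> real^3 \<Rightarrow> 'b::real_normed_vector"
  assumes g: "smooth_torus_time g"
  obtains M where "0 \<le> M" "\<And>t x. t \<in> {0..1} \<Longrightarrow> norm (g t x) \<le> M"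
proof -
  have "compact ((\<lambda>(t, x). g t x) ` ({0..1} \<times> cbox 0 1))"
    by (intro compact_continuous_image continuous_on_subset[OF smooth_time_continuous[OF g]] compact_Times)
      auto
  then obtain M where M: "norm z \<le> M" if "z \<in> (\<lambda>(t, x). g t x) ` ({0..1} \<times> cbox 0 1)" for z
    using compact_imp_bounded bounded_iff by metis
  show ?thesis
  proof
    show "norm (g t x) \<le> max 0 M" if t: "t \<in> {0..1}" for t x
    proof -
      obtain y where y: "y \<in> cbox 0 1" "\<And>g :: real^3 \<Rightarrow> 'b. periodic g \<Longrightarrow> g x = g y"
        using periodic_reduce by blast
      have "g t x = g t y" using y(2) smooth_time_periodic[OF g t] by blast
      then show ?thesis using M[of "g t y"] y t by force
    qed
  qed simp
qed

text \<open>Energy method for the difference \<open>w\<close>. Paired with \<open>w\<close>, the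
  pressure and the transport by \<open>v\<close> are divergences, the viscous term has a sign, and
  the remaining term is at most \<open>2 * C\<close> times the energy because the gradient of the
  smooth solution \<open>u\<close> is bounded. Only velocities are compared, since pressures may
  differ by a function of time.\<close>

lemma navier_stokes_unique:
  assumes nu: "\<nu> \<ge> 0"
    and U: "navier_stokes_solution \<nu> f u0 u p" and V: "navier_stokes_solution \<nu> f u0 v q"
    and t: "t \<in> {0..1}"
  shows "v t x = u t x"
proof -
  have su: "smooth_torus_time u" and sv: "smooth_torus_time v"
    and sp: "smooth_torus_time p" and sq: "smooth_torus_time q"
    using U V by (auto simp: navier_stokes_solution_def)
  define w where "w t x = v t x - u t x" for t x
  define \<pi> where "\<pi> t x = q t x - p t x" for t x
  define wi where "wi i t x = partial_deriv i (v t) x - partial_deriv i (u t) x" for i t x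
  define wave_second where "wave_second i t x = partial_deriv i (partial_deriv i (v t)) x - partial_deriv
      i (partial_deriv i (u t)) x" for i t x
  define \<pi>i where "\<pi>i i t x = partial_deriv i (q t) x - partial_deriv i (p t) x" for i t x
  note spu = smooth_time_partial[OF su] and spv = smooth_time_partial[OF sv]
    and spp = smooth_time_partial[OF sp] and spq = smooth_time_partial[OF sq]
  note sppu = smooth_time_partial[OF spu] and sppv = smooth_time_partial[OF spv]
  have Dw: "((\<lambda>h. w t (x + h *\<^sub>R ee i)) has_vector_derivative wi i t x) (at 0)" if "t \<in> {0..1}" for t x i
    unfolding w_def wi_def
    by (intro has_vector_derivative_diff smooth_time_partial_line su sv that)
  have Dwi: "((\<lambda>h. wi i t (x + h *\<^sub>R ee i)) has_vector_derivative wave_second i t x) (at 0)"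
    if "t \<in> {0..1}" for t x i
    unfolding wi_def wave_second_def
    by (intro has_vector_derivative_diff smooth_time_partial_line spu spv that)
  have D\<pi>: "((\<lambda>h. \<pi> t (x + h *\<^sub>R ee i)) has_real_derivative \<pi>i i t x) (at 0)" if "t \<in> {0..1}" for t x i
    unfolding \<pi>_def \<pi>i_def has_real_derivative_iff_has_vector_derivative
    by (intro has_vector_derivative_diff smooth_time_partial_line sp sq that)
  define wt where "wt t x = time_deriv v t x - time_deriv u t x" for t x
  have Dt: "((\<lambda>s. w s x) has_vector_derivative wt t x) (at t within {0..1})" if "t \<in> {0..1}" for t x
    unfolding w_def wt_def by (intro has_vector_derivative_diff smooth_time_deriv su sv that)
  have cwt: "continuous_on spacetime (\<lambda>(t, x). wt t x)"
    unfolding wt_def using continuous_on_diff[OF smooth_time_deriv_continuous[OF sv]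
        smooth_time_deriv_continuous[OF su]]
    by (simp add: split_def)
  have cw: "continuous_on spacetime (\<lambda>(t, x). w t x)"
    unfolding w_def using continuous_on_diff[OF smooth_time_continuous[OF sv] smooth_time_continuous[OF su]]
    by (simp add: split_def)
  define E where "E t = torus_int (\<lambda>x. w t x \<bullet> w t x)" for t
  note continuous_slice = smooth_time_slice_continuous
  have cw1: "continuous_on UNIV (w t)" and cwi1: "continuous_on UNIV (wi i t)"
    and cwii1: "continuous_on UNIV (wave_second i t)" and c\<pi>1: "continuous_on UNIV (\<pi> t)"
    and c\<pi>i1: "continuous_on UNIV (\<pi>i i t)" if "t \<in> {0..1}" for t i
    unfolding w_def wi_def wave_second_def \<pi>_def \<pi>i_def
    using that by (intro continuous_on_diff continuous_slice[OF su] continuous_slice[OF sv]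
        continuous_slice[OF sp] continuous_slice[OF sq] continuous_slice[OF spu]
      continuous_slice[OF spv] continuous_slice[OF spp] continuous_slice[OF spq] continuous_slice[OF
          sppu] continuous_slice[OF sppv]; assumption)+
  have DE: "(E has_real_derivative torus_int (\<lambda>x. 2 * (w t x \<bullet> wt t x))) (at t within {0..1})"
    if t: "t \<in> {0..1}" for t
    unfolding E_def
  proof (rule torus_int_has_derivative[OF _ _ _ t])
    show "((\<lambda>t. w t x \<bullet> w t x) has_real_derivative 2 * (w t x \<bullet> wt t x)) (at t within {0..1})"
      if "t \<in> {0..1}" for t x
      using inner_has_real_derivative[OF Dt[OF that, of x] Dt[OF that, of x]]
      by (simp add: inner_commute)
    show "continuous_on UNIV (\<lambda>x. w t x \<bullet> w t x)" if "t \<in> {0..1}" for t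
      by (intro continuous_intros cw1 that)
    show "continuous_on spacetime (\<lambda>(t, x). 2 * (w t x \<bullet> wt t x))"
      using continuous_on_inner[OF cw cwt] by (auto simp: split_def intro!: continuous_intros)
  qed
  define M where "M t x = (\<Sum>i\<in>UNIV. norm (partial_deriv i (u t) x))" for t x
  have "\<exists>B. \<forall>t\<in>{0..1}. \<forall>x. norm (partial_deriv i (u t) x) \<le> B" for i
    by (rule smooth_time_bounded[OF spu]) blast
  then have "\<exists>B. \<forall>i. \<forall>t\<in>{0..1}. \<forall>x. norm (partial_deriv i (u t) x) \<le> B i"
    by (intro choice) blast
  then obtain B where B: "\<And>i t x. t \<in> {0..1} \<Longrightarrow> norm (partial_deriv i (u t) x) \<le> B i"
    by blast
  define C where "C = (\<Sum>i\<in>UNIV. B i)"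
  have MC: "M t x \<le> C" if "t \<in> {0..1}" for t x
    unfolding M_def C_def by (intro sum_mono B that)
  have cv1: "continuous_on UNIV (v t)" if "t \<in> {0..1}" for t using that continuous_slice sv by blast
  have cpu1: "continuous_on UNIV (partial_deriv i (u t))" if "t \<in> {0..1}" for t i
    using that continuous_slice spu by blast
  have cpv1: "continuous_on UNIV (partial_deriv i (v t))" if "t \<in> {0..1}" for t i
    using that continuous_slice spv by blast
  have bound: "torus_int (\<lambda>x. 2 * (w t x \<bullet> wt t x)) \<le> 2 * C * E t" if t: "t \<in> {0..1}" for t
  proof -
    \<comment> \<open>The viscous, convective and pressure fluxes of the energy balance. Summed over
      \<open>i\<close>, their derivatives \<open>G'\<close> differ from twice the product of
      \<open>w\<close> with its time derivative by the signed viscous term and the stretching term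
      of \<open>u\<close> alone.\<close>
    define G where "G i x = 2 * \<nu> * (w t x \<bullet> wi i t x) - v t x $ i * (w t x \<bullet> w t x) - 2 * w t x $ i * \<pi>
        t x" for i x
    define G' where "G' i x = 2 * \<nu> * (wi i t x \<bullet> wi i t x + w t x \<bullet> wave_second i t x)
       - (partial_deriv i (v t) x $ i * (w t x \<bullet> w t x) + v t x $ i * (2 * (w t x \<bullet> wi i t x)))
       - 2 * (wi i t x $ i * \<pi> t x + w t x $ i * \<pi>i i t x)" for i x
    have "((\<lambda>h. G i (x + h *\<^sub>R ee i)) has_real_derivative G' i x) (at 0)" for i x
      unfolding G_def G'_def
      by (rule DERIV_cong, (rule DERIV_diff DERIV_mult DERIV_const inner_has_real_derivative Dw Dwi D\<pi>
          nth_has_real_derivative smooth_time_partial_line[OF sv] t)+)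
        (simp add: inner_commute algebra_simps)
    moreover have "periodic (G i)" for i
    proof -
      have "periodic (v t)" "periodic (u t)" "periodic (p t)" "periodic (q t)"
        "periodic (partial_deriv i (v t))" "periodic (partial_deriv i (u t))"
        using t su sv sp sq spu spv smooth_time_periodic by blast+
      then show ?thesis unfolding G_def w_def wi_def \<pi>_def by (simp add: periodic_def)
    qed
    moreover have cG': "continuous_on UNIV (G' i)" for i
      unfolding G'_def
      by (intro continuous_intros cw1 cwi1 cwii1 c\<pi>1 c\<pi>i1 cv1 cpv1 t)
    ultimately have G0: "torus_int (G' i) = 0" for i using torus_int_partial_zero by blast
    have eq: "2 * (w t x \<bullet> wt t x) = (\<Sum>i\<in>UNIV. G' i x)
        - (2 * \<nu> * (\<Sum>i\<in>UNIV. wi i t x \<bullet> wi i t x)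
         + 2 * (\<Sum>i\<in>UNIV. w t x $ i * (w t x \<bullet> partial_deriv i (u t) x)))" for x
    proof -
      have eu: "time_deriv u t x = \<nu> *\<^sub>R laplacian (u t) x + f t x - gradient (p t) x - advection (u t) (u t) x"
        and du: "divergence (u t) x = 0"
        using U t unfolding navier_stokes_solution_def by (force simp: algebra_simps)+
      have ev: "time_deriv v t x = \<nu> *\<^sub>R laplacian (v t) x + f t x - gradient (q t) x - advection (v t) (v t) x"
        and dv: "divergence (v t) x = 0"
        using V t unfolding navier_stokes_solution_def by (force simp: algebra_simps)+
      \<comment> \<open>The difference of the quadratic terms is split into the transport of
        \<open>w\<close> by \<open>v\<close> and \<open>w\<close> acting on the gradient of
        \<open>u\<close>; the first of these yields a divergence in the energy balance.\<close>
      have wt: "wt t x = \<nu> *\<^sub>R (\<Sum>i\<in>UNIV. wave_second i t x) - (\<chi> i. \<pi>i i t x)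
         - (\<Sum>i\<in>UNIV. v t x $ i *\<^sub>R wi i t x) - (\<Sum>i\<in>UNIV. w t x $ i *\<^sub>R partial_deriv i (u t) x)"
        unfolding wt_def eu ev laplacian_def gradient_def advection_def wave_second_def \<pi>i_def wi_def w_def
        by (simp add: sum_subtractf scaleR_diff_right scaleR_diff_left vec_eq_iff algebra_simps)
      have div: "(\<Sum>i\<in>UNIV. wi i t x $ i) = 0" and divv: "(\<Sum>i\<in>UNIV. partial_deriv i (v t) x $ i) = 0"
        using du dv by (simp_all add: divergence_def wi_def sum_subtractf)
      have "(\<Sum>i\<in>UNIV. G' i x) = 2 * \<nu> * (\<Sum>i\<in>UNIV. wi i t x \<bullet> wi i t x)
         + 2 * \<nu> * (\<Sum>i\<in>UNIV. w t x \<bullet> wave_second i t x)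
         - (\<Sum>i\<in>UNIV. partial_deriv i (v t) x $ i) * (w t x \<bullet> w t x)
         - 2 * (\<Sum>i\<in>UNIV. v t x $ i * (w t x \<bullet> wi i t x))
         - 2 * (\<Sum>i\<in>UNIV. wi i t x $ i) * \<pi> t x - 2 * (\<Sum>i\<in>UNIV. w t x $ i * \<pi>i i t x)"
        unfolding G'_def
        by (simp add: sum_subtractf sum.distrib sum_distrib_left sum_distrib_right algebra_simps)
      note this
      moreover have alg: "2 * (\<nu> * a - b - c - d) = 2 * \<nu> * e + 2 * \<nu> * a - 0 * g - 2 * c - 2 * 0 * h - 2 * b
          - (2 * \<nu> * e + 2 * d)" for a b c d e g h :: real
        by (simp add: algebra_simps)
      moreover have "w t x \<bullet> (\<chi> i. \<pi>i i t x) = (\<Sum>i\<in>UNIV. w t x $ i * \<pi>i i t x)"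
        by (simp add: inner_vec_def)
      moreover have "w t x \<bullet> (\<Sum>i\<in>UNIV. v t x $ i *\<^sub>R wi i t x) = (\<Sum>i\<in>UNIV. v t x $ i * (w t x \<bullet> wi i t x))"
        by (simp add: inner_sum_right)
      moreover have "w t x \<bullet> (\<Sum>i\<in>UNIV. w t x $ i *\<^sub>R partial_deriv i (u t) x)
          = (\<Sum>i\<in>UNIV. w t x $ i * (w t x \<bullet> partial_deriv i (u t) x))"
        by (simp add: inner_sum_right)
      moreover have "w t x \<bullet> (\<nu> *\<^sub>R (\<Sum>i\<in>UNIV. wave_second i t x)) = \<nu> * (\<Sum>i\<in>UNIV. w t x \<bullet> wave_second i t x)"
        by (simp add: inner_sum_right)
      ultimately show ?thesis unfolding wt div divv inner_diff_right by (simp only: alg)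
    qed
    have "torus_int (\<lambda>x. 2 * (w t x \<bullet> wt t x)) \<le> torus_int (\<lambda>x. (\<Sum>i\<in>UNIV. G' i x) + 2 * C * (w t x \<bullet> w t x))"
    proof (rule torus_int_mono)
      show "continuous_on UNIV (\<lambda>x. 2 * (w t x \<bullet> wt t x))"
        unfolding eq by (intro continuous_intros cG' cwi1 cw1 cpu1 t)
      show "continuous_on UNIV (\<lambda>x. (\<Sum>i\<in>UNIV. G' i x) + 2 * C * (w t x \<bullet> w t x))"
        by (intro continuous_intros cG' cw1 t)
      fix x
      have "- (w t x $ i * (w t x \<bullet> partial_deriv i (u t) x))
          \<le> norm (w t x) * (norm (w t x) * norm (partial_deriv i (u t) x))" for i
      proof -
        have "\<bar>w t x $ i * (w t x \<bullet> partial_deriv i (u t) x)\<bar>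
            \<le> norm (w t x) * (norm (w t x) * norm (partial_deriv i (u t) x))"
          unfolding abs_mult
          by (intro mult_mono Cauchy_Schwarz_ineq2 component_le_norm_cart) auto
        then show ?thesis by linarith
      qed
      then have "- (\<Sum>i\<in>UNIV. w t x $ i * (w t x \<bullet> partial_deriv i (u t) x))
          \<le> (\<Sum>i\<in>UNIV. norm (w t x) * (norm (w t x) * norm (partial_deriv i (u t) x)))"
        unfolding sum_negf[symmetric] by (intro sum_mono) auto
      also have "\<dots> = M t x * (w t x \<bullet> w t x)"
        unfolding M_def sum_distrib_right by (simp add: dot_square_norm power2_eq_square mult_ac)
      also have "\<dots> \<le> C * (w t x \<bullet> w t x)" by (intro mult_right_mono MC t) auto
      finally have "- (\<Sum>i\<in>UNIV. w t x $ i * (w t x \<bullet> partial_deriv i (u t) x)) \<le> C * (w t x \<bullet> w t x)" .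
      moreover have "0 \<le> \<nu> * (\<Sum>i\<in>UNIV. wi i t x \<bullet> wi i t x)"
        using nu by (intro mult_nonneg_nonneg sum_nonneg) auto
      ultimately show "2 * (w t x \<bullet> wt t x) \<le> (\<Sum>i\<in>UNIV. G' i x) + 2 * C * (w t x \<bullet> w t x)"
        unfolding eq by linarith
    qed
    also have "\<dots> = 2 * C * E t"
      unfolding E_def
      by (subst torus_int_add) (auto intro!: continuous_intros cG' cw1 t simp: torus_int_sum cG' G0
          torus_int_cmult)
    finally show ?thesis .
  qed
  \<comment> \<open>Gronwall: with this factor the energy is nonincreasing, and it vanishes at time
    0.\<close>
  have "exp (- 2 * C * t) * E t - exp (- 2 * C * 0) * E 0 \<le> 0 - 0"
  proof (rule derivative_le_imp_le[where f = "\<lambda>t. exp (- 2 * C * t) * E t" and g = "\<lambda>t. 0"])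
    fix s assume s: "s \<in> {0..t}"
    then have s1: "s \<in> {0..1}" using t by auto
    show "((\<lambda>t. exp (- 2 * C * t) * E t) has_real_derivative
        exp (- 2 * C * s) * (torus_int (\<lambda>x. 2 * (w s x \<bullet> wt s x)) - 2 * C * E s)) (at s within {0..t})"
      by (rule DERIV_subset[OF _ , of _ _ _ "{0..1}"])
       (use t in \<open>auto intro!: derivative_eq_intros DE[OF s1] simp: algebra_simps\<close>)
    show "exp (- 2 * C * s) * (torus_int (\<lambda>x. 2 * (w s x \<bullet> wt s x)) - 2 * C * E s) \<le> 0"
      using bound[OF s1] by (intro mult_nonneg_nonpos) auto
  qed (use t in auto)
  moreover have "E 0 = 0"
  proof -
    have "w 0 = (\<lambda>x. 0)" using U V by (auto simp: navier_stokes_solution_def w_def)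
    then show ?thesis by (simp add: E_def torus_int_def)
  qed
  ultimately have "E t \<le> 0" by (simp add: mult_le_0_iff)
  moreover have "E t \<ge> 0" unfolding E_def by (intro torus_int_nonneg continuous_intros cw1 t) auto
  ultimately have "E t = 0" by simp
  moreover have "periodic (\<lambda>x. w t x \<bullet> w t x)"
    using smooth_time_periodic[OF su t] smooth_time_periodic[OF sv t] by (simp add: periodic_def w_def)
  ultimately have "w t x \<bullet> w t x = 0"
    unfolding E_def using torus_int_zero_imp_zero[of "\<lambda>x. w t x \<bullet> w t x" x] cw1[OF t]
    by (simp add: continuous_on_inner)
  then show ?thesis by (simp add: w_def)
qed

section \<open>Smooth functions of one variable\<close>

text \<open>Counterpart of \<open>C_k_on\<close> for the time amplitudes. They live on the whole
  line, so no one-sided derivatives occur, and the existential quantifier lets a derivative be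
  supplied as a witness.\<close>

primrec Ck_real :: "nat \<Rightarrow> (real \<Rightarrow> real) \<Rightarrow> bool" where
  "Ck_real 0 c \<longleftrightarrow> continuous_on UNIV c"
| "Ck_real (Suc k) c \<longleftrightarrow> (\<exists>c'. (\<forall>t. (c has_real_derivative c' t) (at t)) \<and> Ck_real k c')"

definition smooth_real :: "(real \<Rightarrow> real) \<Rightarrow> bool" where
  "smooth_real c \<longleftrightarrow> (\<forall>k. Ck_real k c)"

lemma Ck_real_SucD: "Ck_real (Suc k) c \<Longrightarrow> Ck_real k c"
proof (induction k arbitrary: c)
  case 0
  then show ?case by (auto intro: DERIV_continuous_on)
next
  case (Suc k)
  from Suc.prems obtain c' where c': "\<And>t. (c has_real_derivative c' t) (at t)" "Ck_real (Suc k) c'"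
    unfolding Ck_real.simps(2)[of "Suc k" c] by blast
  then show ?case using Suc.IH[OF c'(2)] unfolding Ck_real.simps(2)[of k c] by blast
qed

lemma Ck_real_SucI: "(\<And>t. (c has_real_derivative c' t) (at t)) \<Longrightarrow> Ck_real k c' \<Longrightarrow> Ck_real (Suc k) c"
  by auto

lemma Ck_real_const: "Ck_real k (\<lambda>t. a)"
proof (induction k arbitrary: a)
  case (Suc k)
  show ?case by (rule Ck_real_SucI[of _ "\<lambda>t. 0"]) (auto intro: Suc)
qed auto

lemma Ck_real_add: "Ck_real k f \<Longrightarrow> Ck_real k g \<Longrightarrow> Ck_real k (\<lambda>t. f t + g t)"
proof (induction k arbitrary: f g)
  case (Suc k)
  then obtain f' g' where "\<And>t. (f has_real_derivative f' t) (at t)" "Ck_real k f'"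
    "\<And>t. (g has_real_derivative g' t) (at t)" "Ck_real k g'" by auto
  then show ?case by (intro Ck_real_SucI[of _ "\<lambda>t. f' t + g' t"]) (auto intro!: derivative_intros Suc.IH)
qed (auto intro: continuous_intros)

lemma Ck_real_mult: "Ck_real k f \<Longrightarrow> Ck_real k g \<Longrightarrow> Ck_real k (\<lambda>t. f t * g t)"
proof (induction k arbitrary: f g)
  case (Suc k)
  then obtain f' g' where D: "\<And>t. (f has_real_derivative f' t) (at t)" "Ck_real k f'"
    "\<And>t. (g has_real_derivative g' t) (at t)" "Ck_real k g'" by auto
  show ?case
  proof (rule Ck_real_SucI[of _ "\<lambda>t. f' t * g t + f t * g' t"])
    show "((\<lambda>t. f t * g t) has_real_derivative f' t * g t + f t * g' t) (at t)" for t
      by (rule DERIV_cong, rule DERIV_mult[OF D(1) D(3)]) (simp add: algebra_simps)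
    show "Ck_real k (\<lambda>t. f' t * g t + f t * g' t)"
      by (intro Ck_real_add Suc.IH D Ck_real_SucD[OF Suc.prems(1)] Ck_real_SucD[OF Suc.prems(2)])
  qed
qed (auto intro: continuous_intros)

lemma Ck_real_compose_affine: "Ck_real k f \<Longrightarrow> Ck_real k (\<lambda>t. f (a * t + b))"
proof (induction k arbitrary: f)
  case 0
  then show ?case by (auto intro!: continuous_intros continuous_on_compose2[of UNIV f])
next
  case (Suc k)
  then obtain f' where D: "\<And>t. (f has_real_derivative f' t) (at t)" "Ck_real k f'" by auto
  show ?case
  proof (rule Ck_real_SucI[of _ "\<lambda>t. a * f' (a * t + b)"])
    show "((\<lambda>t. f (a * t + b)) has_real_derivative a * f' (a * t + b)) (at t)" for t
      by (rule DERIV_cong, rule DERIV_chain2[OF D(1)]) (auto intro!: derivative_eq_intros)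
    show "Ck_real k (\<lambda>t. a * f' (a * t + b))" by (intro Ck_real_mult Ck_real_const Suc.IH D)
  qed
qed

lemma smooth_real_const: "smooth_real (\<lambda>t. a)" by (simp add: smooth_real_def Ck_real_const)
lemma smooth_real_add: "smooth_real f \<Longrightarrow> smooth_real g \<Longrightarrow> smooth_real (\<lambda>t. f t + g t)"
  by (simp add: smooth_real_def Ck_real_add)
lemma smooth_real_mult: "smooth_real f \<Longrightarrow> smooth_real g \<Longrightarrow> smooth_real (\<lambda>t. f t * g t)"
  by (simp add: smooth_real_def Ck_real_mult)
lemma smooth_real_cmult: "smooth_real f \<Longrightarrow> smooth_real (\<lambda>t. a * f t)"
  by (simp add: smooth_real_mult smooth_real_const)
lemma smooth_real_compose_affine: "smooth_real f \<Longrightarrow> smooth_real (\<lambda>t. f (a * t + b))"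
  by (simp add: smooth_real_def Ck_real_compose_affine)

lemma smooth_real_continuous: "smooth_real f \<Longrightarrow> continuous_on S f"
  unfolding smooth_real_def by (metis Ck_real.simps(1) continuous_on_subset subset_UNIV)

lemma smooth_real_derivative:
  assumes "smooth_real c"
  obtains c' where "smooth_real c'" "\<And>t. (c has_real_derivative c' t) (at t)"
proof
  have D: "(c has_real_derivative deriv c t) (at t)" for t
    using assms unfolding smooth_real_def by (metis Ck_real.simps(2) DERIV_imp_deriv)
  then show "(c has_real_derivative deriv c t) (at t)" for t .
  show "smooth_real (deriv c)"
    unfolding smooth_real_def
  proof
    fix k
    have "Ck_real (Suc k) c" using assms by (simp add: smooth_real_def)
    then obtain c' where c': "\<And>t. (c has_real_derivative c' t) (at t)" "Ck_real k c'" by auto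
    then have "c' = deriv c" by (intro ext) (metis DERIV_imp_deriv)
    then show "Ck_real k (deriv c)" using c' by simp
  qed
qed

lemma smooth_real_of_derivative:
  assumes "smooth_real c'" "\<And>t. (c has_real_derivative c' t) (at t)"
  shows "smooth_real c"
  unfolding smooth_real_def
proof
  fix k
  have "Ck_real (Suc k) c" using assms by (intro Ck_real_SucI[of _ c']) (auto simp: smooth_real_def)
  then show "Ck_real k c" by (rule Ck_real_SucD)
qed

text \<open>Bootstrapping: if \<open>c\<close> has \<open>k\<close> continuous derivatives, then so
  has \<open>a * c t + F t\<close>, which is the derivative of \<open>c\<close>. The amplitudes from
  Duhamel's formula are smooth for this reason.\<close>

lemma smooth_real_linear_ode:
  assumes D: "\<And>t. (c has_real_derivative a * c t + F t) (at t)" and F: "smooth_real F"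
  shows "smooth_real c"
  unfolding smooth_real_def
proof
  fix k show "Ck_real k c"
  proof (induction k)
    case 0
    show ?case unfolding Ck_real.simps by (rule DERIV_continuous_on) (rule D)
  next
    case (Suc k)
    show ?case
      by (rule Ck_real_SucI[OF D]) (use Suc F in \<open>auto intro!: Ck_real_add Ck_real_mult Ck_real_const
          simp: smooth_real_def\<close>)
  qed
qed

lemma smooth_real_exp: "smooth_real (\<lambda>t. exp (a * t))"
  by (rule smooth_real_linear_ode[where a = a and F = "\<lambda>t. 0"])
    (auto intro!: derivative_eq_intros smooth_real_const)

text \<open>Stated on the whole line rather than as an integral from 0, so that derivatives are
  two-sided at the ends of the time interval too.\<close>

lemma antiderivative_real:
  fixes f :: "real \<Rightarrow> real"
  assumes "continuous_on UNIV f"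
  shows "\<exists>F. F 0 = 0 \<and> (\<forall>t. (F has_real_derivative f t) (at t))"
proof -
  have "\<exists>F. \<forall>x :: real. -\<infinity> < ereal x \<longrightarrow> ereal x < \<infinity> \<longrightarrow> (F has_vector_derivative f x) (at x)"
    by (rule einterval_antiderivative) (use assms in \<open>auto simp: continuous_on_eq_continuous_at\<close>)
  then obtain F where F: "\<And>x. (F has_real_derivative f x) (at x)"
    by (auto simp: has_real_derivative_iff_has_vector_derivative)
  show ?thesis
    by (intro exI[of _ "\<lambda>t. F t - F 0"]) (auto intro!: derivative_eq_intros F)
qed

text \<open>
  Derivatives of \<open>t^{-k} exp (-1/t)\<close> stay in the span of this family, hence all its members are
  smooth.
\<close>

definition recip_exp :: "nat \<Rightarrow> real \<Rightarrow> real" where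
  "recip_exp k t = (if t \<le> 0 then 0 else (1 / t) ^ k * exp (- (1 / t)))"

lemma power_div_fact_le_exp: "0 \<le> x \<Longrightarrow> x ^ n / fact n \<le> exp (x::real)"
  using sum_le_suminf[of "\<lambda>n. x ^ n /\<^sub>R fact n" "{n}"] exp_converges[of x]
  by (simp add: sums_iff field_simps)

lemma recip_exp_bound: "\<bar>recip_exp k t\<bar> \<le> fact (k + 2) * t\<^sup>2"
proof (cases "t \<le> 0")
  case False
  then have t: "t > 0" by simp
  have "(1 / t) ^ (k + 2) \<le> fact (k + 2) * exp (1 / t)"
    using power_div_fact_le_exp[of "1 / t" "k + 2"] t by (simp add: field_simps del: fact_Suc)
  then have "(1 / t) ^ (k + 2) * (exp (- (1 / t)) * t\<^sup>2) \<le> (fact (k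
      + 2) * exp (1 / t)) * (exp (- (1 / t)) * t\<^sup>2)"
    by (rule mult_right_mono) simp
  also have "\<dots> = fact (k + 2) * (exp (1 / t) * exp (- (1 / t))) * t\<^sup>2" by (simp only: mult_ac)
  also have "\<dots> = fact (k + 2) * t\<^sup>2" by (simp add: exp_minus del: fact_Suc)
  also have "(1 / t) ^ (k + 2) * (exp (- (1 / t)) * t\<^sup>2) = (1 / t) ^ k * exp (- (1 / t))"
    using t by (simp add: power_add power2_eq_square)
  finally show ?thesis using t by (simp add: recip_exp_def del: fact_Suc)
qed (auto simp: recip_exp_def)

lemma recip_exp_nonneg: "0 \<le> recip_exp k t" by (simp add: recip_exp_def)

lemma recip_exp_deriv: "(recip_exp k has_real_derivative recip_exp (k + 2) t - real k * recip_exp (k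
    + 1) t) (at t)"
proof -
  consider "t < 0" | "t = 0" | "t > 0" by linarith
  then show ?thesis
  proof cases
    case 1
    then have z: "recip_exp (k + 2) t - real k * recip_exp (k + 1) t = 0" by (simp add: recip_exp_def)
    have "((\<lambda>t. 0) has_real_derivative 0) (at t)" by simp
    then have "(recip_exp k has_real_derivative 0) (at t)"
    proof (rule has_field_derivative_transform_within_open[where S = "{..<0}"])
      show "t \<in> {..<0}" using 1 by simp
      show "0 = recip_exp k x" if "x \<in> {..<0}" for x using that by (simp add: recip_exp_def)
    qed simp
    then show ?thesis unfolding z .
  next
    case 2
    obtain C :: real where C: "\<bar>recip_exp k h\<bar> \<le> C * h\<^sup>2" for h using recip_exp_bound by blast
    have le: "norm (recip_exp k h / h) \<le> C * \<bar>h\<bar>" for h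
    proof (cases "h = 0")
      case False
      then show ?thesis using C[of h]
        by (simp add: divide_le_eq abs_mult power2_eq_square mult.assoc)
    qed simp
    have "((\<lambda>h. recip_exp k h / h) \<longlongrightarrow> 0) (at 0)"
    proof (rule Lim_null_comparison)
      show "\<forall>\<^sub>F h in at 0. norm (recip_exp k h / h) \<le> C * \<bar>h\<bar>" using le by simp
      show "((\<lambda>h::real. C * \<bar>h\<bar>) \<longlongrightarrow> 0) (at 0)"
        by (auto intro!: tendsto_eq_intros)
    qed
    then show ?thesis using 2 by (simp add: DERIV_def recip_exp_def)
  next
    case 3
    have Di: "((\<lambda>t. 1 / t) has_real_derivative - (1 / t * (1 / t))) (at t)"
      using DERIV_inverse[of t] 3 by (simp add: inverse_eq_divide power2_eq_square)
    have D: "((\<lambda>t. (1 / t) ^ k * exp (- (1 / t))) has_real_derivative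
        real k * (1 / t) ^ (k - 1) * (- (1 / t * (1 / t))) * exp (- (1 / t))
          + (1 / t) ^ k * (exp (- (1 / t)) * (1 / t * (1 / t)))) (at t)"
      by (rule DERIV_cong, rule DERIV_mult[OF DERIV_power[OF Di] DERIV_fun_exp[OF DERIV_minus[OF Di]]])
        (simp add: mult_ac)
    have alg: "real k * s ^ (k - 1) * (- (s * s)) * e + s ^ k * (e * (s * s))
        = s ^ (k + 2) * e - real k * (s ^ (k + 1) * e)" for s e :: real
      by (cases k) (simp_all add: power_add algebra_simps)
    have eq: "real k * (1 / t) ^ (k - 1) * (- (1 / t * (1 / t))) * exp (- (1 / t))
          + (1 / t) ^ k * (exp (- (1 / t)) * (1 / t * (1 / t)))
        = recip_exp (k + 2) t - real k * recip_exp (k + 1) t"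
      unfolding alg using 3 by (simp add: recip_exp_def)
    show ?thesis
    proof (rule has_field_derivative_transform_within_open[where S = "{0<..}"])
      show "((\<lambda>t. (1 / t) ^ k * exp (- (1 / t))) has_real_derivative
          recip_exp (k + 2) t - real k * recip_exp (k + 1) t) (at t)"
        using D unfolding eq .
      show "t \<in> {0<..}" using 3 by simp
      show "(1 / x) ^ k * exp (- (1 / x)) = recip_exp k x" if "x \<in> {0<..}" for x
        using that by (simp add: recip_exp_def)
    qed simp
  qed
qed

lemma smooth_real_recip_exp: "smooth_real (recip_exp k)"
  unfolding smooth_real_def
proof
  fix n show "Ck_real n (recip_exp k)"
  proof (induction n arbitrary: k)
    case 0
    show ?case unfolding Ck_real.simps by (rule DERIV_continuous_on) (rule recip_exp_deriv)
  next
    case (Suc n)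
    have "Ck_real n (\<lambda>t. recip_exp (k + 2) t + (- real k) * recip_exp (k + 1) t)"
      by (intro Ck_real_add Ck_real_mult Ck_real_const Suc)
    then show ?case
      by (intro Ck_real_SucI[of _ "\<lambda>t. recip_exp (k + 2) t + (- real k) * recip_exp (k + 1) t"])
        (use recip_exp_deriv[of k] in auto)
  qed
qed

text \<open>The normalised integral of a bump, the product of two copies of
  \<open>exp (- (1 / t))\<close> facing each other from the ends of \<open>{0..1}\<close>.\<close>

lemma smooth_step_exists:
  "\<exists>S. smooth_real S \<and> (\<forall>t\<le>0. S t = 0) \<and> (\<forall>t\<ge>1. S t = 1) \<and> (\<forall>t. 0 \<le> S t \<and> S t \<le> 1)"
proof -
  define b where "b = (\<lambda>t. recip_exp 0 t * recip_exp 0 (- 1 * t + 1))"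
  have sb: "smooth_real b" unfolding b_def
    by (rule smooth_real_mult[OF smooth_real_recip_exp smooth_real_compose_affine[OF smooth_real_recip_exp]])
  have b0: "0 \<le> b t" for t by (simp add: b_def recip_exp_nonneg)
  have bz: "b t = 0" if "t \<le> 0 \<or> t \<ge> 1" for t using that by (auto simp: b_def recip_exp_def)
  have cb: "continuous_on UNIV b" by (rule smooth_real_continuous[OF sb])
  from antiderivative_real[OF cb] obtain B where
    B: "B 0 = 0" "\<And>t. (B has_real_derivative b t) (at t)" by auto
  have mono: "B s \<le> B t" if "s \<le> t" for s t
  proof (rule DERIV_nonneg_imp_nondecreasing[OF that])
    fix x
    show "\<exists>y. (B has_real_derivative y) (at x) \<and> 0 \<le> y" using B(2)[of x] b0[of x] by auto
  qed
  have Bneg: "B t = 0" if "t \<le> 0" for t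
  proof -
    have "B 0 \<le> B t"
    proof (rule DERIV_nonpos_imp_nonincreasing[OF that])
      fix x assume "t \<le> x" "x \<le> 0"
      then show "\<exists>y. (B has_real_derivative y) (at x) \<and> y \<le> 0" using B(2)[of x] bz[of x] by auto
    qed
    then show ?thesis using mono[OF that] B(1) by simp
  qed
  have Bpos: "B t = B 1" if "t \<ge> 1" for t
  proof -
    have "B t \<le> B 1"
    proof (rule DERIV_nonpos_imp_nonincreasing[OF that])
      fix x assume "1 \<le> x" "x \<le> t"
      then show "\<exists>y. (B has_real_derivative y) (at x) \<and> y \<le> 0" using B(2)[of x] bz[of x] by auto
    qed
    then show ?thesis using mono[OF that] by simp
  qed
  have "B 0 < B 1"
  proof (rule DERIV_pos_imp_increasing_open[of 0 1 B])
    show "\<exists>y. (B has_real_derivative y) (at x) \<and> 0 < y" if "0 < x" "x < 1" for x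
      using B(2)[of x] that by (intro exI[of _ "b x"]) (auto simp: b_def recip_exp_def)
    show "continuous_on {0..1} B" by (rule DERIV_continuous_on) (use B(2) in \<open>auto intro:
        has_field_derivative_at_within\<close>)
  qed simp
  then have B1: "B 1 > 0" using B by simp
  have "smooth_real (\<lambda>t. (1 / B 1) * B t)"
    by (rule smooth_real_cmult[OF smooth_real_of_derivative[OF sb B(2)]])
  moreover
  have "0 \<le> B t \<and> B t \<le> B 1" for t
    using mono[of 0 t] mono[of t 1] Bneg[of t] Bpos[of t] B(1) by linarith
  then have "0 \<le> (1 / B 1) * B t \<and> (1 / B 1) * B t \<le> 1" for t using B1 by simp
  moreover have "(1 / B 1) * B t = 1" if "t \<ge> 1" for t using Bpos[OF that] B1 by simp
  moreover have "(1 / B 1) * B t = 0" if "t \<le> 0" for t using Bneg[OF that] by simp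
  ultimately show ?thesis by meson
qed

definition step :: "real \<Rightarrow> real" where
  "step = (SOME S. smooth_real S \<and> (\<forall>t\<le>0. S t = 0) \<and> (\<forall>t\<ge>1. S t = 1) \<and> (\<forall>t. 0 \<le> S t \<and> S t \<le> 1))"

lemma step: "smooth_real step" "\<And>t. t \<le> 0 \<Longrightarrow> step t = 0" "\<And>t. t \<ge> 1 \<Longrightarrow> step t = 1"
  "\<And>t. 0 \<le> step t" "\<And>t. step t \<le> 1"
  using someI_ex[OF smooth_step_exists] unfolding step_def[symmetric] by blast+

text \<open>Vanishing of both derivatives at 0 and 1 themselves separates consecutive stages in
  time, endpoints included; the uniform bound \<open>C\<close> enters the force estimate.\<close>

lemma step_derivatives:
  "\<exists>h h' C. smooth_real h \<and> (\<forall>t. (step has_real_derivative h t) (at t)) \<and>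
    (\<forall>t. (h has_real_derivative h' t) (at t)) \<and> smooth_real h' \<and>
    (\<forall>t. t \<le> 0 \<or> t \<ge> 1 \<longrightarrow> h t = 0 \<and> h' t = 0) \<and> (\<forall>t. \<bar>h t\<bar> \<le> C \<and> \<bar>h' t\<bar> \<le> C)"
proof -
  obtain h where h: "smooth_real h" "\<And>t. (step has_real_derivative h t) (at t)"
    using smooth_real_derivative[OF step(1)] by blast
  obtain h' where h': "smooth_real h'" "\<And>t. (h has_real_derivative h' t) (at t)"
    using smooth_real_derivative[OF h(1)] by blast
  \<comment> \<open>For \<open>t \<le> 0\<close> the function \<open>step\<close> attains its
    minimum and for \<open>t \<ge> 1\<close> its maximum, so the first derivative vanishes at the
    endpoints as well.\<close>
  have hz: "h t = 0" if "t \<le> 0 \<or> t \<ge> 1" for t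
    using that DERIV_local_min[OF h(2), of 1 t] DERIV_local_max[OF h(2), of 1 t] step by auto
  have "h' t = 0" if "t < 0 \<or> t > 1" for t
  proof -
    have "(h has_real_derivative 0) (at t)"
      by (rule has_field_derivative_transform_within_open[of "\<lambda>t. 0" _ t "{..<0} \<union> {1<..}"])
        (use that hz in auto)
    then show ?thesis using h'(2) DERIV_unique by blast
  qed
  \<comment> \<open>The second derivative vanishes on the open half-lines and extends to the
    endpoints by continuity.\<close>
  moreover have "h' 0 = 0" "h' 1 = 0"
  proof -
    have "closed {t. h' t = 0}" by (intro closed_Collect_eq smooth_real_continuous[OF h'(1)]
        continuous_on_const)
    then have "closure ({..<0} \<union> {1<..}) \<subseteq> {t. h' t = 0}"
      by (intro closure_minimal) (use calculation in auto)
    then show "h' 0 = 0" "h' 1 = 0" by (auto simp: closure_Un)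
  qed
  ultimately have h'z: "h' t = 0" if "t \<le> 0 \<or> t \<ge> 1" for t
    using that by (cases "t = 0"; cases "t = 1") auto
  have bd: "\<exists>C. \<forall>t. \<bar>g t\<bar> \<le> C" if "smooth_real g" "\<And>t. t \<le> 0 \<or> t \<ge> 1 \<Longrightarrow> g t = 0" for g
  proof -
    have "compact (g ` {0..1})" by (intro compact_continuous_image smooth_real_continuous that) auto
    then obtain M where M: "\<And>z. z \<in> g ` {0..1} \<Longrightarrow> \<bar>z\<bar> \<le> M"
      using compact_imp_bounded bounded_iff real_norm_def by metis
    have "\<bar>g t\<bar> \<le> max 0 M" for t
      using M[of "g t"] that(2)[of t] by (cases "t \<in> {0..1}") auto
    then show ?thesis by blast
  qed
  obtain C1 C2 where "\<And>t. \<bar>h t\<bar> \<le> C1" "\<And>t. \<bar>h' t\<bar> \<le> C2"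
    using bd[OF h(1) hz] bd[OF h'(1) h'z] by blast
  then show ?thesis
    by (intro exI[of _ h] exI[of _ h'] exI[of _ "max C1 C2"] conjI allI impI h h' hz h'z)
      (auto simp: le_max_iff_disj)
qed

section \<open>Trigonometric triangle waves\<close>

text \<open>Multiplication by \<open>(cos y)\<^sup>2\<close> moves frequencies by -2, 0 or 2 and so
  keeps them odd. Odd frequencies are nonzero, which permits termwise integration, and they change
  sign under half a period, which makes the wave antiperiodic.\<close>

lemma cos_odd_power_expansion:
  "\<exists>xs :: (real \<times> int) list. (\<forall>(a, k)\<in>set xs. odd k) \<and>
     (\<forall>y. cos y ^ (2 * n + 1) = (\<Sum>(a, k)\<leftarrow>xs. a * cos (of_int k * y)))"
proof (induction n)
  case 0
  show ?case by (rule exI[of _ "[(1, 1)]"]) auto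
next
  case (Suc n)
  then obtain xs :: "(real \<times> int) list" where odd: "\<forall>(a, k)\<in>set xs. odd k"
    and eq: "\<And>y. cos y ^ (2 * n + 1) = (\<Sum>(a, k)\<leftarrow>xs. a * cos (of_int k * y))" by blast
  have step: "\<exists>zs :: (real \<times> int) list. (\<forall>(a, k)\<in>set zs. odd k) \<and>
      (\<forall>y. (\<Sum>(a, k)\<leftarrow>zs. a * cos (of_int k * y)) = (cos y)\<^sup>2 * (\<Sum>(a, k)\<leftarrow>ys. a * cos (of_int k * y)))"
    if "\<forall>(a, k)\<in>set ys. odd k" for ys :: "(real \<times> int) list"
    using that
  proof (induction ys)
    case Nil
    show ?case by (rule exI[of _ "[]"]) auto
  next
    case (Cons ak ys)
    obtain a k where ak: "ak = (a, k)" by (cases ak)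
    from Cons obtain zs :: "(real \<times> int) list" where zs: "\<forall>(a, k)\<in>set zs. odd k"
      "\<And>y. (\<Sum>(a, k)\<leftarrow>zs. a * cos (of_int k * y)) = (cos y)\<^sup>2 * (\<Sum>(a, k)\<leftarrow>ys. a * cos (of_int k * y))"
      by auto
    have k: "odd k" using Cons.prems ak by auto
    have c2: "(cos y)\<^sup>2 = (1 + cos (2 * y)) / 2" for y :: real
      using cos_double_cos[of y] by simp
    have id: "a / 2 * cos (of_int k * y) + (a / 4 * cos (of_int (k + 2) * y) + a / 4 * cos (of_int (k - 2) * y))
        = (cos y)\<^sup>2 * (a * cos (of_int k * y))" for y
    proof -
      have "cos (of_int (k + 2) * y) + cos (of_int (k - 2) * y) = 2 * cos (of_int k * y) * cos (2 * y)"
        by (simp add: algebra_simps cos_add cos_diff)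
      then have "a / 4 * (cos (of_int (k + 2) * y) + cos (of_int (k - 2) * y))
          = a / 4 * (2 * cos (of_int k * y) * cos (2 * y))" by (simp only:)
      then show ?thesis unfolding c2 by (simp only: distrib_left) (simp add: field_simps)
    qed
    show ?case
    proof (intro exI[of _ "(a / 2, k) # (a / 4, k + 2) # (a / 4, k - 2) # zs"] conjI allI)
      show "\<forall>(a, k)\<in>set ((a / 2, k) # (a / 4, k + 2) # (a / 4, k - 2) # zs). odd k"
        using zs k by auto
      show "(\<Sum>(a, k)\<leftarrow>(a / 2, k) # (a / 4, k + 2) # (a / 4, k - 2) # zs. a * cos (of_int k * y))
         = (cos y)\<^sup>2 * (\<Sum>(a, k)\<leftarrow>ak # ys. a * cos (of_int k * y))" for y
        using id[of y] zs(2)[of y] by (simp add: ak distrib_left)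
    qed
  qed
  from step[OF odd] obtain zs :: "(real \<times> int) list" where zs: "\<forall>(a, k)\<in>set zs. odd k"
    "\<And>y. (\<Sum>(a, k)\<leftarrow>zs. a * cos (of_int k * y)) = (cos y)\<^sup>2 * (\<Sum>(a, k)\<leftarrow>xs. a * cos (of_int k * y))"
    by auto
  have "cos y ^ (2 * Suc n + 1) = (cos y)\<^sup>2 * cos y ^ (2 * n + 1)" for y :: real
    by (simp add: power2_eq_square)
  then have "cos y ^ (2 * Suc n + 1) = (\<Sum>(a, k)\<leftarrow>zs. a * cos (of_int k * y))" for y :: real
    by (simp only: zs(2) eq)
  then show ?case using zs(1) by blast
qed

definition cos_coeffs :: "nat \<Rightarrow> (real \<times> int) list" where
  "cos_coeffs n = (SOME xs. (\<forall>(a, k)\<in>set xs. odd k) \<and>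
     (\<forall>y. cos y ^ (2 * n + 1) = (\<Sum>(a, k)\<leftarrow>xs. a * cos (of_int k * y))))"

lemma cos_coeffs: "(a, k) \<in> set (cos_coeffs n) \<Longrightarrow> odd k"
  "cos y ^ (2 * n + 1) = (\<Sum>(a, k)\<leftarrow>cos_coeffs n. a * cos (of_int k * y))"
  using someI_ex[OF cos_odd_power_expansion[of n]] unfolding cos_coeffs_def[symmetric] by auto

section \<open>The integrated kernel that shapes the triangle wave\<close>

definition kernel_int :: "nat \<Rightarrow> real \<Rightarrow> real" where
  "kernel_int n = (SOME P. P 0 = 0 \<and> (\<forall>z. (P has_real_derivative (1 - z\<^sup>2) ^ n) (at z)))"

lemma kernel_int: "kernel_int n 0 = 0" "(kernel_int n has_real_derivative (1 - z\<^sup>2) ^ n) (at z)"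
proof -
  have "continuous_on UNIV (\<lambda>z::real. (1 - z\<^sup>2) ^ n)" by (intro continuous_intros)
  from someI_ex[OF antiderivative_real[OF this]]
  show "kernel_int n 0 = 0" "(kernel_int n has_real_derivative (1 - z\<^sup>2) ^ n) (at z)"
    unfolding kernel_int_def[symmetric] by auto
qed

lemma kernel_int_diff_le:
  assumes "a \<le> b" and "\<And>s. s \<in> {a..b} \<Longrightarrow> (f has_real_derivative f' s) (at s)"
    and "\<And>s. s \<in> {a..b} \<Longrightarrow> f' s \<le> (1 - s\<^sup>2) ^ n"
  shows "f b - f a \<le> kernel_int n b - kernel_int n a"
  by (rule derivative_le_imp_le[OF assms(1), where f' = f' and g' = "\<lambda>s. (1 - s\<^sup>2) ^ n"])
    (use assms kernel_int in \<open>auto intro: has_field_derivative_at_within\<close>)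

lemma kernel_int_odd: "kernel_int n (- z) = - kernel_int n z"
proof -
  have "((\<lambda>z. kernel_int n z + kernel_int n (- z)) has_real_derivative 0) (at z)" for z
    by (rule DERIV_cong, rule DERIV_add[OF kernel_int(2) DERIV_chain2[OF kernel_int(2) DERIV_minus[OF
        DERIV_ident]]])
      simp
  then have "kernel_int n z + kernel_int n (- z) = kernel_int n 0 + kernel_int n (- 0)"
    using DERIV_isconst_all[of "\<lambda>z. kernel_int n z + kernel_int n (- z)" z 0] by blast
  then show ?thesis by (simp add: kernel_int(1))
qed

lemma kernel_int_mono: "-1 \<le> a \<Longrightarrow> a \<le> b \<Longrightarrow> b \<le> 1 \<Longrightarrow> kernel_int n a \<le> kernel_int n b"
proof -
  assume ab: "-1 \<le> a" "a \<le> b" "b \<le> 1"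
  have "0 \<le> (1 - s\<^sup>2) ^ n" if "s \<in> {a..b}" for s
    using that ab by (simp add: abs_square_le_1 abs_le_iff)
  then have "0 - 0 \<le> kernel_int n b - kernel_int n a"
    by (intro kernel_int_diff_le[where f = "\<lambda>z. 0" and f' = "\<lambda>z. 0"] ab) auto
  then show ?thesis by simp
qed

text \<open>Bernoulli's inequality \<open>1 - n * s\<^sup>2 \<le> (1 - s\<^sup>2) ^ n\<close>,
  integrated up to \<open>1 / sqrt n\<close>, where its left side reaches zero.\<close>

lemma kernel_int_1_ge:
  assumes "n \<ge> 1" shows "kernel_int n 1 \<ge> 2 / (3 * sqrt n)"
proof -
  define b where "b = 1 / sqrt n"
  have b: "0 < b" "b \<le> 1" using assms by (auto simp: b_def)
  have "(b - real n * b ^ 3 / 3) - (0 - real n * 0 ^ 3 / 3) \<le> kernel_int n b - kernel_int n 0"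
  proof (rule kernel_int_diff_le[where f = "\<lambda>z. z - real n * z ^ 3 / 3" and f' = "\<lambda>z. 1 - real n * z\<^sup>2"])
    fix s assume s: "s \<in> {0..b}"
    show "((\<lambda>z. z - real n * z ^ 3 / 3) has_real_derivative 1 - real n * s\<^sup>2) (at s)"
      by (auto intro!: derivative_eq_intros)
    have "s\<^sup>2 \<le> 1" using s b by (simp add: power_le_one)
    then show "1 - n * s\<^sup>2 \<le> (1 - s\<^sup>2) ^ n"
      using Bernoulli_inequality[of "- (s\<^sup>2)" n] by simp
  qed (use b in auto)
  moreover have "n * b ^ 3 = b"
    using assms by (simp add: b_def power3_eq_cube field_simps)
  ultimately have "2 / 3 * b \<le> kernel_int n b" by (simp add: kernel_int(1))
  also have "\<dots> \<le> kernel_int n 1" using b by (intro kernel_int_mono) auto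
  finally show ?thesis by (simp add: b_def field_simps)
qed

text \<open>Since \<open>1 - (z + h)\<^sup>2 \<le> (1 - z\<^sup>2) * (1 - h\<^sup>2)\<close>, the
  tail beyond \<open>z\<close> is a small factor times an integral of the same kernel from 0. At the
  sine this factor is a power of the cosine, which is concentrated at the corners of the
  wave.\<close>

lemma kernel_int_tail:
  assumes z: "0 \<le> z" "z \<le> 1"
  shows "kernel_int n 1 - kernel_int n z \<le> (1 - z\<^sup>2) ^ n * kernel_int n 1"
proof -
  have "kernel_int n (z + (1 - z)) - kernel_int n (z + 0)
      \<le> (1 - z\<^sup>2) ^ n * kernel_int n (1 - z) - (1 - z\<^sup>2) ^ n * kernel_int n 0"
  proof (rule derivative_le_imp_le[where f' = "\<lambda>h. (1 - (z + h)\<^sup>2) ^ n"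
    and g' = "\<lambda>h. (1 - z\<^sup>2) ^ n * (1 - h\<^sup>2) ^ n"])
    fix h assume h: "h \<in> {0..1 - z}"
    have "((\<lambda>h. kernel_int n (z + h)) has_real_derivative (1 - (z + h)\<^sup>2) ^ n) (at h)"
      by (rule DERIV_cong, rule DERIV_chain2[OF kernel_int(2) DERIV_add[OF DERIV_const DERIV_ident]]) simp
    then show "((\<lambda>h. kernel_int n (z + h)) has_real_derivative (1 - (z + h)\<^sup>2) ^ n) (at h within {0..1 - z})"
      by (rule has_field_derivative_at_within)
    show "((\<lambda>h. (1 - z\<^sup>2) ^ n * kernel_int n h)
        has_real_derivative (1 - z\<^sup>2) ^ n * (1 - h\<^sup>2) ^ n) (at h within {0..1 - z})"
      by (rule DERIV_cmult[OF has_field_derivative_at_within[OF kernel_int(2)]])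
    have "0 \<le> 1 - (z + h)\<^sup>2" using h z by (simp add: power_le_one)
    moreover have "1 - (z + h)\<^sup>2 \<le> (1 - z\<^sup>2) * (1 - h\<^sup>2)"
    proof -
      have "(1 - z\<^sup>2) * (1 - h\<^sup>2) - (1 - (z + h)\<^sup>2) = 2 * z * h + (z * h)\<^sup>2"
        by (simp add: power2_eq_square algebra_simps)
      moreover have "0 \<le> 2 * z * h + (z * h)\<^sup>2" using z h by (intro add_nonneg_nonneg) auto
      ultimately show ?thesis by linarith
    qed
    ultimately have "(1 - (z + h)\<^sup>2) ^ n \<le> ((1 - z\<^sup>2) * (1 - h\<^sup>2)) ^ n" by (rule power_mono[rotated])
    then show "(1 - (z + h)\<^sup>2) ^ n \<le> (1 - z\<^sup>2) ^ n * (1 - h\<^sup>2) ^ n" by (simp add: power_mult_distrib)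
  qed (use z in auto)
  also have "\<dots> \<le> (1 - z\<^sup>2) ^ n * kernel_int n 1"
    unfolding kernel_int(1) using z by (auto intro!: mult_left_mono kernel_int_mono simp: power_le_one)
  finally show ?thesis by simp
qed

text \<open>
  A smoothed triangle wave with slope \<open>profile_d1\<close>. Its second derivative \<open>profile_d2\<close> is an odd
  power of the cosine, hence a sum of cosines of nonzero frequency; integrating it twice term by
  term shows that \<open>profile\<close> is a trigonometric polynomial.
\<close>

definition profile :: "nat \<Rightarrow> real \<Rightarrow> real" where
  "profile n y = - (2 * pi / kernel_int n 1) * (\<Sum>(a, k)\<leftarrow>cos_coeffs n. a / (2 * pi * of_int k)\<^sup>2 * cos
      (of_int k * (2 * pi * y)))"

definition profile_d1 :: "nat \<Rightarrow> real \<Rightarrow> real" where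
  "profile_d1 n y = kernel_int n (sin (2 * pi * y)) / kernel_int n 1"

definition profile_d2 :: "nat \<Rightarrow> real \<Rightarrow> real" where
  "profile_d2 n y = 2 * pi / kernel_int n 1 * cos (2 * pi * y) ^ (2 * n + 1)"

definition profile_d3 :: "nat \<Rightarrow> real \<Rightarrow> real" where
  "profile_d3 n y = - (4 * pi\<^sup>2 * (2 * n + 1) / kernel_int n 1 * (cos (2 * pi * y) ^ (2 * n) * sin (2 *
      pi * y)))"

lemma DERIV_sum_list:
  assumes "\<And>x. x \<in> set xs \<Longrightarrow> ((\<lambda>t. f x t) has_real_derivative f' x) (at t)"
  shows "((\<lambda>t. \<Sum>x\<leftarrow>xs. f x t) has_real_derivative (\<Sum>x\<leftarrow>xs. f' x)) (at t)"
  using assms by (induction xs) (auto intro!: DERIV_add)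

lemma profile_d1_deriv: "(profile_d1 n has_real_derivative profile_d2 n y) (at y)"
proof -
  have "((\<lambda>y. kernel_int n (sin (2 * pi * y))) has_real_derivative
      (1 - (sin (2 * pi * y))\<^sup>2) ^ n * (cos (2 * pi * y) * (2 * pi))) (at y)"
    by (rule DERIV_chain2[OF kernel_int(2)]) (auto intro!: derivative_eq_intros)
  then have "((\<lambda>y. kernel_int n (sin (2 * pi * y)) / kernel_int n 1) has_real_derivative
      (1 - (sin (2 * pi * y))\<^sup>2) ^ n * (cos (2 * pi * y) * (2 * pi)) / kernel_int n 1) (at y)"
    by (rule DERIV_cdivide)
  moreover have "(1 - (sin (2 * pi * y))\<^sup>2) ^ n * (cos (2 * pi * y) * (2 * pi)) / kernel_int n 1
      = profile_d2 n y"
    unfolding cos_squared_eq[symmetric] by (simp add: profile_d2_def power_mult[symmetric])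
  ultimately show ?thesis unfolding profile_d1_def[abs_def] by simp
qed

lemma cos_power_deriv: "((\<lambda>y. cos (2 * pi * y) ^ (2 * n + 1)) has_real_derivative
    - (real (2 * n + 1) * (2 * pi) * (cos (2 * pi * y) ^ (2 * n) * sin (2 * pi * y)))) (at y)"
proof -
  have "((\<lambda>y. cos (2 * pi * y)) has_real_derivative - sin (2 * pi * y) * (2 * pi)) (at y)"
    by (auto intro!: derivative_eq_intros)
  from DERIV_power[OF this, of "2 * n + 1"] show ?thesis
    by (rule DERIV_cong) simp
qed

lemma profile_d2_deriv: "(profile_d2 n has_real_derivative profile_d3 n y) (at y)"
  unfolding profile_d2_def[abs_def]
  by (rule DERIV_cong, rule DERIV_cmult[OF cos_power_deriv])
    (simp add: profile_d3_def power2_eq_square mult_ac)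

text \<open>The termwise derivative \<open>S\<close> of the cosine sum and \<open>profile_d1\<close>
  have the same derivative \<open>profile_d2\<close>, and both vanish at 0.\<close>

lemma profile_deriv: "(profile n has_real_derivative profile_d1 n y) (at y)"
proof -
  define S where "S y = (2 * pi / kernel_int n 1) * (\<Sum>(a, k)\<leftarrow>cos_coeffs n. a / (2 * pi * of_int k) * sin
      (of_int k * (2 * pi * y)))" for y
  have k0: "k \<noteq> 0" if "(a, k) \<in> set (cos_coeffs n)" for a k using cos_coeffs(1)[OF that] by auto
  have neg: "(\<Sum>x\<leftarrow>xs. - g x) = - (\<Sum>x\<leftarrow>xs. g x)" for xs :: "(real \<times> int) list" and g :: "real \<times> int \<Rightarrow> real"
    by (induction xs) auto
  have D1: "(profile n has_real_derivative S y) (at y)" for y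
  proof -
    have "((\<lambda>y. \<Sum>(a, k)\<leftarrow>cos_coeffs n. a / (2 * pi * of_int k)\<^sup>2 * cos (of_int k * (2 * pi * y)))
        has_real_derivative
       (\<Sum>x\<leftarrow>cos_coeffs n. (case x of (a, k) \<Rightarrow> - (a / (2 * pi * of_int k) * sin (of_int k * (2 * pi *
           y)))))) (at y)"
    proof (rule DERIV_sum_list)
      fix x assume x: "x \<in> set (cos_coeffs n)"
      obtain a k where ak: "x = (a, k)" by (cases x)
      show "((\<lambda>t. case x of (a, k) \<Rightarrow> a / (2 * pi * of_int k)\<^sup>2 * cos (of_int k * (2 * pi * t)))
          has_real_derivative
         (case x of (a, k) \<Rightarrow> - (a / (2 * pi * of_int k) * sin (of_int k * (2 * pi * y))))) (at y)"
        unfolding ak prod.case using k0[of a k] x ak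
        by (auto intro!: derivative_eq_intros simp: power2_eq_square field_simps)
    qed
    from DERIV_cmult[OF this, of "- (2 * pi / kernel_int n 1)"]
    show ?thesis unfolding profile_def[abs_def] S_def
      by (simp add: split_def neg)
  qed
  have D2: "(S has_real_derivative profile_d2 n y) (at y)" for y
  proof -
    have "((\<lambda>y. \<Sum>(a, k)\<leftarrow>cos_coeffs n. a / (2 * pi * of_int k) * sin (of_int k * (2 * pi * y)))
        has_real_derivative
       (\<Sum>x\<leftarrow>cos_coeffs n. (case x of (a, k) \<Rightarrow> a * cos (of_int k * (2 * pi * y))))) (at y)"
    proof (rule DERIV_sum_list)
      fix x assume x: "x \<in> set (cos_coeffs n)"
      obtain a k where ak: "x = (a, k)" by (cases x)
      show "((\<lambda>t. case x of (a, k) \<Rightarrow> a / (2 * pi * of_int k) * sin (of_int k * (2 * pi * t)))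
          has_real_derivative
         (case x of (a, k) \<Rightarrow> a * cos (of_int k * (2 * pi * y)))) (at y)"
        unfolding ak prod.case using k0[of a k] x ak
        by (auto intro!: derivative_eq_intros)
    qed
    from DERIV_cmult[OF this, of "2 * pi / kernel_int n 1"]
    show ?thesis unfolding S_def[abs_def] profile_d2_def cos_coeffs(2)[of "2 * pi * y" n] by simp
  qed
  have "((\<lambda>y. S y - profile_d1 n y) has_real_derivative 0) (at y)" for y
    using DERIV_diff[OF D2 profile_d1_deriv[of n y]] by simp
  then have "S y - profile_d1 n y = S 0 - profile_d1 n 0"
    using DERIV_isconst_all[of "\<lambda>y. S y - profile_d1 n y" y 0] by blast
  also have "\<dots> = 0" by (simp add: S_def profile_d1_def kernel_int(1) split_def)
  finally show ?thesis using D1[of y] by simp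
qed

lemma kernel_int_1_pos: "n \<ge> 1 \<Longrightarrow> kernel_int n 1 > 0"
  using kernel_int_1_ge[of n] by (simp add: order_less_le_trans[rotated])

lemma abs_profile_d1_le: "n \<ge> 1 \<Longrightarrow> \<bar>profile_d1 n y\<bar> \<le> 1"
  using kernel_int_mono[of "sin (2 * pi * y)" 1 n] kernel_int_mono[of "-1" "sin (2 * pi * y)" n]
    kernel_int_odd[of n 1] kernel_int_1_pos[of n]
  by (simp add: profile_d1_def abs_le_iff divide_le_eq le_divide_eq)

text \<open>The defect is \<open>1 - \<bar>s\<bar>\<close> times
  \<open>1 + \<bar>s\<bar> \<le> 2\<close> for the slope \<open>s\<close>, and
  \<open>kernel_int_tail\<close> at the absolute value of the sine bounds the first factor. This is
  the error density of the mixing step.\<close>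

lemma profile_d1_defect:
  assumes n: "n \<ge> 1" shows "1 - (profile_d1 n y)\<^sup>2 \<le> 2 * cos (2 * pi * y) ^ (2 * n)"
proof -
  define z where "z = \<bar>sin (2 * pi * y)\<bar>"
  have z: "0 \<le> z" "z \<le> 1" by (auto simp: z_def)
  have c: "kernel_int n 1 > 0" using kernel_int_1_pos[OF n] .
  have "\<bar>profile_d1 n y\<bar> = kernel_int n z / kernel_int n 1"
  proof -
    have "\<bar>kernel_int n (sin (2 * pi * y))\<bar> = kernel_int n z"
    proof (cases "sin (2 * pi * y) \<ge> 0")
      case True
      then show ?thesis using kernel_int_mono[of 0 z n] z kernel_int(1)[of n] by (simp add: z_def)
    next
      case False
      then have "z = - sin (2 * pi * y)" by (simp add: z_def)
      then show ?thesis using kernel_int_mono[of 0 z n] z kernel_int(1)[of n] kernel_int_odd[of n z] by simp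
    qed
    then show ?thesis using c by (simp add: profile_d1_def)
  qed
  moreover have "1 - kernel_int n z / kernel_int n 1 \<le> (1 - z\<^sup>2) ^ n"
    using kernel_int_tail[OF z, of n] c by (simp add: field_simps)
  moreover have "(1 - z\<^sup>2) ^ n = cos (2 * pi * y) ^ (2 * n)"
    by (simp add: z_def cos_squared_eq[symmetric] power_mult)
  ultimately have d: "1 - \<bar>profile_d1 n y\<bar> \<le> cos (2 * pi * y) ^ (2 * n)" by simp
  have "1 - (profile_d1 n y)\<^sup>2 = (1 - \<bar>profile_d1 n y\<bar>) * (1 + \<bar>profile_d1 n y\<bar>)"
    by (simp add: power2_eq_square algebra_simps)
  also have "\<dots> \<le> (1 - \<bar>profile_d1 n y\<bar>) * 2"
    using abs_profile_d1_le[OF n, of y] by (intro mult_left_mono) auto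
  also have "\<dots> \<le> 2 * cos (2 * pi * y) ^ (2 * n)" using mult_right_mono[OF d, of 2] by (simp add: mult.commute)
  finally show ?thesis .
qed

lemma inverse_kernel_int_le: "n \<ge> 1 \<Longrightarrow> 1 / kernel_int n 1 \<le> 3 / 2 * sqrt n"
  using kernel_int_1_ge[of n] kernel_int_1_pos[of n] by (simp add: field_simps)

lemma abs_profile_d2_le:
  assumes n: "n \<ge> 1" shows "\<bar>profile_d2 n y\<bar> \<le> 12 * sqrt n"
proof -
  have "\<bar>profile_d2 n y\<bar> = 2 * pi * (1 / kernel_int n 1) * \<bar>cos (2 * pi * y)\<bar> ^ (2 * n + 1)"
    using kernel_int_1_pos[OF n] by (simp add: profile_d2_def abs_mult power_abs)
  also have "\<dots> \<le> 2 * 4 * (3 / 2 * sqrt n) * 1"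
    using pi_less_4 kernel_int_1_pos[OF n] inverse_kernel_int_le[OF n]
    by (intro mult_mono power_le_one) auto
  finally show ?thesis by simp
qed

lemma abs_profile_d3_le:
  assumes n: "n \<ge> 1" shows "\<bar>profile_d3 n y\<bar> \<le> 300 * n * sqrt n"
proof -
  have "\<bar>profile_d3 n y\<bar> = 4 * pi\<^sup>2 * (2 * n + 1) * (1 / kernel_int n 1) * (\<bar>cos (2 * pi * y)\<bar> ^ (2 * n)
      * \<bar>sin (2 * pi * y)\<bar>)"
    using kernel_int_1_pos[OF n] by (simp add: profile_d3_def abs_mult power_abs)
  also have "\<dots> \<le> 4 * 4\<^sup>2 * (3 * n) * (3 / 2 * sqrt n) * (1 * 1)"
  proof -
    have "pi\<^sup>2 \<le> 4\<^sup>2" using pi_less_4 by (intro power_mono) auto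
    moreover have "2 * n + 1 \<le> 3 * n" using n by simp
    then have "real (2 * n + 1) \<le> 3 * real n" by linarith
    ultimately have "pi\<^sup>2 * real (2 * n + 1) \<le> 4\<^sup>2 * (3 * real n)" by (intro mult_mono) auto
    then have "pi\<^sup>2 * (1 + 2 * real n) \<le> 48 * real n" by simp
    then show ?thesis using kernel_int_1_pos[OF n] inverse_kernel_int_le[OF n]
      by (intro mult_mono power_le_one) auto
  qed
  finally show ?thesis by simp
qed

lemma profile_periodic_half: "profile n (y + 1 / 2) = - profile n y"
proof -
  have "(\<Sum>(a, k)\<leftarrow>xs. a / (2 * pi * of_int k)\<^sup>2 * cos (of_int k * (2 * pi * (y + 1 / 2))))
      = - (\<Sum>(a, k)\<leftarrow>xs. a / (2 * pi * of_int k)\<^sup>2 * cos (of_int k * (2 * pi * y)))"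
    if "\<forall>(a, k)\<in>set xs. odd k" for xs
    using that
  proof (induction xs)
    case (Cons x xs)
    obtain a k where ak: "x = (a, k)" by (cases x)
    have "cos (of_int k * (2 * pi * (y + 1 / 2))) = cos (of_int k * (2 * pi * y) + pi * of_int k)"
      by (simp add: algebra_simps)
    also have "\<dots> = - cos (of_int k * (2 * pi * y))"
      using Cons.prems ak by (simp add: cos_add)
    finally show ?case using Cons ak by simp
  qed simp
  moreover have "\<forall>(a, k)\<in>set (cos_coeffs n). odd k" using cos_coeffs(1) by auto
  ultimately show ?thesis unfolding profile_def by (simp only: mult_minus_right)
qed

lemma profile_periodic: "profile n (y + 1) = profile n y"
  using profile_periodic_half[of n y] profile_periodic_half[of n "y + 1 / 2"] by (simp add: add.assoc)

lemma real_lipschitz: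
  fixes f :: "real \<Rightarrow> real"
  assumes "\<And>x. (f has_real_derivative f' x) (at x)" "\<And>x. \<bar>f' x\<bar> \<le> B"
  shows "\<bar>f x - f y\<bar> \<le> B * \<bar>x - y\<bar>"
  using field_differentiable_bound[of UNIV f f' B x y] assms by (simp add: convex_UNIV)

text \<open>The function changes sign over half a period while its slope is at most 1.\<close>

lemma abs_profile_le:
  assumes "n \<ge> 1" shows "\<bar>profile n y\<bar> \<le> 1"
  using real_lipschitz[OF profile_deriv abs_profile_d1_le[OF assms], of y "y + 1 / 2"]
  by (simp add: profile_periodic_half)

text \<open>Wallis' recursion. The induction keeps \<open>(J n)\<^sup>2 * (2 * n + 1)\<close> below
  1 because \<open>(2 * n + 1) * (2 * n + 3) \<le> (2 * n + 2)\<^sup>2\<close>. The integral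
  measures how much of a period is taken by the rounded corners.\<close>

lemma integral_cos_power: "integral {0..1} (\<lambda>y. cos (2 * pi * y) ^ (2 * n)) \<le> 1 / sqrt (2 * n + 1)"
proof -
  define J where "J n = integral {0..1} (\<lambda>y. cos (2 * pi * y) ^ (2 * n))" for n
  have int: "(\<lambda>y. cos (2 * pi * y) ^ m) integrable_on {0..1}" for m
    by (intro integrable_continuous_real continuous_intros)
  have rec: "(2 * n + 2) * J (Suc n) = (2 * n + 1) * J n" for n
  proof -
    have "((\<lambda>y. 2 * pi * ((2 * n + 2) * cos (2 * pi * y) ^ (2 * Suc n) - (2 * n
        + 1) * cos (2 * pi * y) ^ (2 * n)))
        has_integral sin (2 * pi * 1) * cos (2 * pi * 1) ^ (2 * n
            + 1) - sin (2 * pi * 0) * cos (2 * pi * 0) ^ (2 * n + 1)) {0..1}"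
    proof (rule fundamental_theorem_of_calculus)
      fix y :: real
      have "((\<lambda>y. sin (2 * pi * y)) has_real_derivative cos (2 * pi * y) * (2 * pi)) (at y)"
        by (auto intro!: derivative_eq_intros)
      from DERIV_mult[OF this cos_power_deriv[of n y]]
      have "((\<lambda>y. sin (2 * pi * y) * cos (2 * pi * y) ^ (2 * n + 1)) has_real_derivative
         2 * pi * ((cos (2 * pi * y))\<^sup>2 * cos (2 * pi * y) ^ (2 * n)
           - (2 * n + 1) * (sin (2 * pi * y))\<^sup>2 * cos (2 * pi * y) ^ (2 * n))) (at y)"
        by (rule DERIV_cong) (simp add: power2_eq_square algebra_simps)
      then have "((\<lambda>y. sin (2 * pi * y) * cos (2 * pi * y) ^ (2 * n + 1)) has_real_derivative
         2 * pi * ((2 * n + 2) * cos (2 * pi * y) ^ (2 * Suc n) - (2 * n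
             + 1) * cos (2 * pi * y) ^ (2 * n))) (at y)"
        unfolding sin_squared_eq by (rule DERIV_cong) (simp add: power2_eq_square algebra_simps)
      then show "((\<lambda>y. sin (2 * pi * y) * cos (2 * pi * y) ^ (2 * n + 1)) has_vector_derivative
         2 * pi * ((2 * n + 2) * cos (2 * pi * y) ^ (2 * Suc n) - (2 * n
             + 1) * cos (2 * pi * y) ^ (2 * n))) (at y within {0..1})"
        by (simp only: has_real_derivative_iff_has_vector_derivative has_vector_derivative_at_within)
    qed simp
    moreover have "sin (2 * pi * 1) * cos (2 * pi * 1) ^ (2 * n
        + 1) - sin (2 * pi * 0) * cos (2 * pi * 0) ^ (2 * n + 1) = 0"
      by simp
    ultimately have "integral {0..1} (\<lambda>y. 2 * pi * ((2 * n + 2) * cos (2 * pi * y) ^ (2 * Suc n) - (2 * n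
        + 1) * cos (2 * pi * y) ^ (2 * n))) = 0"
      by (simp only: integral_unique)
    moreover have "integral {0..1} (\<lambda>y. 2 * pi * ((2 * n + 2) * cos (2 * pi * y) ^ (2 * Suc n) - (2 * n
        + 1) * cos (2 * pi * y) ^ (2 * n)))
       = 2 * pi * ((2 * n + 2) * J (Suc n) - (2 * n + 1) * J n)"
      unfolding integral_mult_right J_def
      by (subst Henstock_Kurzweil_Integration.integral_diff) (intro integrable_on_mult_right int refl,
          intro integrable_on_mult_right int refl, simp)
    ultimately show ?thesis by (simp add: add.commute)
  qed
  have "(J n)\<^sup>2 * (2 * real n + 1) \<le> 1" for n
  proof (induction n)
    case 0
    show ?case by (simp add: J_def)
  next
    case (Suc n)
    have J: "J (Suc n) = J n * (2 * real n + 1) / (2 * real n + 2)" using rec[of n] by (simp add: field_simps)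
    have alg: "(j * a / b)\<^sup>2 * c = (j\<^sup>2 * a) * (a * c / b\<^sup>2)" for j a b c :: real
      by (simp add: power2_eq_square)
    have "(J (Suc n))\<^sup>2 * (2 * real (Suc n) + 1)
        = ((J n)\<^sup>2 * (2 * real n + 1)) * ((2 * real n + 1) * (2 * real (Suc n) + 1) / (2 * real n + 2)\<^sup>2)"
      unfolding J alg ..
    also have "\<dots> \<le> 1 * 1"
    proof (intro mult_mono Suc)
      have "(2 * real n + 1) * (2 * real (Suc n) + 1) \<le> (2 * real n + 2)\<^sup>2"
        by (simp add: power2_eq_square algebra_simps)
      then show "(2 * real n + 1) * (2 * real (Suc n) + 1) / (2 * real n + 2)\<^sup>2 \<le> 1" by simp
    qed auto
    finally show ?case by simp
  qed
  then have "(J n)\<^sup>2 \<le> 1 / (2 * real n + 1)" by (simp add: field_simps)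
  then have "J n \<le> sqrt (1 / (2 * real n + 1))" using real_le_rsqrt by blast
  then show ?thesis by (simp add: J_def real_sqrt_divide add.commute)
qed

section \<open>Transport by alternating shears\<close>

definition step_deriv :: "real \<Rightarrow> real" where "step_deriv = deriv step"
definition step_deriv2 :: "real \<Rightarrow> real" where "step_deriv2 = deriv step_deriv"

lemma step_deriv: "smooth_real step_deriv" "(step has_real_derivative step_deriv t) (at t)"
    "(step_deriv has_real_derivative step_deriv2 t) (at t)" "smooth_real step_deriv2"
    "t \<le> 0 \<or> t \<ge> 1 \<Longrightarrow> step_deriv t = 0" "t \<le> 0 \<or> t \<ge> 1 \<Longrightarrow> step_deriv2 t = 0"
  and step_deriv_bounded: "\<exists>C. \<forall>t. \<bar>step_deriv t\<bar> \<le> C \<and> \<bar>step_deriv2 t\<bar> \<le> C"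
proof -
  from step_derivatives obtain h h' C where h: "smooth_real h" "\<And>t. (step has_real_derivative h t) (at t)"
    "\<And>t. (h has_real_derivative h' t) (at t)" "smooth_real h'"
    "\<And>t. t \<le> 0 \<or> t \<ge> 1 \<Longrightarrow> h t = 0" "\<And>t. t \<le> 0 \<or> t \<ge> 1 \<Longrightarrow> h' t = 0"
    "\<And>t. \<bar>h t\<bar> \<le> C \<and> \<bar>h' t\<bar> \<le> C"
    by blast
  have "step_deriv = h" unfolding step_deriv_def using h(2) by (intro ext DERIV_imp_deriv)
  moreover have "step_deriv2 = h'" unfolding step_deriv2_def \<open>step_deriv = h\<close>
    using h(3) by (intro ext DERIV_imp_deriv)
  ultimately show "smooth_real step_deriv" "(step has_real_derivative step_deriv t) (at t)"
    "(step_deriv has_real_derivative step_deriv2 t) (at t)" "smooth_real step_deriv2"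
    "t \<le> 0 \<or> t \<ge> 1 \<Longrightarrow> step_deriv t = 0" "t \<le> 0 \<or> t \<ge> 1 \<Longrightarrow> step_deriv2 t = 0"
    "\<exists>C. \<forall>t. \<bar>step_deriv t\<bar> \<le> C \<and> \<bar>step_deriv2 t\<bar> \<le> C"
    using h by blast+
qed

text \<open>
  The factor \<open>10000\<close> keeps the errors \<open>240 / root_slope q\<close> committed in the successive mixing
  steps summable to less than \<open>1/20\<close>. Stage \<open>q\<close> displaces the coordinate \<open>stage_axis q\<close> as a
  function of the other planar coordinate, which is \<open>stage_axis (Suc q)\<close>; \<open>ramp q\<close> is the
  fraction of the displacement carried out.
\<close>

definition root_slope :: "nat \<Rightarrow> nat" where "root_slope q = 10000 * (q + 1)\<^sup>2"
text \<open>A perfect square, so that the mixing errors of order \<open>1 / sqrt (slope q)\<close>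
  sum like \<open>1 / (q + 1)\<^sup>2\<close>.\<close>

definition slope :: "nat \<Rightarrow> nat" where "slope q = (root_slope q)\<^sup>2"
primrec grad_scale :: "nat \<Rightarrow> real" where
  "grad_scale 0 = 1" | "grad_scale (Suc q) = real (slope q) * grad_scale q"
text \<open>The stages accumulate at \<open>1/2\<close> with lengths that decay only polynomially;
  the time derivatives of the ramps therefore cost only powers of \<open>q\<close>.\<close>

definition stage_start :: "nat \<Rightarrow> real" where "stage_start q = (1 - 1 / (real q + 1)) / 2"
definition stage_len :: "nat \<Rightarrow> real" where "stage_len q = 1 / (2 * (real q + 1) * (real q + 2))"
definition stage_axis :: "nat \<Rightarrow> 3" where "stage_axis q = (if even q then 1 else 2)"

definition ramp :: "nat \<Rightarrow> real \<Rightarrow> real" where "ramp q t = step ((t - stage_start q) / stage_len q)"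
definition ramp_d1 :: "nat \<Rightarrow> real \<Rightarrow> real"
  where "ramp_d1 q t = step_deriv ((t - stage_start q) / stage_len q) / stage_len q"
definition ramp_d2 :: "nat \<Rightarrow> real \<Rightarrow> real"
  where "ramp_d2 q t = step_deriv2 ((t - stage_start q) / stage_len q) / (stage_len q)\<^sup>2"

text \<open>The slope also serves as exponent of the kernel. The corners then occupy a proportion of
  order \<open>1 / sqrt (slope q)\<close> of the period, matching the other mixing errors.\<close>

definition disp :: "nat \<Rightarrow> real \<Rightarrow> real" where
  "disp q y = real (slope q) / 2 ^ q * profile (slope q) (2 ^ q * y)"
definition disp_d1 :: "nat \<Rightarrow> real \<Rightarrow> real" where
  "disp_d1 q y = real (slope q) * profile_d1 (slope q) (2 ^ q * y)"

lemma stage_axis_Suc_neq: "stage_axis (Suc q) \<noteq> stage_axis q" "stage_axis q \<noteq> stage_axis (Suc q)"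
  by (auto simp: stage_axis_def)

lemma stage_axis_neq_3: "stage_axis q \<noteq> 3" by (auto simp: stage_axis_def)

lemma stage_axis_Suc_Suc: "stage_axis (Suc (Suc q)) = stage_axis q" by (simp add: stage_axis_def)

lemma stage_len_pos: "stage_len q > 0" by (simp add: stage_len_def)

lemma stage_start_Suc: "stage_start (Suc q) = stage_start q + stage_len q"
  by (simp add: stage_start_def stage_len_def divide_simps) (simp add: algebra_simps)

lemma stage_start_mono: "q \<le> r \<Longrightarrow> stage_start q \<le> stage_start r"
proof (induction r rule: dec_induct)
  case (step n)
  then show ?case using stage_len_pos[of n] by (simp add: stage_start_Suc)
qed simp

lemma stage_start_nonneg: "0 \<le> stage_start q" and stage_start_le_half: "stage_start q \<le> 1 / 2"
  by (auto simp: stage_start_def field_simps)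

lemma ramp_before: "t \<le> stage_start q \<Longrightarrow> ramp q t = 0"
  and ramp_after: "t \<ge> stage_start (Suc q) \<Longrightarrow> ramp q t = 1"
  and ramp_d1_off: "t \<le> stage_start q \<or> t \<ge> stage_start (Suc q) \<Longrightarrow> ramp_d1 q t = 0"
  and ramp_d2_off: "t \<le> stage_start q \<or> t \<ge> stage_start (Suc q) \<Longrightarrow> ramp_d2 q t = 0"
  using stage_len_pos[of q]
  by (auto simp: ramp_def ramp_d1_def ramp_d2_def stage_start_Suc divide_le_0_iff le_divide_eq intro!:
      step step_deriv(5,6))

lemma ramp_range: "0 \<le> ramp q t" "ramp q t \<le> 1" by (auto simp: ramp_def step)

lemma ramp_deriv: "(ramp q has_real_derivative ramp_d1 q t) (at t)"
proof -
  have "((\<lambda>t. (t - stage_start q) / stage_len q) has_real_derivative 1 / stage_len q) (at t)"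
    using stage_len_pos[of q] by (auto intro!: derivative_eq_intros)
  from DERIV_chain2[OF step_deriv(2) this] show ?thesis
    unfolding ramp_def[abs_def] ramp_d1_def by simp
qed

lemma ramp_d1_deriv: "(ramp_d1 q has_real_derivative ramp_d2 q t) (at t)"
proof -
  have "((\<lambda>t. (t - stage_start q) / stage_len q) has_real_derivative 1 / stage_len q) (at t)"
    using stage_len_pos[of q] by (auto intro!: derivative_eq_intros)
  from DERIV_cdivide[OF DERIV_chain2[OF step_deriv(3) this], of "stage_len q"] show ?thesis
    unfolding ramp_d1_def[abs_def] ramp_d2_def by (simp add: power2_eq_square)
qed

lemma stage_arg_affine: "(t - stage_start q) / stage_len q = 1 / stage_len q * t
    + (- stage_start q / stage_len q)"
  by (simp add: diff_divide_distrib)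

lemma smooth_real_ramp_d1: "smooth_real (ramp_d1 q)"
proof -
  have "smooth_real (\<lambda>t. 1 / stage_len q * step_deriv (1 / stage_len q * t + (- stage_start q / stage_len q)))"
    by (rule smooth_real_cmult[OF smooth_real_compose_affine[OF step_deriv(1)]])
  then show ?thesis unfolding ramp_d1_def[abs_def] stage_arg_affine by simp
qed

lemma smooth_real_ramp_d2: "smooth_real (ramp_d2 q)"
proof -
  have "smooth_real (\<lambda>t. 1 / (stage_len q)\<^sup>2 * step_deriv2 (1 / stage_len q * t
      + (- stage_start q / stage_len q)))"
    by (rule smooth_real_cmult[OF smooth_real_compose_affine[OF step_deriv(4)]])
  then show ?thesis unfolding ramp_d2_def[abs_def] stage_arg_affine by simp
qed

lemma root_slope_pos: "root_slope q \<ge> 10000" by (simp add: root_slope_def)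
lemma slope_pos: "slope q \<ge> 1" using root_slope_pos[of q] by (simp add: slope_def)
text \<open>A crude exponential bound, which already beats the factors \<open>2 ^ q\<close> and
  \<open>4 ^ q\<close> coming from the frequencies.\<close>

lemma grad_scale_ge: "grad_scale q \<ge> 10000 ^ q"
proof (induction q)
  case (Suc q)
  have "root_slope q * 1 \<le> root_slope q * root_slope q"
    using root_slope_pos[of q] by (intro mult_left_mono) auto
  then have "10000 \<le> slope q" unfolding slope_def power2_eq_square using root_slope_pos[of q] by linarith
  then show ?case using Suc by (auto intro!: mult_mono)
qed simp

lemma grad_scale_ge_1: "grad_scale q \<ge> 1"
  using grad_scale_ge[of q] one_le_power[of "10000::real" q] by linarith

lemma disp_deriv: "(disp q has_real_derivative disp_d1 q y) (at y)"
proof -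
  have "((\<lambda>y. profile (slope q) (2 ^ q * y)) has_real_derivative profile_d1 (slope q) (2 ^ q * y) * 2 ^
      q) (at y)"
    by (rule DERIV_chain2[OF profile_deriv]) (auto intro!: derivative_eq_intros)
  from DERIV_cmult[OF this, of "real (slope q) / 2 ^ q"]
  show ?thesis unfolding disp_def[abs_def] disp_d1_def by simp
qed

definition disp_d2 :: "nat \<Rightarrow> real \<Rightarrow> real" where
  "disp_d2 q y = real (slope q) * 2 ^ q * profile_d2 (slope q) (2 ^ q * y)"
definition disp_d3 :: "nat \<Rightarrow> real \<Rightarrow> real" where
  "disp_d3 q y = real (slope q) * 2 ^ q * 2 ^ q * profile_d3 (slope q) (2 ^ q * y)"

lemma disp_d1_deriv: "(disp_d1 q has_real_derivative disp_d2 q y) (at y)"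
proof -
  have "((\<lambda>y. profile_d1 (slope q) (2 ^ q * y))
      has_real_derivative profile_d2 (slope q) (2 ^ q * y) * 2 ^ q) (at y)"
    by (rule DERIV_chain2[OF profile_d1_deriv]) (auto intro!: derivative_eq_intros)
  from DERIV_cmult[OF this, of "real (slope q)"]
  show ?thesis unfolding disp_d1_def[abs_def] disp_d2_def by (simp add: mult_ac)
qed

lemma disp_d2_deriv: "(disp_d2 q has_real_derivative disp_d3 q y) (at y)"
proof -
  have "((\<lambda>y. profile_d2 (slope q) (2 ^ q * y))
      has_real_derivative profile_d3 (slope q) (2 ^ q * y) * 2 ^ q) (at y)"
    by (rule DERIV_chain2[OF profile_d2_deriv]) (auto intro!: derivative_eq_intros)
  from DERIV_cmult[OF this, of "real (slope q) * 2 ^ q"]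
  show ?thesis unfolding disp_d2_def[abs_def] disp_d3_def by (simp add: mult_ac)
qed

lemma abs_disp_d1_le: "\<bar>disp_d1 q y\<bar> \<le> slope q"
  using abs_profile_d1_le[OF slope_pos[of q], of "2 ^ q * y"] by (simp add: disp_d1_def abs_mult mult_left_le)

lemma disp_periodic: "disp q (y + 1) = disp q y"
proof -
  have "profile n (z + real m) = profile n z" for n m z
  proof (induction m)
    case (Suc m)
    have "z + real (Suc m) = (z + real m) + 1" by simp
    then show ?case using Suc profile_periodic[of n "z + real m"] by metis
  qed simp
  from this[of "slope q" "2 ^ q * y" "2 ^ q"] show ?thesis by (simp add: disp_def distrib_left)
qed

lemma continuous_profile_d1: "continuous_on S (profile_d1 n)"
  by (rule DERIV_continuous_on) (rule has_field_derivative_at_within, rule profile_d1_deriv)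

lemma continuous_disp: "continuous_on S (disp q)"
  by (rule DERIV_continuous_on) (rule has_field_derivative_at_within, rule disp_deriv)

lemma continuous_disp_d1: "continuous_on S (disp_d1 q)"
  unfolding disp_d1_def[abs_def]
  by (intro continuous_intros continuous_on_compose2[OF continuous_profile_d1[of UNIV]]) auto

lemma continuous_ramp: "continuous_on S (ramp q)"
  by (rule DERIV_continuous_on) (rule has_field_derivative_at_within, rule ramp_deriv)

lemma continuous_ramp_d1: "continuous_on S (ramp_d1 q)"
  by (rule DERIV_continuous_on) (rule has_field_derivative_at_within, rule ramp_d1_deriv)

section \<open>The transported scalar and its derivatives\<close>

definition shear :: "nat \<Rightarrow> real \<Rightarrow> real^3 \<Rightarrow> real^3" where
  "shear q t X = X - (ramp q t * disp q (X $ stage_axis (Suc q))) *\<^sub>R ee (stage_axis q)"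

text \<open>The initial scalar composed with the backward flow map: the shear performed last is
  undone first. Shears that have not begun at time \<open>t\<close> are the identity.\<close>

primrec Psi :: "nat \<Rightarrow> real \<Rightarrow> real^3 \<Rightarrow> real" where
  "Psi 0 t X = sin (2 * pi * X $ 1)"
| "Psi (Suc q) t X = Psi q t (shear q t X)"

text \<open>By the chain rule a shear keeps the component along \<open>stage_axis q\<close> and adds
  a multiple of it, of size up to \<open>slope q\<close>, to the other planar component. This is how
  gradients are amplified.\<close>

primrec Psi_grad :: "nat \<Rightarrow> real \<Rightarrow> real^3 \<Rightarrow> real^3" where
  "Psi_grad 0 t X = (2 * pi * cos (2 * pi * X $ 1)) *\<^sub>R ee 1"
| "Psi_grad (Suc q) t X = Psi_grad q t (shear q t X)
     - (ramp q t * disp_d1 q (X $ stage_axis (Suc q)) * Psi_grad q t (shear q t X) $ stage_axis q) *\<^sub>R ee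
         (stage_axis (Suc q))"

primrec Psi_time :: "nat \<Rightarrow> real \<Rightarrow> real^3 \<Rightarrow> real" where
  "Psi_time 0 t X = 0"
| "Psi_time (Suc q) t X = Psi_time q t (shear q t X)
     - ramp_d1 q t * disp q (X $ stage_axis (Suc q)) * Psi_grad q t (shear q t X) $ stage_axis q"

lemma ee_nth: "ee i $ j = (if j = i then 1 else 0)" by (simp add: axis_def)

lemma inner_ee: "x \<bullet> ee i = x $ i" "ee i \<bullet> x = x $ i"
  by (simp_all add: inner_axis inner_axis')

lemma shear_periodic: "shear q t (X + ee k) = shear q t X + ee k"
proof -
  have "disp q ((X + ee k) $ stage_axis (Suc q)) = disp q (X $ stage_axis (Suc q))"
    by (simp add: ee_nth disp_periodic)
  then show ?thesis by (simp only: shear_def) simp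
qed

lemma Psi_periodic: "periodic (Psi q t)"
proof -
  have "Psi q t (X + ee k) = Psi q t X" for X k
  proof (induction q arbitrary: X)
    case 0
    have "sin (2 * pi * (X $ 1 + 1)) = sin (2 * pi * X $ 1)"
      by (simp add: distrib_left)
    then show ?case by (simp add: ee_nth)
  qed (simp add: shear_periodic)
  then show ?thesis by (simp add: periodic_def)
qed

lemma abs_Psi_le: "\<bar>Psi q t X\<bar> \<le> 1"
  by (induction q arbitrary: X) auto

lemma shear_has_derivative:
  "((\<lambda>z. shear q (fst z) (snd z)) has_derivative (\<lambda>\<zeta>. snd \<zeta> - (fst \<zeta> * (ramp_d1 q t * disp q (X $
      stage_axis (Suc q)))
      + ramp q t * disp_d1 q (X $ stage_axis (Suc q)) * snd \<zeta> $ stage_axis (Suc q)) *\<^sub>R ee (stage_axis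
          q))) (at (t, X))"
proof -
  have H: "((\<lambda>z::real \<times> (real^3). ramp q (fst z)) has_derivative (\<lambda>\<zeta>. fst \<zeta> * ramp_d1 q t)) (at (t, X))"
    using DERIV_compose_FDERIV[OF ramp_deriv, of fst fst "(t, X)" UNIV] by (simp add: has_derivative_fst)
  have snd: "((\<lambda>z::real \<times> (real^3). snd z $ stage_axis (Suc q)) has_derivative (\<lambda>\<zeta>. snd \<zeta> $ stage_axis
      (Suc q))) (at (t, X))"
    by (intro bounded_linear_imp_has_derivative bounded_linear_vec_nth[THEN bounded_linear_compose]
        bounded_linear_snd)
  have D: "((\<lambda>z::real \<times> (real^3). disp q (snd z $ stage_axis (Suc q))) has_derivative (\<lambda>\<zeta>. snd \<zeta> $
      stage_axis (Suc q) * disp_d1 q (X $ stage_axis (Suc q)))) (at (t, X))"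
    using DERIV_compose_FDERIV[OF disp_deriv snd] by simp
  show ?thesis unfolding shear_def
    by (rule has_derivative_eq_rhs, (rule has_derivative_diff has_derivative_scaleR_left has_derivative_mult
      has_derivative_snd has_derivative_ident H D)+) (auto simp: algebra_simps)
qed

lemma Psi_has_derivative:
  "((\<lambda>z. Psi q (fst z) (snd z)) has_derivative (\<lambda>\<zeta>. fst \<zeta> * Psi_time q t X
      + Psi_grad q t X \<bullet> snd \<zeta>)) (at (t, X))"
proof (induction q arbitrary: X)
  case 0
  have snd: "((\<lambda>z::real \<times> (real^3). 2 * pi * snd z $ 1) has_derivative (\<lambda>\<zeta>. 2 * pi * snd \<zeta> $ 1)) (at (t, X))"
    by (intro has_derivative_mult_right bounded_linear_imp_has_derivative
      bounded_linear_vec_nth[THEN bounded_linear_compose] bounded_linear_snd)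
  have "((\<lambda>z::real \<times> (real^3). sin (2 * pi * snd z $ 1)) has_derivative (\<lambda>\<zeta>. 2 * pi * snd \<zeta> $ 1 * cos (2
      * pi * X $ 1))) (at (t, X))"
    using DERIV_compose_FDERIV[OF DERIV_sin snd] by simp
  then show ?case by (simp add: inner_ee mult_ac)
next
  case (Suc q)
  have sh: "((\<lambda>z. (fst z, shear q (fst z) (snd z))) has_derivative (\<lambda>\<zeta>. (fst \<zeta>, snd \<zeta> - (fst \<zeta> * (ramp_d1
      q t * disp q (X $ stage_axis (Suc q)))
      + ramp q t * disp_d1 q (X $ stage_axis (Suc q)) * snd \<zeta> $ stage_axis (Suc q)) *\<^sub>R ee (stage_axis
          q)))) (at (t, X))"
    by (intro has_derivative_Pair has_derivative_fst has_derivative_ident shear_has_derivative)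
  have P: "((\<lambda>z. Psi q (fst z) (snd z)) has_derivative (\<lambda>\<zeta>. fst \<zeta> * Psi_time q t (shear q t X)
      + Psi_grad q t (shear q t X) \<bullet> snd \<zeta>))
      (at ((\<lambda>z. (fst z, shear q (fst z) (snd z))) (t, X)))"
    using Suc[of "shear q t X"] by simp
  have eq: "(\<lambda>z. Psi q (fst z) (snd z)) \<circ> (\<lambda>z. (fst z, shear q (fst z) (snd z)))
      = (\<lambda>z. Psi (Suc q) (fst z) (snd z))"
    by (simp add: fun_eq_iff)
  have "((\<lambda>z. Psi (Suc q) (fst z) (snd z)) has_derivative
     (\<lambda>\<zeta>. fst \<zeta> * Psi_time q t (shear q t X) + Psi_grad q t (shear q t X) \<bullet> snd \<zeta>) \<circ>
     (\<lambda>\<zeta>. (fst \<zeta>, snd \<zeta> - (fst \<zeta> * (ramp_d1 q t * disp q (X $ stage_axis (Suc q)))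
      + ramp q t * disp_d1 q (X $ stage_axis (Suc q)) * snd \<zeta> $ stage_axis (Suc q)) *\<^sub>R ee (stage_axis
          q)))) (at (t, X))"
    using diff_chain_at[OF sh P] unfolding eq .
  then show ?case
    by (rule has_derivative_eq_rhs)
      (auto simp: o_def inner_diff_right inner_diff_left inner_ee algebra_simps)
qed

lemma continuous_shear: "continuous_on UNIV (\<lambda>z. shear q (fst z) (snd z))"
  unfolding shear_def
  by (intro continuous_intros continuous_on_compose2[OF continuous_ramp[of UNIV]]
    continuous_on_compose2[OF continuous_disp[of UNIV]]) auto

lemma continuous_Psi_grad: "continuous_on UNIV (\<lambda>z. Psi_grad q (fst z) (snd z))"
proof (induction q)
  case (Suc q)
  have "continuous_on UNIV (\<lambda>z. Psi_grad q (fst z) (shear q (fst z) (snd z)))"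
    using continuous_on_compose2[OF Suc, of UNIV "\<lambda>z. (fst z, shear q (fst z) (snd z))"] continuous_shear[of q]
    by (simp add: continuous_on_Pair continuous_on_fst)
  then show ?case unfolding Psi_grad.simps
    by (intro continuous_intros continuous_on_compose2[OF continuous_ramp[of UNIV]]
      continuous_on_compose2[OF continuous_disp_d1[of UNIV]]) auto
qed (auto intro!: continuous_intros)

lemma continuous_Psi_time: "continuous_on UNIV (\<lambda>z. Psi_time q (fst z) (snd z))"
proof (induction q)
  case (Suc q)
  have "continuous_on UNIV (\<lambda>z. Psi_time q (fst z) (shear q (fst z) (snd z)))"
    using continuous_on_compose2[OF Suc, of UNIV "\<lambda>z. (fst z, shear q (fst z) (snd z))"] continuous_shear[of q]
    by (simp add: continuous_on_Pair continuous_on_fst)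
  moreover have "continuous_on UNIV (\<lambda>z. Psi_grad q (fst z) (shear q (fst z) (snd z)))"
    using continuous_on_compose2[OF continuous_Psi_grad[of q], of UNIV "\<lambda>z. (fst z, shear q (fst z) (snd
        z))"] continuous_shear[of q]
    by (simp add: continuous_on_Pair continuous_on_fst)
  ultimately show ?case unfolding Psi_time.simps
    by (intro continuous_intros continuous_on_compose2[OF continuous_ramp_d1[of UNIV]]
      continuous_on_compose2[OF continuous_disp[of UNIV]]) auto
qed (auto intro!: continuous_intros)

lemma continuous_Psi: "continuous_on UNIV (\<lambda>z. Psi q (fst z) (snd z))"
proof -
  have "((\<lambda>z. Psi q (fst z) (snd z)) has_derivative (\<lambda>\<zeta>. fst \<zeta> * Psi_time q (fst z) (snd z)
      + Psi_grad q (fst z) (snd z) \<bullet> snd \<zeta>)) (at z)" for z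
    using Psi_has_derivative[of q "fst z" "snd z"] by simp
  then show ?thesis by (intro has_derivative_continuous_on) simp
qed

lemma Psi_time_derivative: "((\<lambda>t. Psi q t X) has_real_derivative Psi_time q t X) (at t)"
proof -
  have "((\<lambda>t. (t, X)) has_derivative (\<lambda>\<tau>. (\<tau>, 0))) (at t)" by (auto intro!: derivative_eq_intros)
  from diff_chain_at[OF this Psi_has_derivative[of q t X]] show ?thesis
    unfolding o_def fst_conv snd_conv by (rule has_derivative_imp_has_field_derivative) simp
qed

lemma Psi_line_derivative: "((\<lambda>h. Psi q t (X + h *\<^sub>R ee i)) has_real_derivative Psi_grad q t (X
    + h *\<^sub>R ee i) $ i) (at h)"
proof -
  have "((\<lambda>h. (t, X + h *\<^sub>R ee i)) has_derivative (\<lambda>\<tau>. (0, \<tau> *\<^sub>R ee i))) (at h)"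
    by (auto intro!: derivative_eq_intros)
  from diff_chain_at[OF this Psi_has_derivative[of q t "X + h *\<^sub>R ee i"]] show ?thesis
    unfolding o_def fst_conv snd_conv by (rule has_derivative_imp_has_field_derivative) (simp add: inner_ee)
qed

definition vel :: "nat \<Rightarrow> real \<Rightarrow> real^3 \<Rightarrow> real^3" where
  "vel Q t X = (\<Sum>q<Q. (ramp_d1 q t * disp q (X $ stage_axis (Suc q))) *\<^sub>R ee (stage_axis q))"

lemma vel_after: "t \<ge> stage_start Q \<Longrightarrow> vel Q t X = 0"
  unfolding vel_def
proof (intro sum.neutral ballI)
  fix q assume t: "t \<ge> stage_start Q" and "q \<in> {..<Q}"
  then have "stage_start (Suc q) \<le> t" using stage_start_mono[of "Suc q" Q] by auto
  then show "(ramp_d1 q t * disp q (X $ stage_axis (Suc q))) *\<^sub>R ee (stage_axis q) = 0"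
    by (simp add: ramp_d1_off)
qed

lemma Psi_time_after: "t \<ge> stage_start Q \<Longrightarrow> Psi_time Q t X = 0"
proof (induction Q arbitrary: X)
  case (Suc Q)
  then have "t \<ge> stage_start Q" using stage_start_mono[of Q "Suc Q"] by auto
  then show ?case using Suc by (simp add: ramp_d1_off)
qed simp

text \<open>Until stage \<open>Q\<close> starts its shear is the identity, and once it has started
  the earlier shears are complete. The time derivative then comes from the last shear alone and
  cancels against advection by it, because that shear leaves the gradient component along its own
  direction unchanged.\<close>

lemma Psi_transport: "Psi_time Q t X + vel Q t X \<bullet> Psi_grad Q t X = 0"
proof (induction Q arbitrary: X)
  case (Suc Q)
  show ?case
  proof (cases "t \<le> stage_start Q")
    case True
    then have "shear Q t X = X" by (simp add: shear_def ramp_before)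
    then show ?thesis using Suc[of X] True by (simp add: ramp_d1_off ramp_before vel_def)
  next
    case False
    then have "vel (Suc Q) t X = (ramp_d1 Q t * disp Q (X $ stage_axis (Suc Q))) *\<^sub>R ee (stage_axis Q)"
      using vel_after[of Q t X] by (simp add: vel_def)
    moreover have "Psi_time Q t (shear Q t X) = 0" using False by (intro Psi_time_after) auto
    ultimately show ?thesis
      using stage_axis_Suc_neq[of Q] by (simp add: inner_ee ee_nth)
  qed
qed (simp add: vel_def)

lemma slope_ge: "8 * ((real q + 1) * (real q + 2)) \<le> slope q" "100000000 \<le> slope q"
proof -
  have "(real q + 1) * (real q + 2) \<le> (real q + 1) * (2 * (real q + 1))" by (intro mult_left_mono) auto
  also have "\<dots> = 2 * (real q + 1)\<^sup>2" by (simp add: power2_eq_square)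
  finally have a: "(real q + 1) * (real q + 2) \<le> 2 * (real q + 1)\<^sup>2" .
  have s: "real (root_slope q) = 10000 * (real q + 1)\<^sup>2" by (simp add: root_slope_def)
  have "real (root_slope q) * 10000 \<le> real (root_slope q) * real (root_slope q)"
    using root_slope_pos[of q] by (intro mult_left_mono) auto
  then have b: "real (root_slope q) * 10000 \<le> real (slope q)" by (simp add: slope_def power2_eq_square)
  show "8 * ((real q + 1) * (real q + 2)) \<le> slope q"
    using a b zero_le_power2[of "real q + 1"] unfolding s by linarith
  show "100000000 \<le> slope q" using b root_slope_pos[of q] by linarith
qed

text \<open>The planar components exchange roles at every stage: the large one is multiplied by at
  most \<open>slope q\<close> and the other is added to it. Relative to
  \<open>2 * pi * grad_scale (Suc q)\<close> this addition is at most
  \<open>1 / ((q + 1) * (q + 2))\<close>, and the factor \<open>2 - 1 / (q + 1)\<close> absorbs the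
  telescoping sum. The constant thus stays bounded while the scale grows.\<close>

lemma Psi_grad_bounds:
  "\<bar>Psi_grad q t X $ stage_axis q\<bar> \<le> 2 * pi * (2 - 1 / (real q + 1)) * grad_scale q"
  "\<bar>Psi_grad q t X $ stage_axis (Suc q)\<bar> \<le> 4 * pi * grad_scale q"
  "Psi_grad q t X $ 3 = 0"
proof (induction q arbitrary: X)
  case 0
  {
    case 1 show ?case by (simp add: stage_axis_def ee_nth abs_mult)
  next
    case 2 show ?case by (simp add: stage_axis_def ee_nth)
  next
    case 3 show ?case by (simp add: ee_nth)
  }
next
  case (Suc q)
  have grad_scale: "grad_scale q > 0" using grad_scale_ge_1[of q] by simp
  have a: "\<bar>Psi_grad q t (shear q t X) $ stage_axis q\<bar> \<le> 2 * pi * (2 - 1 / (real q + 1)) * grad_scale q"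
    for X by (rule Suc(1))
  {
    case (1 X)
    let ?Y = "shear q t X"
    have "\<bar>Psi_grad (Suc q) t X $ stage_axis (Suc q)\<bar> \<le> \<bar>Psi_grad q t ?Y $ stage_axis (Suc q)\<bar>
        + \<bar>ramp q t * disp_d1 q (X $ stage_axis (Suc q)) * Psi_grad q t ?Y $ stage_axis q\<bar>"
    proof -
      have "Psi_grad (Suc q) t X $ stage_axis (Suc q)
          = Psi_grad q t ?Y $ stage_axis (Suc q) - ramp q t * disp_d1 q (X $ stage_axis (Suc q)) *
              Psi_grad q t ?Y $ stage_axis q"
        by (simp add: ee_nth)
      then show ?thesis by linarith
    qed
    also have "\<bar>ramp q t * disp_d1 q (X $ stage_axis (Suc q)) * Psi_grad q t ?Y $ stage_axis q\<bar>
        \<le> 1 * real (slope q) * (2 * pi * (2 - 1 / (real q + 1)) * grad_scale q)"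
      unfolding abs_mult using ramp_range[of q t] abs_disp_d1_le[of q] a[of X] by (intro mult_mono) auto
    also have "\<bar>Psi_grad q t ?Y $ stage_axis (Suc q)\<bar> \<le> 4 * pi * grad_scale q" by (rule Suc(2))
    also have "4 * pi * grad_scale q \<le> 2 * pi * grad_scale q * (slope q * (1 / ((real q + 1) * (real q + 2))))"
    proof -
      have "2 \<le> slope q * (1 / ((real q + 1) * (real q + 2)))"
      proof -
        define D where "D = (real q + 1) * (real q + 2)"
        have "D > 0" by (simp add: D_def)
        moreover have "2 * D \<le> slope q" using slope_ge(1)[of q] \<open>D > 0\<close> unfolding D_def[symmetric] by linarith
        ultimately show ?thesis unfolding D_def[symmetric] by (simp add: le_divide_eq)
      qed
      then have "2 * pi * grad_scale q * 2 \<le> 2 * pi * grad_scale q * (slope q * (1 / ((real q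
          + 1) * (real q + 2))))"
        using grad_scale by (intro mult_left_mono) auto
      then show ?thesis by simp
    qed
    also have "2 * pi * grad_scale q * (slope q * (1 / ((real q + 1) * (real q + 2))))
        + 1 * real (slope q) * (2 * pi * (2 - 1 / (real q + 1)) * grad_scale q)
       = 2 * pi * (slope q * grad_scale q) * (2 - 1 / (real q + 1) + 1 / ((real q + 1) * (real q + 2)))"
      by (simp add: algebra_simps)
    also have "2 - 1 / (real q + 1) + 1 / ((real q + 1) * (real q + 2)) = 2 - 1 / (real (Suc q) + 1)"
      by (simp add: divide_simps) (simp add: algebra_simps)
    finally show ?case by (simp add: mult_ac)
  next
    case (2 X)
    let ?Y = "shear q t X"
    have "\<bar>Psi_grad (Suc q) t X $ stage_axis (Suc (Suc q))\<bar> = \<bar>Psi_grad q t ?Y $ stage_axis q\<bar>"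
      by (simp add: stage_axis_Suc_Suc ee_nth stage_axis_Suc_neq)
    also note a[of X]
    also have "2 * pi * (2 - 1 / (real q + 1)) * grad_scale q \<le> 2 * pi * 2 * (slope q * grad_scale q)"
    proof -
      have c: "2 * pi * (2 - c) * l = 4 * pi * l - 2 * pi * c * l" for c l :: real
        by (simp add: algebra_simps)
      have "0 \<le> 2 * pi * (1 / (real q + 1)) * grad_scale q" using grad_scale by simp
      moreover have "1 * (4 * pi * grad_scale q) \<le> slope q * (4 * pi * grad_scale q)"
        using grad_scale slope_pos[of q] by (intro mult_right_mono) auto
      moreover have "2 * pi * 2 * (slope q * grad_scale q) = slope q * (4 * pi * grad_scale q)" by simp
      ultimately show ?thesis unfolding c by linarith
    qed
    finally show ?case by simp
  next
    case (3 X)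
    show ?case using Suc(3)[of "shear q t X"] stage_axis_neq_3[of "Suc q"] by (simp add: ee_nth)
  }
qed

section \<open>Mixing\<close>

definition line_average :: "real \<Rightarrow> 3 \<Rightarrow> (real^3 \<Rightarrow> real) \<Rightarrow> real^3 \<Rightarrow> real" where
  "line_average r i F X = integral {0..1} (\<lambda>h. F (X + (r * h) *\<^sub>R ee i))"

lemma continuous_line_average:
  assumes "continuous_on UNIV F" shows "continuous_on UNIV (line_average r i F)"
proof -
  have "continuous_on (UNIV \<times> cbox 0 1) (\<lambda>(X, h). F (X + (r * h) *\<^sub>R ee i))"
    unfolding split_def
    by (rule continuous_on_compose2[OF assms]) (auto intro!: continuous_intros)
  from integral_continuous_on_param[OF this] show ?thesis
    unfolding line_average_def[abs_def] by simp
qed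

lemma periodic_line_average: "periodic F \<Longrightarrow> periodic (line_average r i F)"
proof -
  assume per: "periodic F"
  have "F (X + ee k + (r * h) *\<^sub>R ee i) = F (X + (r * h) *\<^sub>R ee i)" for X k h
  proof -
    have "X + ee k + (r * h) *\<^sub>R ee i = (X + (r * h) *\<^sub>R ee i) + ee k" by simp
    then show ?thesis using per unfolding periodic_def by metis
  qed
  then show ?thesis by (simp add: periodic_def line_average_def)
qed

lemma continuous_Psi_slice: "continuous_on UNIV (Psi q t)"
  using continuous_on_compose2[OF continuous_Psi[of q], of UNIV "\<lambda>X. (t, X)"]
  by (simp add: continuous_on_Pair)

lemma Psi_lipschitz:
  "\<bar>Psi q t (X + a *\<^sub>R ee (stage_axis q)) - Psi q t X\<bar> \<le> 4 * pi * grad_scale q * \<bar>a\<bar>"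
  "\<bar>Psi q t (X + a *\<^sub>R ee (stage_axis (Suc q))) - Psi q t X\<bar> \<le> 4 * pi * grad_scale q * \<bar>a\<bar>"
proof -
  have "\<bar>Psi_grad q t Y $ stage_axis q\<bar> \<le> 4 * pi * grad_scale q" for Y
  proof -
    have c: "2 * pi * (2 - c) * l = 4 * pi * l - 2 * pi * c * l" for c l :: real
      by (simp add: algebra_simps)
    have "0 \<le> 2 * pi * (1 / (real q + 1)) * grad_scale q" using grad_scale_ge_1[of q] by simp
    then show ?thesis using Psi_grad_bounds(1)[of q t Y] unfolding c by linarith
  qed
  then show "\<bar>Psi q t (X + a *\<^sub>R ee (stage_axis q)) - Psi q t X\<bar> \<le> 4 * pi * grad_scale q * \<bar>a\<bar>"
    using real_lipschitz[OF Psi_line_derivative[of q t X "stage_axis q"], of "4 * pi * grad_scale q" a 0]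
      by simp
  show "\<bar>Psi q t (X + a *\<^sub>R ee (stage_axis (Suc q))) - Psi q t X\<bar> \<le> 4 * pi * grad_scale q * \<bar>a\<bar>"
    using real_lipschitz[OF Psi_line_derivative[of q t X "stage_axis (Suc q)"], of "4 * pi * grad_scale
        q" a 0] Psi_grad_bounds(2)[of q t]
    by simp
qed

lemma ramp_1: "ramp q 1 = 1"
  using stage_start_le_half[of "Suc q"] by (intro ramp_after) auto

lemma torus_int_coordinate:
  assumes "continuous_on UNIV g" "\<And>y. g (y + 1) = g y"
  shows "torus_int (\<lambda>X. g (X $ j)) = integral {0..1} g"
proof -
  have c: "continuous_on UNIV (\<lambda>X::real^3. g (X $ j))"
    by (rule continuous_on_compose2[OF assms(1)]) (auto intro!: continuous_intros)
  have p: "periodic (\<lambda>X::real^3. g (X $ j))"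
    using assms(2) by (simp add: periodic_def ee_nth)
  have "torus_int (\<lambda>X. g (X $ j)) = torus_int (\<lambda>X. integral {0..1} (\<lambda>s. g ((X + s *\<^sub>R ee j) $ j)))"
    using torus_int_average[OF c p, of j] by simp
  also have "\<dots> = torus_int (\<lambda>X. integral {0..1} g)"
    using integral_periodic_shift_real[OF assms] by (simp add: ee_nth)
  finally show ?thesis by (simp add: torus_int_const)
qed

lemma integral_periodic_scale:
  fixes g :: "real \<Rightarrow> real"
  assumes "continuous_on UNIV g" "\<And>y. g (y + 1) = g y"
  shows "integral {0..1} (\<lambda>s. g (2 ^ q * s)) = integral {0..1} g"
  using assms
proof (induction q arbitrary: g)
  case (Suc q)
  have int: "g integrable_on {a..b}" for a b
    by (metis Suc.prems(1) continuous_on_subset integrable_continuous_real subset_UNIV)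
  have c: "continuous_on UNIV (\<lambda>s. g (2 * s))"
    by (rule continuous_on_compose2[OF Suc.prems(1)]) (auto intro!: continuous_intros)
  have p: "g (2 * (y + 1)) = g (2 * y)" for y
  proof -
    have "2 * (y + 1) = 2 * y + 1 + 1" by simp
    then show ?thesis using Suc.prems(2) by metis
  qed
  have "integral {0..1} (\<lambda>s. g (2 ^ Suc q * s)) = integral {0..1} (\<lambda>s. (\<lambda>s. g (2 * s)) (2 ^ q * s))"
    by (simp add: mult.assoc)
  also have "\<dots> = integral {0..1} (\<lambda>s. g (2 * s))" by (rule Suc.IH[OF c p])
  also have "\<dots> = integral {0..2} g / 2"
  proof -
    have "((\<lambda>s. 2 *\<^sub>R g (2 * s)) has_integral integral {2 * 0..2 * 1} g) {0..1}"
      by (rule has_integral_substitution[where c = 0 and d = 2])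
        (auto intro!: derivative_eq_intros continuous_on_subset[OF Suc.prems(1)])
    from integral_unique[OF this] show ?thesis by simp
  qed
  also have "integral {0..2} g = integral {0..1} g + integral {1..2} g"
    by (rule Henstock_Kurzweil_Integration.integral_combine[symmetric]) (auto intro: int)
  also have "integral {1..2} g = integral {0..1} g"
    using integral_shift_real_ivl[of 1 1 2 g] Suc.prems(2) by simp
  finally show ?case by simp
qed simp

text \<open>It measures how well the scalar is mixed at its own gradient scale, along the direction
  in which the large gradient component points. Time 1 stands for any time after all shears are
  complete.\<close>

definition mean_size :: "nat \<Rightarrow> real" where
  "mean_size q = torus_int (\<lambda>X. \<bar>line_average (1 / grad_scale q) (stage_axis q) (Psi q 1) X\<bar>)"

text \<open>The segment covers a whole period of the initial sine.\<close>

lemma mean_size_0: "mean_size 0 = 0"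
proof -
  have "line_average 1 1 (Psi 0 1) X = 0" for X
  proof -
    have "((\<lambda>h. sin (2 * pi * (X $ 1 + h))) has_integral
       - cos (2 * pi * (X $ 1 + 1)) / (2 * pi) - - cos (2 * pi * (X $ 1 + 0)) / (2 * pi)) {0..1}"
      by (intro fundamental_theorem_of_calculus)
        (auto simp: has_real_derivative_iff_has_vector_derivative[symmetric] intro!: derivative_eq_intros)
    moreover have "cos (2 * pi * (X $ 1 + 1)) = cos (2 * pi * (X $ 1 + 0))"
      by (simp add: distrib_left)
    ultimately show ?thesis by (simp add: line_average_def ee_nth integral_unique)
  qed
  then have "(\<lambda>X. \<bar>line_average (1 / grad_scale 0) (stage_axis 0) (Psi 0 1) X\<bar>) = (\<lambda>X. 0)"
    by (simp add: stage_axis_def)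
  then show ?thesis by (simp only: mean_size_def torus_int_const)
qed

text \<open>Over the short segments of the mixing step the displacement is thereby nearly affine;
  the constant is a bound for \<open>disp_d2\<close>.\<close>

lemma disp_taylor:
  "\<bar>disp q (y + k) - disp q y - k * disp_d1 q y\<bar> \<le> slope q * 2 ^ q * (12 * sqrt (slope q)) * k\<^sup>2"
proof -
  let ?B = "slope q * 2 ^ q * (12 * sqrt (slope q))"
  have "\<bar>disp_d2 q x\<bar> \<le> ?B" for x
  proof -
    have "\<bar>disp_d2 q x\<bar> = slope q * 2 ^ q * \<bar>profile_d2 (slope q) (2 ^ q * x)\<bar>"
      by (simp add: disp_d2_def abs_mult)
    also have "\<dots> \<le> ?B"
      using abs_profile_d2_le[OF slope_pos[of q], of "2 ^ q * x"] by (intro mult_left_mono) auto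
    finally show ?thesis .
  qed
  then have L: "\<bar>disp_d1 q a - disp_d1 q b\<bar> \<le> ?B * \<bar>a - b\<bar>" for a b by (rule real_lipschitz[OF disp_d1_deriv])
  have "norm ((disp q (y + k) - disp_d1 q y * (y + k)) - (disp q y - disp_d1 q y * y))
      \<le> (?B * \<bar>k\<bar>) * norm (y + k - y)"
  proof (rule field_differentiable_bound[of "closed_segment y (y + k)" _ "\<lambda>z. disp_d1 q z - disp_d1 q y"])
    fix z assume z: "z \<in> closed_segment y (y + k)"
    show "((\<lambda>z. disp q z - disp_d1 q y * z) has_field_derivative disp_d1 q z - disp_d1 q y) (at z within
        closed_segment y (y + k))"
      by (rule DERIV_subset[OF _ subset_UNIV]) (auto intro!: derivative_eq_intros disp_deriv)
    have "\<bar>z - y\<bar> \<le> \<bar>k\<bar>" using segment_bound1[OF z] by simp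
    then have "?B * \<bar>z - y\<bar> \<le> ?B * \<bar>k\<bar>" by (intro mult_left_mono) auto
    then show "norm (disp_d1 q z - disp_d1 q y) \<le> ?B * \<bar>k\<bar>" using L[of z y] unfolding real_norm_def by linarith
  qed auto
  then show ?thesis by (simp add: algebra_simps power2_eq_square abs_mult[symmetric])
qed

lemma integral_abs_diff_le:
  fixes f g :: "real \<Rightarrow> real"
  assumes "continuous_on {0..1} f" "continuous_on {0..1} g" "\<And>h. h \<in> {0..1} \<Longrightarrow> \<bar>f h - g h\<bar> \<le> B"
  shows "\<bar>integral {0..1} f - integral {0..1} g\<bar> \<le> B"
proof -
  have "norm (integral {0..1} (\<lambda>h. f h - g h)) \<le> B * (1 - 0)"
    by (rule integral_bound) (use assms in \<open>auto intro: continuous_intros\<close>)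
  moreover have "integral {0..1} (\<lambda>h. f h - g h) = integral {0..1} f - integral {0..1} g"
    by (intro integral_diff integrable_continuous_real assms)
  ultimately show ?thesis by simp
qed

text \<open>
  Along a segment of length \<open>1 / grad_scale (Suc q)\<close> in the direction \<open>stage_axis (Suc q)\<close>, the
  \<open>q\<close>-th shear acts as a motion by \<open>\<plusminus> 1 / grad_scale q\<close> along \<open>stage_axis q\<close>, wherever the
  profile slope \<open>\<sigma>\<close> is close to \<open>\<plusminus> 1\<close>. Combining both signs with the weights \<open>(1 \<plusminus> \<sigma>) / 2\<close>
  bounds the new averages by the old ones up to an error of order \<open>1 - \<sigma>\<^sup>2\<close>; the weights depend
  only on the transverse coordinate, so shear invariance of the integral applies.
\<close>

lemma mean_size_Suc_le: "mean_size (Suc q) \<le> mean_size q + 240 / root_slope q"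
proof -
  define F where "F = Psi q 1"
  define i where "i = stage_axis q"
  define j where "j = stage_axis (Suc q)"
  define r where "r = 1 / grad_scale q"
  define r' where "r' = 1 / grad_scale (Suc q)"
  define L where "L = 4 * pi * grad_scale q"
  define \<sigma> where "\<sigma> y = profile_d1 (slope q) (2 ^ q * y)" for y
  define B where "B = slope q * 2 ^ q * (12 * sqrt (slope q))"
  \<comment> \<open>The two errors that do not depend on the sign of the slope: the extent of the
    segment along \<open>ee j\<close>, and the curvature of the displacement over it.\<close>
  define e where "e = L * r' + L * (B * r'\<^sup>2)"
  have ij: "i \<noteq> j" by (simp add: i_def j_def stage_axis_Suc_neq)
  have grad_scale: "grad_scale q \<ge> 1" by (rule grad_scale_ge_1)
  have sl: "real (slope q) \<ge> 1" using slope_pos[of q] by linarith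
  have r: "r > 0" "r' > 0" "slope q * r' = r" "L * r = 4 * pi" "L > 0" "B \<ge> 0"
  proof -
    have "grad_scale q > 0" "slope q > 0" using grad_scale sl by auto
    then show "r > 0" "r' > 0" "slope q * r' = r" "L * r = 4 * pi" "L > 0" "B \<ge> 0"
      by (auto simp: r_def r'_def L_def B_def)
  qed
  have cF: "continuous_on UNIV F" and pF: "periodic F"
    by (auto simp: F_def continuous_Psi_slice Psi_periodic)
  have lip: "\<bar>F (Z + a *\<^sub>R ee i + b *\<^sub>R ee j) - F (Z + a' *\<^sub>R ee i)\<bar> \<le> L * \<bar>b\<bar> + L * \<bar>a - a'\<bar>" for Z a b a'
  proof -
    have "\<bar>F ((Z + a *\<^sub>R ee i) + b *\<^sub>R ee j) - F (Z + a *\<^sub>R ee i)\<bar> \<le> L * \<bar>b\<bar>"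
      unfolding F_def j_def L_def by (rule Psi_lipschitz)
    moreover have "\<bar>F ((Z + a' *\<^sub>R ee i) + (a - a') *\<^sub>R ee i) - F (Z + a' *\<^sub>R ee i)\<bar> \<le> L * \<bar>a - a'\<bar>"
      unfolding F_def i_def L_def by (rule Psi_lipschitz)
    moreover have "(Z + a' *\<^sub>R ee i) + (a - a') *\<^sub>R ee i = Z + a *\<^sub>R ee i" by (simp add: algebra_simps)
    ultimately show ?thesis by simp
  qed
  have \<sigma>1: "\<bar>\<sigma> y\<bar> \<le> 1" for y unfolding \<sigma>_def by (rule abs_profile_d1_le[OF slope_pos])
  have Dd: "\<bar>disp q (y + r' * h) - disp q y - r * h * \<sigma> y\<bar> \<le> B * r'\<^sup>2" if "h \<in> {0..1}" for y h
  proof -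
    have "\<bar>disp q (y + r' * h) - disp q y - (r' * h) * disp_d1 q y\<bar> \<le> B * (r' * h)\<^sup>2"
      unfolding B_def by (rule disp_taylor)
    also have "(r' * h)\<^sup>2 \<le> r'\<^sup>2" using that r by (intro power_mono mult_left_le) auto
    then have "B * (r' * h)\<^sup>2 \<le> B * r'\<^sup>2" using r by (intro mult_left_mono)
    moreover have "(r' * h) * disp_d1 q y = r * h * \<sigma> y"
      unfolding r(3)[symmetric] by (simp add: disp_d1_def \<sigma>_def)
    ultimately show ?thesis by linarith
  qed
  define S where "S X = X - disp q (X $ j) *\<^sub>R ee i" for X
  define A' where "A' = line_average r' j (Psi (Suc q) 1)"
  \<comment> \<open>Along the segment the sheared point moves by about
    \<open>- (r * h * \<sigma>)\<close> in direction \<open>ee i\<close>. \<open>Fp\<close> and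
    \<open>Fm\<close> are the models of the new average for slope \<open>1\<close> and slope
    \<open>-1\<close>.\<close>
  define Fp where "Fp X = integral {0..1} (\<lambda>h. F (S X + (- (r * h)) *\<^sub>R ee i))" for X
  define Fm where "Fm X = integral {0..1} (\<lambda>h. F (S X + (r * h) *\<^sub>R ee i))" for X
  have A': "A' X = integral {0..1} (\<lambda>h. F (X + (- disp q (X $ j + r' * h)) *\<^sub>R ee i + (r' * h) *\<^sub>R ee j))" for X
  proof -
    have "Psi (Suc q) 1 (X + (r' * h) *\<^sub>R ee j) = F (X + (- disp q (X $ j + r' * h)) *\<^sub>R ee i
        + (r' * h) *\<^sub>R ee j)" for h
    proof -
      have "shear q 1 (X + (r' * h) *\<^sub>R ee j) = X + (- disp q (X $ j + r' * h)) *\<^sub>R ee i + (r' * h) *\<^sub>R ee j"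
        by (simp add: shear_def ramp_1 i_def j_def ee_nth)
      then show ?thesis by (simp add: F_def)
    qed
    then show ?thesis by (simp add: A'_def line_average_def)
  qed
  have cF': "continuous_on {0..1} (\<lambda>h. F (G h))" if "continuous_on {0..1} G" for G :: "real \<Rightarrow> real^3"
    by (rule continuous_on_compose2[OF cF that]) auto
  have cdisp: "continuous_on {0..1} (\<lambda>h. disp q (a + r' * h))" for a
    by (rule continuous_on_compose2[OF continuous_disp[of UNIV]]) (auto intro!: continuous_intros)
  have dp: "\<bar>A' X - Fp X\<bar> \<le> e + L * (r * (1 - \<sigma> (X $ j)))" for X
    unfolding A' Fp_def
  proof (rule integral_abs_diff_le)
    fix h :: real assume h: "h \<in> {0..1}"
    let ?y = "X $ j"
    have "S X + (- (r * h)) *\<^sub>R ee i = X + (- disp q ?y - r * h) *\<^sub>R ee i"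
      by (simp add: S_def algebra_simps)
    then have "\<bar>F (X + (- disp q (?y + r' * h)) *\<^sub>R ee i + (r' * h) *\<^sub>R ee j) - F (S X + (- (r * h)) *\<^sub>R ee i)\<bar>
       \<le> L * \<bar>r' * h\<bar> + L * \<bar>- disp q (?y + r' * h) - (- disp q ?y - r * h)\<bar>"
      using lip by metis
    also have "\<bar>r' * h\<bar> \<le> r'" using h r by (auto simp: abs_mult mult_left_le)
    also have "\<bar>- disp q (?y + r' * h) - (- disp q ?y - r * h)\<bar> \<le> B * r'\<^sup>2 + r * (1 - \<sigma> ?y)"
    proof -
      have "0 \<le> r * h * (1 - \<sigma> ?y)" "r * h * (1 - \<sigma> ?y) \<le> r * 1 * (1 - \<sigma> ?y)"
        using h r \<sigma>1[of ?y] by (intro mult_nonneg_nonneg mult_right_mono mult_left_mono; auto)+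
      then show ?thesis using Dd[OF h, of ?y] by (simp add: algebra_simps)
    qed
    finally show "\<bar>F (X + (- disp q (?y + r' * h)) *\<^sub>R ee i + (r' * h) *\<^sub>R ee j) - F (S X
        + (- (r * h)) *\<^sub>R ee i)\<bar>
       \<le> e + L * (r * (1 - \<sigma> ?y))"
      using r by (simp add: e_def distrib_left)
  qed (intro cF' continuous_intros cdisp)+
  have dm: "\<bar>A' X - Fm X\<bar> \<le> e + L * (r * (1 + \<sigma> (X $ j)))" for X
    unfolding A' Fm_def
  proof (rule integral_abs_diff_le)
    fix h :: real assume h: "h \<in> {0..1}"
    let ?y = "X $ j"
    have "S X + (r * h) *\<^sub>R ee i = X + (- disp q ?y + r * h) *\<^sub>R ee i"
      by (simp add: S_def algebra_simps)
    then have "\<bar>F (X + (- disp q (?y + r' * h)) *\<^sub>R ee i + (r' * h) *\<^sub>R ee j) - F (S X + (r * h) *\<^sub>R ee i)\<bar>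
       \<le> L * \<bar>r' * h\<bar> + L * \<bar>- disp q (?y + r' * h) - (- disp q ?y + r * h)\<bar>"
      using lip by metis
    also have "\<bar>r' * h\<bar> \<le> r'" using h r by (auto simp: abs_mult mult_left_le)
    also have "\<bar>- disp q (?y + r' * h) - (- disp q ?y + r * h)\<bar> \<le> B * r'\<^sup>2 + r * (1 + \<sigma> ?y)"
    proof -
      have "0 \<le> r * h * (1 + \<sigma> ?y)" "r * h * (1 + \<sigma> ?y) \<le> r * 1 * (1 + \<sigma> ?y)"
        using h r \<sigma>1[of ?y] by (intro mult_nonneg_nonneg mult_right_mono mult_left_mono; auto)+
      then show ?thesis using Dd[OF h, of ?y] by (simp add: algebra_simps)
    qed
    finally show "\<bar>F (X + (- disp q (?y + r' * h)) *\<^sub>R ee i + (r' * h) *\<^sub>R ee j) - F (S X + (r * h) *\<^sub>R ee i)\<bar>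
       \<le> e + L * (r * (1 + \<sigma> ?y))"
      using r by (simp add: e_def distrib_left)
  qed (intro cF' continuous_intros cdisp)+
  define A where "A = line_average r i F"
  have cA: "continuous_on UNIV A" and pA: "periodic A"
    unfolding A_def by (auto intro: continuous_line_average periodic_line_average cF pF)
  have FmA: "Fm X = A (X + (- disp q (X $ j)) *\<^sub>R ee i)" for X
    by (simp add: Fm_def A_def line_average_def S_def)
  \<comment> \<open>A segment run backwards is a forward segment started a distance \<open>r\<close>
    earlier, so both models are values of the old average \<open>A\<close> at points moved along
    \<open>ee i\<close>.\<close>
  have FpA: "Fp X = A (X + (- disp q (X $ j) - r) *\<^sub>R ee i)" for X
  proof -
    have "integral {0..1} (\<lambda>h. F (S X + (- (r * h)) *\<^sub>R ee i)) = integral {-1..0} (\<lambda>h. F (S X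
        + (r * h) *\<^sub>R ee i))"
      using Henstock_Kurzweil_Integration.integral_reflect_real[of 0 "-1" "\<lambda>h. F (S X
          + (r * h) *\<^sub>R ee i)"] by simp
    also have "\<dots> = integral {0..1} (\<lambda>h. F (S X + (r * (h - 1)) *\<^sub>R ee i))"
      using integral_shift_real_ivl[of "-1" "-1" 0 "\<lambda>h. F (S X + (r * h) *\<^sub>R ee i)"] by simp
    also have "(\<lambda>h. F (S X + (r * (h - 1)) *\<^sub>R ee i)) = (\<lambda>h. F (X + (- disp q (X $ j) - r) *\<^sub>R ee i
        + (r * h) *\<^sub>R ee i))"
      by (simp add: S_def algebra_simps)
    finally show ?thesis by (simp add: Fp_def A_def line_average_def)
  qed
  define \<theta>p where "\<theta>p y = (1 + \<sigma> y) / 2" for y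
  define \<theta>m where "\<theta>m y = (1 - \<sigma> y) / 2" for y
  have c\<sigma>: "continuous_on UNIV \<sigma>" unfolding \<sigma>_def[abs_def]
    by (intro continuous_on_compose2[OF continuous_profile_d1[of UNIV]] continuous_intros) auto
  have c\<theta>: "continuous_on UNIV (\<lambda>X::real^3. \<theta>p (X $ j))" "continuous_on UNIV (\<lambda>X::real^3. \<theta>m (X $ j))"
      "continuous_on UNIV (\<lambda>X::real^3. \<sigma> (X $ j))"
    unfolding \<theta>p_def \<theta>m_def by (intro continuous_intros continuous_on_compose2[OF c\<sigma>]; simp)+
  have p1: "disp_d1 q (y + 1) = disp_d1 q y" for y
  proof -
    have "((\<lambda>y. disp q (y + 1)) has_real_derivative disp_d1 q (y + 1) * 1) (at y)"
      by (rule DERIV_chain2[OF disp_deriv]) (auto intro!: derivative_eq_intros)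
    then show ?thesis using disp_deriv[of q y] DERIV_unique by (simp add: disp_periodic) blast
  qed
  have p\<sigma>: "\<sigma> (y + 1) = \<sigma> y" for y
    using p1[of y] slope_pos[of q] by (simp add: disp_d1_def \<sigma>_def)
  have shearA: "torus_int (\<lambda>X. \<theta> (X $ j) * \<bar>A (X + g (X $ j) *\<^sub>R ee i)\<bar>) = torus_int (\<lambda>X. \<theta> (X $ j) * \<bar>A X\<bar>)"
    if "continuous_on UNIV (\<lambda>X::real^3. \<theta> (X $ j))" "\<And>y. \<theta> (y + 1) = \<theta> y"
      "continuous_on UNIV g" "\<And>y. g (y + 1) = g y" for \<theta> g
  proof -
    have "torus_int (\<lambda>X. (\<lambda>X. \<theta> (X $ j) * \<bar>A X\<bar>) (X + g (X $ j) *\<^sub>R ee i)) = torus_int (\<lambda>X. \<theta> (X $ j) * \<bar>A X\<bar>)"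
    proof (rule torus_int_shear)
      show "continuous_on UNIV (\<lambda>X. \<theta> (X $ j) * \<bar>A X\<bar>)" by (intro continuous_intros that cA)
      show "periodic (\<lambda>X. \<theta> (X $ j) * \<bar>A X\<bar>)"
        using pA that(2) by (simp add: periodic_def ee_nth)
    qed (use that ij in auto)
    moreover have "(X + g (X $ j) *\<^sub>R ee i) $ j = X $ j" for X using ij by (simp add: ee_nth)
    ultimately show ?thesis by (simp only:)
  qed
  have cA1: "continuous_on UNIV (\<lambda>X. A (X + g (X $ j) *\<^sub>R ee i))" if "continuous_on UNIV g" for g
    by (rule continuous_on_compose2[OF cA]) (auto intro!: continuous_intros continuous_on_compose2[OF that])
  have ptw: "\<bar>A' X\<bar> \<le> \<theta>p (X $ j) * \<bar>A (X + (- disp q (X $ j) - r) *\<^sub>R ee i)\<bar>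
     + \<theta>m (X $ j) * \<bar>A (X + (- disp q (X $ j)) *\<^sub>R ee i)\<bar> + (e + L * r * (1 - (\<sigma> (X $ j))\<^sup>2))" for X
  proof -
    let ?s = "\<sigma> (X $ j)"
    have t: "0 \<le> \<theta>p (X $ j)" "0 \<le> \<theta>m (X $ j)" "\<theta>p (X $ j) + \<theta>m (X $ j) = 1"
      using \<sigma>1[of "X $ j"] by (auto simp: \<theta>p_def \<theta>m_def abs_le_iff field_simps)
    have "\<theta>p (X $ j) * \<bar>A' X\<bar> \<le> \<theta>p (X $ j) * (\<bar>Fp X\<bar> + (e + L * (r * (1 - ?s))))"
      using dp[of X] t by (intro mult_left_mono) auto
    moreover have "\<theta>m (X $ j) * \<bar>A' X\<bar> \<le> \<theta>m (X $ j) * (\<bar>Fm X\<bar> + (e + L * (r * (1 + ?s))))"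
      using dm[of X] t by (intro mult_left_mono) auto
    moreover have "\<theta>p (X $ j) * \<bar>A' X\<bar> + \<theta>m (X $ j) * \<bar>A' X\<bar> = \<bar>A' X\<bar>"
      unfolding distrib_right[symmetric] t(3) by simp
    \<comment> \<open>Each weight meets an error proportional to the other one, so together the two
      errors give \<open>1 - ?s\<^sup>2\<close>.\<close>
    moreover have "\<theta>p (X $ j) * (a + (e + L * (r * (1 - ?s)))) + \<theta>m (X $ j) * (b + (e + L * (r * (1 + ?s))))
       = \<theta>p (X $ j) * a + \<theta>m (X $ j) * b + (e + L * r * (1 - ?s\<^sup>2))" for a b
      by (simp add: \<theta>p_def \<theta>m_def field_simps power2_eq_square)
    ultimately show ?thesis unfolding FpA FmA by smt
  qed
  have gc: "continuous_on UNIV (\<lambda>y. - disp q y - r)" "continuous_on UNIV (\<lambda>y. - disp q y)"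
    by (intro continuous_intros continuous_disp)+
  have cA': "continuous_on UNIV A'" unfolding A'_def by (intro continuous_line_average continuous_Psi_slice)
  have "mean_size (Suc q) = torus_int (\<lambda>X. \<bar>A' X\<bar>)" by (simp add: mean_size_def A'_def r'_def j_def)
  also have "\<dots> \<le> torus_int (\<lambda>X. \<theta>p (X $ j) * \<bar>A (X + (- disp q (X $ j) - r) *\<^sub>R ee i)\<bar>
     + \<theta>m (X $ j) * \<bar>A (X + (- disp q (X $ j)) *\<^sub>R ee i)\<bar> + (e + L * r * (1 - (\<sigma> (X $ j))\<^sup>2)))"
    by (rule torus_int_mono[OF _ _ ptw]) (intro continuous_intros cA' c\<theta> cA1 gc)+
  also have "\<dots> = torus_int (\<lambda>X. \<theta>p (X $ j) * \<bar>A (X + (- disp q (X $ j) - r) *\<^sub>R ee i)\<bar>)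
     + torus_int (\<lambda>X. \<theta>m (X $ j) * \<bar>A (X + (- disp q (X $ j)) *\<^sub>R ee i)\<bar>) + torus_int (\<lambda>X. e
         + L * r * (1 - (\<sigma> (X $ j))\<^sup>2))"
    by (subst torus_int_add, (intro continuous_intros c\<theta> cA1 gc)+, subst torus_int_add, (intro
        continuous_intros c\<theta> cA1 gc)+) simp
  also have "torus_int (\<lambda>X. \<theta>p (X $ j) * \<bar>A (X + (- disp q (X $ j) - r) *\<^sub>R ee i)\<bar>)
      = torus_int (\<lambda>X. \<theta>p (X $ j) * \<bar>A X\<bar>)"
    by (rule shearA[OF c\<theta>(1) _ gc(1)]) (simp_all add: \<theta>p_def p\<sigma> disp_periodic)
  also have "torus_int (\<lambda>X. \<theta>m (X $ j) * \<bar>A (X + (- disp q (X $ j)) *\<^sub>R ee i)\<bar>)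
      = torus_int (\<lambda>X. \<theta>m (X $ j) * \<bar>A X\<bar>)"
    by (rule shearA[OF c\<theta>(2) _ gc(2)]) (simp_all add: \<theta>m_def p\<sigma> disp_periodic)
  also have "torus_int (\<lambda>X. \<theta>p (X $ j) * \<bar>A X\<bar>) + torus_int (\<lambda>X. \<theta>m (X $ j) * \<bar>A X\<bar>) = torus_int (\<lambda>X. \<bar>A X\<bar>)"
  proof -
    have "torus_int (\<lambda>X. \<theta>p (X $ j) * \<bar>A X\<bar>) + torus_int (\<lambda>X. \<theta>m (X $ j) * \<bar>A X\<bar>)
        = torus_int (\<lambda>X. \<theta>p (X $ j) * \<bar>A X\<bar> + \<theta>m (X $ j) * \<bar>A X\<bar>)"
      by (rule torus_int_add[symmetric]) (intro continuous_intros c\<theta> cA)+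
    also have "(\<lambda>X. \<theta>p (X $ j) * \<bar>A X\<bar> + \<theta>m (X $ j) * \<bar>A X\<bar>) = (\<lambda>X. \<bar>A X\<bar>)"
      by (simp add: \<theta>p_def \<theta>m_def field_simps)
    finally show ?thesis .
  qed
  also have "torus_int (\<lambda>X. \<bar>A X\<bar>) = mean_size q" by (simp add: mean_size_def A_def r_def i_def F_def)
  also have "torus_int (\<lambda>X. e + L * r * (1 - (\<sigma> (X $ j))\<^sup>2)) = e + 4 * pi * torus_int (\<lambda>X. 1 - (\<sigma> (X $ j))\<^sup>2)"
    unfolding r(4)
    by (subst torus_int_add) (auto simp: torus_int_const torus_int_cmult intro!: continuous_intros c\<theta>)
  also have "torus_int (\<lambda>X. 1 - (\<sigma> (X $ j))\<^sup>2) \<le> 2 / root_slope q"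
  proof -
    define g where "g y = 2 * cos (2 * pi * y) ^ (2 * slope q)" for y
    have cg: "continuous_on UNIV g" unfolding g_def[abs_def] by (intro continuous_intros)
    have pg: "g (y + 1) = g y" for y by (simp add: g_def distrib_left)
    have pgn: "g (y + real m) = g y" for y m
    proof (induction m)
      case (Suc m)
      have "y + real (Suc m) = (y + real m) + 1" by simp
      then show ?case using Suc pg by metis
    qed simp
    have pg2: "g (2 ^ q * (y + 1)) = g (2 ^ q * y)" for y
      using pgn[of "2 ^ q * y" "2 ^ q"] by (simp add: distrib_left)
    have cg2: "continuous_on UNIV (\<lambda>y. g (2 ^ q * y))"
      by (rule continuous_on_compose2[OF cg]) (auto intro!: continuous_intros)
    have "torus_int (\<lambda>X. 1 - (\<sigma> (X $ j))\<^sup>2) \<le> torus_int (\<lambda>X. g (2 ^ q * X $ j))"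
    proof (rule torus_int_mono)
      show "1 - (\<sigma> (X $ j))\<^sup>2 \<le> g (2 ^ q * X $ j)" for X
        unfolding \<sigma>_def g_def by (rule profile_d1_defect[OF slope_pos])
      show "continuous_on UNIV (\<lambda>X::real^3. g (2 ^ q * X $ j))"
        by (rule continuous_on_compose2[OF cg]) (auto intro!: continuous_intros)
    qed (intro continuous_intros c\<theta>)
    also have "\<dots> = integral {0..1} (\<lambda>y. g (2 ^ q * y))" by (rule torus_int_coordinate[OF cg2 pg2])
    also have "\<dots> = integral {0..1} g" by (rule integral_periodic_scale[OF cg pg])
    also have "\<dots> = 2 * integral {0..1} (\<lambda>y. cos (2 * pi * y) ^ (2 * slope q))"
      by (simp add: g_def[abs_def])
    also have "\<dots> \<le> 2 * (1 / sqrt (2 * slope q + 1))" using integral_cos_power[of "slope q"] by simp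
    also have "1 / sqrt (2 * slope q + 1) \<le> 1 / sqrt (slope q)"
      using sl by (intro divide_left_mono) auto
    also have "sqrt (slope q) = root_slope q" by (simp add: slope_def)
    finally show ?thesis by simp
  qed
  \<comment> \<open>The curvature part equals
    \<open>48 * pi * (2 ^ q / grad_scale q) / root_slope q\<close>: the frequency is compensated by
    the gradient scale, and one square root of the slope is left in the denominator. The budget is
    \<open>200\<close> here and \<open>40\<close> for the corners, in total
    \<open>240\<close>.\<close>
  also have "e \<le> 200 / root_slope q"
  proof -
    have s: "real (slope q) = (real (root_slope q))\<^sup>2" by (simp add: slope_def)
    have sg: "real (root_slope q) \<ge> 10000" using root_slope_pos[of q] by linarith
    have "(2::real) ^ q \<le> 10000 ^ q" by (intro power_mono) auto
    then have q2: "2 ^ q \<le> grad_scale q" using grad_scale_ge[of q] by linarith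
    have "e = 4 * pi / (real (root_slope q))\<^sup>2 + 48 * pi * (2 ^ q / grad_scale q) / real (root_slope q)"
      using grad_scale sg unfolding e_def L_def r'_def B_def grad_scale.simps
        by (simp add: s field_simps power2_eq_square)
    also have "\<dots> \<le> 4 * pi / (real (root_slope q) * 10000) + 48 * pi * 1 / real (root_slope q)"
    proof (rule add_mono)
      have "real (root_slope q) * 10000 \<le> (real (root_slope q))\<^sup>2"
        unfolding power2_eq_square using sg by (intro mult_left_mono) auto
      then show "4 * pi / (real (root_slope q))\<^sup>2 \<le> 4 * pi / (real (root_slope q) * 10000)"
        by (rule divide_left_mono) (use sg in auto)
      have "2 ^ q / grad_scale q \<le> 1" using q2 grad_scale by simp
      then show "48 * pi * (2 ^ q / grad_scale q) / real (root_slope q) \<le> 48 * pi * 1 / real (root_slope q)"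
        by (intro divide_right_mono mult_left_mono) auto
    qed
    also have "\<dots> = (4 * pi / 10000 + 48 * pi) / real (root_slope q)" by (simp add: add_divide_distrib)
    also have "\<dots> \<le> 200 / real (root_slope q)"
      using pi_less_4 by (intro divide_right_mono) auto
    finally show ?thesis .
  qed
  finally have "mean_size (Suc q) \<le> mean_size q + (200 / root_slope q + 4 * pi * (2 / root_slope q))" by simp
  also have "4 * pi * (2 / root_slope q) \<le> 40 / root_slope q"
    using pi_less_4 pi_approx by (simp add: divide_simps)
  finally show ?thesis by (simp add: add_divide_distrib[symmetric])
qed

text \<open>\<open>240 / 10000 = 3 / 125\<close>, and
  \<open>1 / (q + 1)\<^sup>2 \<le> 2 / ((q + 1) * (q + 2))\<close> telescopes, which gives
  \<open>6 / 125\<close>.\<close>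

lemma mean_size_le: "mean_size q \<le> 1 / 20"
proof -
  have "mean_size q \<le> 6 / 125 * (1 - 1 / (real q + 1))"
  proof (induction q)
    case (Suc q)
    have "240 / real (root_slope q) = 3 / 125 / (real q + 1)\<^sup>2" by (simp add: root_slope_def)
    also have "\<dots> \<le> 6 / 125 * (1 / ((real q + 1) * (real q + 2)))"
      by (simp add: divide_simps) (simp add: power2_eq_square algebra_simps)
    also have "1 / ((real q + 1) * (real q + 2)) = 1 / (real q + 1) - 1 / (real (Suc q) + 1)"
      by (simp add: divide_simps)
    finally have le: "240 / real (root_slope q) \<le> 6 / 125 * (1 / (real q + 1) - 1 / (real (Suc q) + 1))" .
    have "m' \<le> 6 / 125 * (1 - b)" if "x \<le> 6 / 125 * (a - b)" "m \<le> 6 / 125 * (1 - a)" "m' \<le> m + x"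
      for x a b m m' :: real using that by (simp add: algebra_simps)
    from this[OF le Suc mean_size_Suc_le] show ?case .
  qed (simp add: mean_size_0)
  also have "\<dots> \<le> 6 / 125 * 1" by (intro mult_left_mono) auto
  finally show ?thesis by simp
qed

text \<open>Shears preserve the integral, so the value is that of the initial sine.\<close>

lemma torus_int_Psi_square: "torus_int (\<lambda>X. (Psi q t X)\<^sup>2) = 1 / 2"
proof (induction q)
  case 0
  have "torus_int (\<lambda>X. (Psi 0 t X)\<^sup>2) = integral {0..1} (\<lambda>y. (sin (2 * pi * y))\<^sup>2)"
    unfolding Psi.simps
    by (rule torus_int_coordinate[where g = "\<lambda>y. (sin (2 * pi * y))\<^sup>2"]) (auto intro!: continuous_intros
        simp: distrib_left)
  also have "\<dots> = 1 / 2"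
  proof -
    have "((\<lambda>y. (sin (2 * pi * y))\<^sup>2) has_integral (1 / 2 - sin (2 * (2 * pi * 1)) / (8 * pi)) - (0 / 2 -
        sin (2 * (2 * pi * 0)) / (8 * pi))) {0..1}"
    proof (rule fundamental_theorem_of_calculus)
      fix y :: real
      have "((\<lambda>y. y / 2 - sin (2 * (2 * pi * y)) / (8 * pi))
          has_real_derivative 1 / 2 - cos (2 * (2 * pi * y)) / 2) (at y)"
        by (auto intro!: derivative_eq_intros)
      moreover have "1 / 2 - cos (2 * (2 * pi * y)) / 2 = (sin (2 * pi * y))\<^sup>2"
        by (simp only: cos_double_sin) (simp add: field_simps)
      ultimately show "((\<lambda>y. y / 2 - sin (2 * (2 * pi * y)) / (8 * pi)) has_vector_derivative (sin (2 *
          pi * y))\<^sup>2) (at y within {0..1})"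
        by (simp add: has_real_derivative_iff_has_vector_derivative has_vector_derivative_at_within)
    qed simp
    moreover have "sin (2 * (2 * pi * 1)) = 0" by (simp only: sin_double) simp
    ultimately show ?thesis by (simp add: integral_unique)
  qed
  finally show ?case .
next
  case (Suc q)
  have "torus_int (\<lambda>X. (Psi (Suc q) t X)\<^sup>2) = torus_int (\<lambda>X. (\<lambda>X. (Psi q t X)\<^sup>2) (X
      + (- (ramp q t * disp q (X $ stage_axis (Suc q)))) *\<^sub>R ee (stage_axis q)))"
    by (simp add: shear_def)
  also have "\<dots> = torus_int (\<lambda>X. (Psi q t X)\<^sup>2)"
    by (rule torus_int_shear[where g = "\<lambda>y. - (ramp q t * disp q y)"])
      (use Psi_periodic[of q t] in \<open>auto intro!: continuous_intros continuous_Psi_slice continuous_disp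
        simp: periodic_def disp_periodic stage_axis_Suc_neq\<close>)
  finally show ?case using Suc by simp
qed

text \<open>Since \<open>\<bar>Psi q t X\<bar> \<le> 1\<close>, the square is the smaller function;
  conservation in \<open>L^2\<close> thus bounds the \<open>L^1\<close> norm from below.\<close>

lemma torus_int_abs_Psi_ge: "torus_int (\<lambda>X. \<bar>Psi q t X\<bar>) \<ge> 1 / 2"
proof -
  have "(Psi q t X)\<^sup>2 \<le> \<bar>Psi q t X\<bar>" for X
    using mult_left_mono[OF abs_Psi_le[of q t X], of "\<bar>Psi q t X\<bar>"] by (simp add: power2_eq_square)
  then have "torus_int (\<lambda>X. (Psi q t X)\<^sup>2) \<le> torus_int (\<lambda>X. \<bar>Psi q t X\<bar>)"
    by (intro torus_int_mono continuous_intros continuous_Psi_slice)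
  then show ?thesis by (simp add: torus_int_Psi_square)
qed

lemma Psi_after: "t \<ge> 1 / 2 \<Longrightarrow> Psi q t X = Psi q 1 X"
proof (induction q arbitrary: X)
  case (Suc q)
  have "ramp q t = 1" using Suc.prems stage_start_le_half[of "Suc q"] by (intro ramp_after) auto
  then have "shear q t X = shear q 1 X" by (simp add: shear_def ramp_1)
  then show ?case using Suc by simp
qed simp

section \<open>Sums of waves and Picard iteration\<close>

text \<open>A phase shift by \<open>pi / 2\<close> turns the cosine produced by differentiation back
  into a sine, so the induction stays within one family.\<close>

lemma C_k_on_wave:
  assumes "Ck_real k c"
  shows "C_k_on k spacetime (\<lambda>z. c (fst z) * sin (\<kappa> \<bullet> snd z + \<beta>))"
  using assms
proof (induction k arbitrary: c \<beta>)
  case 0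
  then show ?case
    by (auto intro!: continuous_intros continuous_on_compose2[of UNIV c])
next
  case (Suc k)
  then obtain c' where c': "\<And>t. (c has_real_derivative c' t) (at t)" "Ck_real k c'" by auto
  show ?case
  proof (rule C_k_on_SucI[OF unique_deriv_set_spacetime])
    fix z :: "real \<times> (real^3)"
    have C: "((\<lambda>z::real \<times> (real^3). c (fst z)) has_derivative (\<lambda>\<zeta>. fst \<zeta> * c' (fst z))) (at z within spacetime)"
      by (rule DERIV_compose_FDERIV[OF c'(1)]) (auto intro!: derivative_eq_intros)
    have K: "((\<lambda>z::real \<times> (real^3). \<kappa> \<bullet> snd z + \<beta>) has_derivative (\<lambda>\<zeta>. \<kappa> \<bullet> snd \<zeta>)) (at z within spacetime)"
      by (auto intro!: derivative_eq_intros)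
    have S: "((\<lambda>z::real \<times> (real^3). sin (\<kappa> \<bullet> snd z + \<beta>)) has_derivative (\<lambda>\<zeta>. (\<kappa> \<bullet> snd \<zeta>) * cos (\<kappa> \<bullet> snd z
        + \<beta>))) (at z within spacetime)"
      by (rule DERIV_compose_FDERIV[OF DERIV_sin K])
    show "((\<lambda>z. c (fst z) * sin (\<kappa> \<bullet> snd z + \<beta>)) has_derivative
        (\<lambda>\<zeta>. fst \<zeta> * (c' (fst z) * sin (\<kappa> \<bullet> snd z + \<beta>))
          + (\<kappa> \<bullet> snd \<zeta>) * (c (fst z) * sin (\<kappa> \<bullet> snd z + (\<beta> + pi / 2))))) (at z within spacetime)"
      by (rule has_derivative_eq_rhs[OF has_derivative_mult[OF C S]])
        (auto simp: sin_add algebra_simps cos_add)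
  next
    fix v :: "real \<times> (real^3)"
    show "C_k_on k spacetime (\<lambda>z. fst v * (c' (fst z) * sin (\<kappa> \<bullet> snd z + \<beta>))
          + (\<kappa> \<bullet> snd v) * (c (fst z) * sin (\<kappa> \<bullet> snd z + (\<beta> + pi / 2))))"
      by (intro C_k_on_add[OF unique_deriv_set_spacetime]
        C_k_on_linear_comp[OF unique_deriv_set_spacetime bounded_linear_mult_right] Suc.IH c'
            Ck_real_SucD[OF Suc.prems])
  qed
qed

lemma C_k_on_sine: "C_k_on k UNIV (\<lambda>x::real^3. sin (\<kappa> \<bullet> x + \<beta>))"
proof (induction k arbitrary: \<beta>)
  case 0
  show ?case by (auto intro!: continuous_intros)
next
  case (Suc k)
  show ?case
  proof (rule C_k_on_SucI[OF unique_deriv_set_UNIV])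
    fix z :: "real^3"
    have K: "((\<lambda>z::real^3. \<kappa> \<bullet> z + \<beta>) has_derivative (\<lambda>\<zeta>. \<kappa> \<bullet> \<zeta>)) (at z)"
      by (auto intro!: derivative_eq_intros)
    show "((\<lambda>z. sin (\<kappa> \<bullet> z + \<beta>)) has_derivative (\<lambda>\<zeta>. (\<kappa> \<bullet> \<zeta>) * sin (\<kappa> \<bullet> z + (\<beta> + pi / 2)))) (at z)"
      by (rule has_derivative_eq_rhs[OF DERIV_compose_FDERIV[OF DERIV_sin K]]) (auto simp: sin_add cos_add)
  next
    show "C_k_on k UNIV (\<lambda>z. (\<kappa> \<bullet> v) * sin (\<kappa> \<bullet> z + (\<beta> + pi / 2)))" for v
      by (rule C_k_on_linear_comp[OF unique_deriv_set_UNIV bounded_linear_mult_right]) (rule Suc)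
  qed
qed

text \<open>Wave vectors of functions on the torus that are independent of the third coordinate. For
  this reason the third velocity component has no divergence and advects nothing.\<close>

definition lattice_vec :: "real^3 \<Rightarrow> bool" where
  "lattice_vec \<kappa> \<longleftrightarrow> \<kappa> $ 3 = 0 \<and> (\<forall>i. \<exists>n::int. \<kappa> $ i = 2 * pi * of_int n)"

lemma lattice_vec_add: "lattice_vec a \<Longrightarrow> lattice_vec b \<Longrightarrow> lattice_vec (a + b)"
  and lattice_vec_diff: "lattice_vec a \<Longrightarrow> lattice_vec b \<Longrightarrow> lattice_vec (a - b)"
proof -
  assume a: "lattice_vec a" and b: "lattice_vec b"
  have "\<exists>n::int. (a + b) $ i = 2 * pi * of_int n" "\<exists>n::int. (a - b) $ i = 2 * pi * of_int n" for i
  proof -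
    obtain m n :: int where mn: "a $ i = 2 * pi * of_int m" "b $ i = 2 * pi * of_int n"
      using a b unfolding lattice_vec_def by metis
    show "\<exists>n::int. (a + b) $ i = 2 * pi * of_int n"
      by (rule exI[of _ "m + n"]) (simp add: mn distrib_left)
    show "\<exists>n::int. (a - b) $ i = 2 * pi * of_int n"
      by (rule exI[of _ "m - n"]) (simp add: mn right_diff_distrib)
  qed
  then show "lattice_vec (a + b)" "lattice_vec (a - b)" using a b by (simp_all add: lattice_vec_def)
qed

lemma lattice_vec_sin_periodic:
  assumes "lattice_vec \<kappa>" shows "sin (\<kappa> \<bullet> (x + ee i) + \<beta>) = sin (\<kappa> \<bullet> x + \<beta>)"
proof -
  obtain n :: int where "\<kappa> $ i = 2 * pi * of_int n" using assms unfolding lattice_vec_def by metis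
  then have eq: "\<kappa> \<bullet> (x + ee i) + \<beta> = (\<kappa> \<bullet> x + \<beta>) + 2 * pi * of_int n"
    by (simp add: inner_add_right inner_axis)
  show ?thesis unfolding eq sin_add[of "\<kappa> \<bullet> x + \<beta>"]
    by (simp only: sin_int_2pin cos_int_2pin mult_1_right mult_zero_right add_0_right)
qed

text \<open>
  A wave is a quadruple of amplitude \<open>c\<close>, wave vector \<open>\<kappa>\<close>, phase \<open>\<beta>\<close> and a number \<open>x\<close> such that
  \<open>|c t| \<le> x * exp (\<gamma> * t)\<close>, where a large \<open>\<gamma>\<close> makes the Picard map a contraction.
\<close>

type_synonym wave = "(real \<Rightarrow> real) \<times> (real^3) \<times> real \<times> real"

definition wave_sum :: "wave list \<Rightarrow> real \<Rightarrow> real^3 \<Rightarrow> real" where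
  "wave_sum L t X = (\<Sum>(c, \<kappa>, \<beta>, x)\<leftarrow>L. c t * sin (\<kappa> \<bullet> X + \<beta>))"
definition wave_time :: "wave list \<Rightarrow> real \<Rightarrow> real^3 \<Rightarrow> real" where
  "wave_time L t X = (\<Sum>(c, \<kappa>, \<beta>, x)\<leftarrow>L. deriv c t * sin (\<kappa> \<bullet> X + \<beta>))"
definition wave_grad :: "wave list \<Rightarrow> real \<Rightarrow> real^3 \<Rightarrow> real^3" where
  "wave_grad L t X = (\<Sum>(c, \<kappa>, \<beta>, x)\<leftarrow>L. (c t * cos (\<kappa> \<bullet> X + \<beta>)) *\<^sub>R \<kappa>)"
definition wave_second :: "3 \<Rightarrow> wave list \<Rightarrow> real \<Rightarrow> real^3 \<Rightarrow> real" where
  "wave_second i L t X = (\<Sum>(c, \<kappa>, \<beta>, x)\<leftarrow>L. - (\<kappa> $ i)\<^sup>2 * (c t * sin (\<kappa> \<bullet> X + \<beta>)))"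
definition wave_laplace :: "wave list \<Rightarrow> real \<Rightarrow> real^3 \<Rightarrow> real" where
  "wave_laplace L t X = (\<Sum>i\<in>UNIV. wave_second i L t X)"
text \<open>The square bounds the sum, its gradient and the Lipschitz constant of its gradient at
  once; the last is required because the residual must be Lipschitz. The factor
  \<open>1 + norm \<kappa>\<close> is submultiplicative under addition of wave vectors.\<close>

definition wave_weight :: "wave list \<Rightarrow> real" where
  "wave_weight L = (\<Sum>(c, \<kappa>, \<beta>, x)\<leftarrow>L. (1 + norm \<kappa>)\<^sup>2 * x)"
definition wave_bounded :: "real \<Rightarrow> wave list \<Rightarrow> bool" where
  "wave_bounded \<gamma> L \<longleftrightarrow> (\<forall>(c, \<kappa>, \<beta>, x)\<in>set L. smooth_real c \<and> lattice_vec \<kappa> \<and> 0 \<le> x \<and>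
     (\<forall>t\<in>{0..1}. \<bar>c t\<bar> \<le> x * exp (\<gamma> * t)))"

lemma wave_Nil [simp]: "wave_sum [] t X = 0" "wave_time [] t X = 0" "wave_grad [] t X
    = 0" "wave_second i [] t X = 0" "wave_laplace [] t X = 0" "wave_weight [] = 0"
    "wave_bounded \<gamma> []"
  by (simp_all add: wave_sum_def wave_time_def wave_grad_def wave_second_def wave_laplace_def
      wave_weight_def wave_bounded_def)

lemma wave_Cons: "wave_sum ((c, \<kappa>, \<beta>, x) # L) t X = c t * sin (\<kappa> \<bullet> X + \<beta>) + wave_sum L t X"
  "wave_time ((c, \<kappa>, \<beta>, x) # L) t X = deriv c t * sin (\<kappa> \<bullet> X + \<beta>) + wave_time L t X"
  "wave_grad ((c, \<kappa>, \<beta>, x) # L) t X = (c t * cos (\<kappa> \<bullet> X + \<beta>)) *\<^sub>R \<kappa> + wave_grad L t X"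
  "wave_second i ((c, \<kappa>, \<beta>, x) # L) t X = - (\<kappa> $ i)\<^sup>2 * (c t * sin (\<kappa> \<bullet> X + \<beta>)) + wave_second i L t X"
  "wave_weight ((c, \<kappa>, \<beta>, x) # L) = (1 + norm \<kappa>)\<^sup>2 * x + wave_weight L"
  "wave_bounded \<gamma> ((c, \<kappa>, \<beta>, x) # L) \<longleftrightarrow> (smooth_real c \<and> lattice_vec \<kappa> \<and> 0 \<le> x \<and>
     (\<forall>t\<in>{0..1}. \<bar>c t\<bar> \<le> x * exp (\<gamma> * t))) \<and> wave_bounded \<gamma> L"
  by (simp_all add: wave_sum_def wave_time_def wave_grad_def wave_second_def wave_weight_def wave_bounded_def)

lemma wave_laplace_Cons: "wave_laplace ((c, \<kappa>, \<beta>, x) # L) t X = - (\<kappa> \<bullet> \<kappa>) * (c t * sin (\<kappa> \<bullet> X + \<beta>))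
    + wave_laplace L t X"
proof -
  have "\<kappa> \<bullet> \<kappa> = (\<Sum>i\<in>UNIV. (\<kappa> $ i)\<^sup>2)" by (simp add: inner_vec_def power2_eq_square)
  then show ?thesis
    by (simp add: wave_laplace_def wave_Cons sum.distrib sum_negf sum_distrib_right sum_subtractf)
qed

lemma wave_append: "wave_sum (L @ L') t X = wave_sum L t X + wave_sum L' t X" "wave_time (L @ L') t X
    = wave_time L t X + wave_time L' t X"
  "wave_grad (L @ L') t X = wave_grad L t X + wave_grad L' t X" "wave_second i (L @ L') t X
      = wave_second i L t X + wave_second i L' t X"
  "wave_laplace (L @ L') t X = wave_laplace L t X + wave_laplace L' t X"
  "wave_weight (L @ L') = wave_weight L + wave_weight L'" "wave_bounded \<gamma> (L @ L') \<longleftrightarrow> wave_bounded \<gamma> L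
      \<and> wave_bounded \<gamma> L'"
  by (simp_all add: wave_sum_def wave_time_def wave_grad_def wave_second_def wave_weight_def
      wave_bounded_def wave_laplace_def sum.distrib ball_Un)

text \<open>\<open>heat_defect\<close> differentiates the amplitudes, so the bounds in
  \<open>wave_bounded\<close> do not survive it; this is the part that does.\<close>

definition wave_smooth :: "wave list \<Rightarrow> bool" where
  "wave_smooth L \<longleftrightarrow> (\<forall>(c, \<kappa>, \<beta>, x)\<in>set L. smooth_real c \<and> lattice_vec \<kappa>)"

lemma wave_bounded_imp_smooth: "wave_bounded \<gamma> L \<Longrightarrow> wave_smooth L"
  by (auto simp: wave_bounded_def wave_smooth_def)

lemma wave_sum_smooth:
  assumes "wave_smooth L" shows "smooth_torus_time (wave_sum L)"
proof -
  have per: "wave_sum L t (x + ee i) = wave_sum L t x" for t x i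
    using assms by (induction L) (auto simp: wave_Cons lattice_vec_sin_periodic wave_smooth_def)
  have "C_k_on k spacetime (\<lambda>(t, x). wave_sum L t x)" for k
    using assms
  proof (induction L)
    case Nil
    show ?case by (simp add: split_def C_k_on_const[OF unique_deriv_set_spacetime])
  next
    case (Cons w L)
    obtain c \<kappa> \<beta> x where w: "w = (c, \<kappa>, \<beta>, x)" by (metis prod_cases4)
    have "C_k_on k spacetime (\<lambda>z. c (fst z) * sin (\<kappa> \<bullet> snd z + \<beta>) + wave_sum L (fst z) (snd z))"
      using Cons by (intro C_k_on_add[OF unique_deriv_set_spacetime] C_k_on_wave)
        (auto simp: w wave_smooth_def smooth_real_def split_def)
    then show ?case by (simp add: w wave_Cons split_def)
  qed
  then show ?thesis using per by (simp add: smooth_torus_time_def smooth_on_def periodic_def)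
qed

lemma smooth_real_deriv: "smooth_real c \<Longrightarrow> (c has_real_derivative deriv c t) (at t)" "smooth_real c
    \<Longrightarrow> smooth_real (deriv c)"
proof -
  assume c: "smooth_real c"
  obtain c' where c': "smooth_real c'" "\<And>t. (c has_real_derivative c' t) (at t)"
    using smooth_real_derivative[OF c] by metis
  then have "deriv c = c'" by (intro ext DERIV_imp_deriv)
  then show "(c has_real_derivative deriv c t) (at t)" "smooth_real (deriv c)" using c' by auto
qed

lemma wave_sum_time_derivative: "wave_bounded \<gamma> L \<Longrightarrow> ((\<lambda>t. wave_sum L t X)
    has_real_derivative wave_time L t X) (at t)"
proof (induction L)
  case (Cons w L)
  obtain c \<kappa> \<beta> x where w: "w = (c, \<kappa>, \<beta>, x)" by (metis prod_cases4)
  have "((\<lambda>t. c t * sin (\<kappa> \<bullet> X + \<beta>) + wave_sum L t X) has_real_derivative deriv c t * sin (\<kappa> \<bullet> X + \<beta>)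
      + wave_time L t X) (at t)"
    using Cons by (intro DERIV_add DERIV_cmult_right smooth_real_deriv) (auto simp: w wave_Cons)
  then show ?case by (simp add: w wave_Cons)
qed simp

lemma inner_line: "\<kappa> \<bullet> (X + h *\<^sub>R ee i) = \<kappa> \<bullet> X + h * \<kappa> $ i"
  by (simp add: inner_add_right inner_axis)

lemma wave_sum_line_derivative: "((\<lambda>h. wave_sum L t (X + h *\<^sub>R ee i))
    has_real_derivative wave_grad L t X $ i) (at 0)"
proof (induction L)
  case (Cons w L)
  obtain c \<kappa> \<beta> x where w: "w = (c, \<kappa>, \<beta>, x)" by (metis prod_cases4)
  have "((\<lambda>h. c t * sin (\<kappa> \<bullet> (X + h *\<^sub>R ee i) + \<beta>)) has_real_derivative c t * cos (\<kappa> \<bullet> X + \<beta>) * \<kappa> $ i) (at 0)"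
    unfolding inner_line by (auto intro!: derivative_eq_intros simp: power2_eq_square)
  from DERIV_add[OF this Cons] show ?case by (simp add: w wave_Cons)
qed simp

lemma wave_grad_line_derivative: "((\<lambda>h. wave_grad L t (X + h *\<^sub>R ee i) $ i)
    has_real_derivative wave_second i L t X) (at 0)"
proof (induction L)
  case (Cons w L)
  obtain c \<kappa> \<beta> x where w: "w = (c, \<kappa>, \<beta>, x)" by (metis prod_cases4)
  have "((\<lambda>h. c t * cos (\<kappa> \<bullet> (X + h *\<^sub>R ee i) + \<beta>) * \<kappa> $ i)
      has_real_derivative - (\<kappa> $ i)\<^sup>2 * (c t * sin (\<kappa> \<bullet> X + \<beta>))) (at 0)"
    unfolding inner_line by (auto intro!: derivative_eq_intros simp: power2_eq_square)
  from DERIV_add[OF this Cons] show ?case by (simp add: w wave_Cons)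
qed simp

lemma continuous_wave_time: "wave_bounded \<gamma> L \<Longrightarrow> continuous_on UNIV (\<lambda>z. wave_time L (fst z) (snd z))"
  and continuous_wave_grad: "wave_bounded \<gamma> L \<Longrightarrow> continuous_on UNIV (\<lambda>z. wave_grad L (fst z) (snd z))"
  and continuous_wave_second: "wave_bounded \<gamma> L \<Longrightarrow> continuous_on UNIV (\<lambda>z. wave_second i L (fst z) (snd z))"
  and continuous_wave_sum: "wave_bounded \<gamma> L \<Longrightarrow> continuous_on UNIV (\<lambda>z. wave_sum L (fst z) (snd z))"
proof -
  assume "wave_bounded \<gamma> L"
  then have "continuous_on UNIV (\<lambda>z. wave_time L (fst z) (snd z))
      \<and> continuous_on UNIV (\<lambda>z. wave_grad L (fst z) (snd z))
      \<and> continuous_on UNIV (\<lambda>z. wave_second i L (fst z) (snd z))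
          \<and> continuous_on UNIV (\<lambda>z. wave_sum L (fst z) (snd z))"
  proof (induction L)
    case (Cons w L)
    obtain c \<kappa> \<beta> x where w: "w = (c, \<kappa>, \<beta>, x)" by (metis prod_cases4)
    have "smooth_real c" using Cons.prems by (simp add: w wave_Cons)
    then have c: "continuous_on UNIV c" "continuous_on UNIV (deriv c)"
      by (auto intro: smooth_real_continuous smooth_real_deriv)
    have "wave_bounded \<gamma> L" using Cons.prems by (simp add: w wave_Cons)
    note IH = Cons.IH[OF this]
    show ?case unfolding w wave_Cons
      by (intro conjI continuous_intros continuous_on_compose2[OF c(1)] continuous_on_compose2[OF c(2)]
          IH[THEN conjunct1]
        IH[THEN conjunct2, THEN conjunct1] IH[THEN conjunct2, THEN conjunct2, THEN conjunct1]
        IH[THEN conjunct2, THEN conjunct2, THEN conjunct2] subset_UNIV)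
  qed simp
  then show "continuous_on UNIV (\<lambda>z. wave_time L (fst z) (snd z))" "continuous_on UNIV (\<lambda>z. wave_grad L
      (fst z) (snd z))"
    "continuous_on UNIV (\<lambda>z. wave_second i L (fst z) (snd z))" "continuous_on UNIV (\<lambda>z. wave_sum L (fst
        z) (snd z))" by auto
qed

lemma wave_grad_third: "wave_bounded \<gamma> L \<Longrightarrow> wave_grad L t X $ 3 = 0"
  by (induction L) (auto simp: wave_Cons lattice_vec_def)

lemma wave_weight_nonneg: "wave_bounded \<gamma> L \<Longrightarrow> 0 \<le> wave_weight L"
  by (induction L) (auto simp: wave_Cons)

lemma wave_bounds:
  assumes "wave_bounded \<gamma> L" "t \<in> {0..1}" "\<gamma> \<ge> 0"
  shows "\<bar>wave_sum L t X\<bar> \<le> wave_weight L * exp \<gamma>" "norm (wave_grad L t X) \<le> wave_weight L * exp \<gamma>"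
    "norm (wave_grad L t X - wave_grad L t Y) \<le> wave_weight L * exp \<gamma> * dist X Y"
proof -
  have "\<bar>wave_sum L t X\<bar> \<le> wave_weight L * exp \<gamma> \<and> norm (wave_grad L t X) \<le> wave_weight L * exp \<gamma> \<and>
    norm (wave_grad L t X - wave_grad L t Y) \<le> wave_weight L * exp \<gamma> * dist X Y"
    using assms(1)
  proof (induction L)
    case (Cons w L)
    obtain c \<kappa> \<beta> x where w: "w = (c, \<kappa>, \<beta>, x)" by (metis prod_cases4)
    have g: "0 \<le> x" "\<bar>c t\<bar> \<le> x * exp (\<gamma> * t)" "wave_bounded \<gamma> L"
      using Cons.prems assms(2) by (auto simp: w wave_Cons)
    note IH = Cons.IH[OF g(3)]
    have "exp (\<gamma> * t) \<le> exp \<gamma>" using assms(2,3) by (simp add: mult_left_le)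
    then have "x * exp (\<gamma> * t) \<le> x * exp \<gamma>" using g(1) by (rule mult_left_mono)
    then have c: "\<bar>c t\<bar> \<le> x * exp \<gamma>" using g(2) by linarith
    let ?n = "norm \<kappa>"
    have n: "1 \<le> (1 + ?n)\<^sup>2" "?n \<le> (1 + ?n)\<^sup>2" "?n * ?n \<le> (1 + ?n)\<^sup>2"
      by (simp_all add: power2_eq_square algebra_simps add_increasing)
    have xe: "0 \<le> x * exp \<gamma>" using g by simp
    have 1: "\<bar>c t * sin (\<kappa> \<bullet> X + \<beta>)\<bar> \<le> (1 + ?n)\<^sup>2 * x * exp \<gamma>"
    proof -
      have "\<bar>c t * sin (\<kappa> \<bullet> X + \<beta>)\<bar> \<le> (x * exp \<gamma>) * 1"
        unfolding abs_mult by (intro mult_mono c) (use xe in auto)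
      also have "\<dots> \<le> (x * exp \<gamma>) * (1 + ?n)\<^sup>2" by (rule mult_left_mono[OF n(1) xe])
      finally show ?thesis by (simp add: mult_ac)
    qed
    have 2: "norm ((c t * cos (\<kappa> \<bullet> X + \<beta>)) *\<^sub>R \<kappa>) \<le> (1 + ?n)\<^sup>2 * x * exp \<gamma>"
    proof -
      have "norm ((c t * cos (\<kappa> \<bullet> X + \<beta>)) *\<^sub>R \<kappa>) \<le> (x * exp \<gamma>) * 1 * ?n"
        unfolding norm_scaleR abs_mult by (intro mult_mono c) (use xe in auto)
      also have "\<dots> \<le> (x * exp \<gamma>) * (1 + ?n)\<^sup>2" using mult_left_mono[OF n(2) xe] by simp
      finally show ?thesis by (simp add: mult_ac)
    qed
    have 3: "norm ((c t * cos (\<kappa> \<bullet> X + \<beta>)) *\<^sub>R \<kappa> - (c t * cos (\<kappa> \<bullet> Y + \<beta>)) *\<^sub>R \<kappa>) \<le> (1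
        + ?n)\<^sup>2 * x * exp \<gamma> * dist X Y"
    proof -
      have "\<bar>cos a - cos b\<bar> \<le> 1 * \<bar>a - b\<bar>" for a b :: real
        using field_differentiable_bound[of UNIV cos "\<lambda>x. - sin x" 1 a b] by (auto intro!: derivative_eq_intros)
      from this[of "\<kappa> \<bullet> X + \<beta>" "\<kappa> \<bullet> Y + \<beta>"]
      have "\<bar>cos (\<kappa> \<bullet> X + \<beta>) - cos (\<kappa> \<bullet> Y + \<beta>)\<bar> \<le> \<bar>\<kappa> \<bullet> (X - Y)\<bar>" by (simp add: inner_diff_right)
      also have "\<dots> \<le> ?n * dist X Y" using Cauchy_Schwarz_ineq2[of \<kappa> "X - Y"] by (simp add: dist_norm)
      finally have d: "\<bar>cos (\<kappa> \<bullet> X + \<beta>) - cos (\<kappa> \<bullet> Y + \<beta>)\<bar> \<le> ?n * dist X Y" .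
      have "norm ((c t * cos (\<kappa> \<bullet> X + \<beta>)) *\<^sub>R \<kappa> - (c t * cos (\<kappa> \<bullet> Y + \<beta>)) *\<^sub>R \<kappa>)
         = \<bar>c t\<bar> * \<bar>cos (\<kappa> \<bullet> X + \<beta>) - cos (\<kappa> \<bullet> Y + \<beta>)\<bar> * ?n"
        unfolding scaleR_left_diff_distrib[symmetric] right_diff_distrib[symmetric] norm_scaleR abs_mult ..
      also have "\<dots> \<le> (x * exp \<gamma>) * (?n * dist X Y) * ?n"
        by (intro mult_mono c d) (use xe in auto)
      also have "\<dots> = (x * exp \<gamma>) * (?n * ?n) * dist X Y" by (simp add: mult_ac)
      also have "\<dots> \<le> (x * exp \<gamma>) * (1 + ?n)\<^sup>2 * dist X Y"
        by (intro mult_right_mono mult_left_mono n xe) auto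
      finally show ?thesis by (simp add: mult_ac)
    qed
    show ?case unfolding w wave_Cons distrib_right
      using IH 1 2 3 norm_triangle_le[OF add_mono[OF 2 IH[THEN conjunct2, THEN conjunct1]]]
        norm_triangle_le[OF add_mono[OF 3 IH[THEN conjunct2, THEN conjunct2]]]
      by (auto simp: algebra_simps intro: abs_triangle_ineq[THEN order_trans])
  qed simp
  then show "\<bar>wave_sum L t X\<bar> \<le> wave_weight L * exp \<gamma>" "norm (wave_grad L t X) \<le> wave_weight L * exp \<gamma>"
    "norm (wave_grad L t X - wave_grad L t Y) \<le> wave_weight L * exp \<gamma> * dist X Y" by auto
qed

text \<open>The components are amplitude, wave vector, phase and direction of the velocity.\<close>

type_synonym vwave = "(real \<Rightarrow> real) \<times> (real^3) \<times> real \<times> (real^3)"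

definition vwave_sum :: "vwave list \<Rightarrow> real \<Rightarrow> real^3 \<Rightarrow> real^3" where
  "vwave_sum P t X = (\<Sum>(c, \<kappa>, \<beta>, d)\<leftarrow>P. (c t * sin (\<kappa> \<bullet> X + \<beta>)) *\<^sub>R d)"

definition vwave_bounded :: "real \<Rightarrow> vwave list \<Rightarrow> bool" where
  "vwave_bounded M P \<longleftrightarrow> 0 \<le> M \<and> (\<forall>(c, \<kappa>, \<beta>, d)\<in>set P. smooth_real c \<and> lattice_vec \<kappa> \<and> (\<forall>t\<in>{0..1}. \<bar>c t\<bar> \<le> M))"

text \<open>
  The factor by which one Picard step multiplies the weight of a wave with wave vector \<open>\<kappa>\<close>: the
  product with a velocity mode \<open>\<eta>\<close> has wave vectors \<open>\<eta> \<plusminus> \<kappa>\<close>, and Duhamel's formula gains the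
  denominators.
\<close>

definition gain :: "real \<Rightarrow> real \<Rightarrow> real \<Rightarrow> vwave list \<Rightarrow> real^3 \<Rightarrow> real" where
  "gain M \<nu> \<gamma> P \<kappa> = (\<Sum>(c, \<eta>, \<beta>, d)\<leftarrow>P.
     M * norm d * norm \<kappa> * (1 + norm \<eta>)\<^sup>2 / (\<nu> * (norm (\<eta> + \<kappa>))\<^sup>2 + \<gamma>)
   + M * norm d * norm \<kappa> * (1 + norm \<eta>)\<^sup>2 / (\<nu> * (norm (\<eta> - \<kappa>))\<^sup>2 + \<gamma>))"

text \<open>Young's inequality \<open>norm \<mu> \<le> \<epsilon> * \<nu> * (norm \<mu>)\<^sup>2 + 1
  / (4 * \<epsilon> * \<nu>)\<close>: the derivative lost in the advection term is absorbed by
  diffusion up to a constant, and the constant by \<open>\<gamma>\<close>.\<close>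

lemma gain_single:
  assumes "\<nu> > 0" "\<delta> > 0"
  shows "\<exists>\<gamma>0>0. \<forall>\<gamma>\<ge>\<gamma>0. \<forall>\<kappa> \<mu>. norm \<kappa> \<le> norm \<mu> + k \<longrightarrow> A * norm \<kappa> / (\<nu> * (norm \<mu>)\<^sup>2 + \<gamma>) \<le> \<delta>"
proof -
  define a where "a = \<bar>A\<bar> + 1"
  define \<epsilon> where "\<epsilon> = \<delta> / a"
  have a: "a > 0" "A \<le> a" by (auto simp: a_def)
  have e: "\<epsilon> > 0" using assms a by (simp add: \<epsilon>_def)
  define \<gamma>0 where "\<gamma>0 = (1 / (4 * \<epsilon> * \<nu>) + \<bar>k\<bar>) / \<epsilon> + 1"
  have g0: "\<gamma>0 > 0" using e assms by (auto simp: \<gamma>0_def intro!: add_nonneg_pos divide_nonneg_pos)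
  have "A * norm \<kappa> / (\<nu> * (norm \<mu>)\<^sup>2 + \<gamma>) \<le> \<delta>" if g: "\<gamma> \<ge> \<gamma>0" and k: "norm \<kappa> \<le> norm \<mu> + k" for \<gamma>
    and \<kappa> :: "'a" and \<mu> :: "'b"
  proof -
    have pos: "\<nu> * (norm \<mu>)\<^sup>2 + \<gamma> > 0" using g g0 assms by (intro add_nonneg_pos) auto
    have "0 \<le> \<epsilon> * \<nu> * (norm \<mu> - 1 / (2 * \<epsilon> * \<nu>))\<^sup>2" using e assms by simp
    also have "\<dots> = \<epsilon> * \<nu> * (norm \<mu>)\<^sup>2 - norm \<mu> + 1 / (4 * \<epsilon> * \<nu>)"
      using e assms by (simp add: power2_eq_square field_simps)
    finally have 1: "norm \<mu> \<le> \<epsilon> * (\<nu> * (norm \<mu>)\<^sup>2) + 1 / (4 * \<epsilon> * \<nu>)" by simp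
    have "(1 / (4 * \<epsilon> * \<nu>) + \<bar>k\<bar>) / \<epsilon> \<le> \<gamma>" using g by (simp add: \<gamma>0_def)
    then have "1 / (4 * \<epsilon> * \<nu>) + \<bar>k\<bar> \<le> \<epsilon> * \<gamma>" using e by (simp add: divide_le_eq mult.commute)
    with 1 k have "norm \<kappa> \<le> \<epsilon> * (\<nu> * (norm \<mu>)\<^sup>2 + \<gamma>)" by (simp add: distrib_left)
    then have "a * norm \<kappa> \<le> a * (\<epsilon> * (\<nu> * (norm \<mu>)\<^sup>2 + \<gamma>))" using a by (intro mult_left_mono) auto
    moreover have "A * norm \<kappa> \<le> a * norm \<kappa>" using a by (intro mult_right_mono) auto
    moreover have "a * (\<epsilon> * (\<nu> * (norm \<mu>)\<^sup>2 + \<gamma>)) = \<delta> * (\<nu> * (norm \<mu>)\<^sup>2 + \<gamma>)" using a by (simp add: \<epsilon>_def)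
    ultimately show ?thesis using pos by (simp add: divide_le_eq)
  qed
  then show ?thesis using g0 by blast
qed

text \<open>There are finitely many velocity modes, and passing from \<open>\<kappa>\<close> to
  \<open>\<eta> \<plusminus> \<kappa>\<close> changes the length by at most
  \<open>norm \<eta>\<close>; hence one \<open>\<gamma>\<close> serves all wave vectors.\<close>

lemma gain_small:
  assumes "\<nu> > 0" "\<delta> > 0"
  shows "\<exists>\<gamma>0>0. \<forall>\<gamma>\<ge>\<gamma>0. \<forall>\<kappa>. gain M \<nu> \<gamma> P \<kappa> \<le> \<delta>"
  using assms(2)
proof (induction P arbitrary: \<delta>)
  case Nil
  then show ?case by (intro exI[of _ 1]) (auto simp: gain_def)
next
  case (Cons p P)
  obtain c \<eta> \<beta> d where p: "p = (c, \<eta>, \<beta>, d)" by (metis prod_cases4)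
  define A where "A = M * norm d * (1 + norm \<eta>)\<^sup>2"
  obtain \<gamma>1 where g1: "\<gamma>1 > 0" "\<And>\<gamma> \<kappa>. \<gamma> \<ge> \<gamma>1 \<Longrightarrow> gain M \<nu> \<gamma> P \<kappa> \<le> \<delta> / 2"
    using Cons.IH[of "\<delta> / 2"] Cons.prems by auto
  have "\<exists>\<gamma>0>0. \<forall>\<gamma>\<ge>\<gamma>0. \<forall>(\<kappa>::real^3) (\<mu>::real^3). norm \<kappa> \<le> norm \<mu> + norm \<eta> \<longrightarrow>
      A * norm \<kappa> / (\<nu> * (norm \<mu>)\<^sup>2 + \<gamma>) \<le> \<delta> / 4"
    by (rule gain_single[OF assms(1)]) (use Cons.prems in simp)
  then obtain \<gamma>2 where g2: "\<gamma>2 > 0" "\<gamma> \<ge> \<gamma>2 \<Longrightarrow> norm \<kappa> \<le> norm \<mu> + norm \<eta> \<Longrightarrow>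
      A * norm \<kappa> / (\<nu> * (norm \<mu>)\<^sup>2 + \<gamma>) \<le> \<delta> / 4" for \<gamma> and \<kappa> \<mu> :: "real^3"
    by blast
  show ?case
  proof (intro exI[of _ "max \<gamma>1 \<gamma>2"] conjI allI impI)
    fix \<gamma> and \<kappa> :: "real^3" assume g: "max \<gamma>1 \<gamma>2 \<le> \<gamma>"
    have k1: "norm \<kappa> \<le> norm (\<eta> + \<kappa>) + norm \<eta>" using norm_triangle_ineq4[of "\<eta> + \<kappa>" \<eta>] by simp
    have k2: "norm \<kappa> \<le> norm (\<eta> - \<kappa>) + norm \<eta>" using norm_triangle_ineq4[of \<eta> "\<eta> - \<kappa>"] by simp
    have "gain M \<nu> \<gamma> (p # P) \<kappa> = A * norm \<kappa> / (\<nu> * (norm (\<eta> + \<kappa>))\<^sup>2 + \<gamma>)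
        + A * norm \<kappa> / (\<nu> * (norm (\<eta> - \<kappa>))\<^sup>2 + \<gamma>) + gain M \<nu> \<gamma> P \<kappa>"
      by (simp add: gain_def p A_def mult_ac)
    also have "\<dots> \<le> \<delta> / 4 + \<delta> / 4 + \<delta> / 2"
      using g by (intro add_mono g1(2) g2(2) k1 k2) auto
    finally show "gain M \<nu> \<gamma> (p # P) \<kappa> \<le> \<delta>" by simp
  qed (use g1 in auto)
qed

text \<open>Duhamel's formula with integrating factor \<open>exp (\<mu> * t)\<close>. Against a
  source growing like \<open>exp (\<gamma> * t)\<close>, the decay rate and the exponential weight
  add up in the denominator.\<close>

lemma heat_amplitude:
  assumes \<mu>: "\<mu> \<ge> 0" and \<gamma>: "\<gamma> > 0" and F: "smooth_real F" and x: "0 \<le> x"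
    and Fb: "\<And>t. t \<in> {0..1} \<Longrightarrow> \<bar>F t\<bar> \<le> x * exp (\<gamma> * t)"
  shows "\<exists>b. smooth_real b \<and> b 0 = 0 \<and> (\<forall>t. (b has_real_derivative - \<mu> * b t + F t) (at t)) \<and>
     (\<forall>t\<in>{0..1}. \<bar>b t\<bar> \<le> x / (\<mu> + \<gamma>) * exp (\<gamma> * t))"
proof -
  have "continuous_on UNIV (\<lambda>t. exp (\<mu> * t) * F t)" by (intro continuous_intros smooth_real_continuous F)
  from antiderivative_real[OF this] obtain G where
    G: "G 0 = 0" "\<And>t. (G has_real_derivative exp (\<mu> * t) * F t) (at t)" by auto
  define b where "b t = exp (- \<mu> * t) * G t" for t
  have D: "(b has_real_derivative - \<mu> * b t + F t) (at t)" for t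
  proof -
    have "((\<lambda>t. exp (- \<mu> * t)) has_real_derivative - \<mu> * exp (- \<mu> * t)) (at t)"
      by (auto intro!: derivative_eq_intros)
    from DERIV_mult[OF this G(2)[of t]]
    have D1: "(b has_real_derivative - \<mu> * exp (- \<mu> * t) * G t + (exp (\<mu> * t) * F t) * exp (- \<mu> * t)) (at t)"
      by (simp add: b_def[abs_def])
    have eq: "(exp (\<mu> * t) * F t) * exp (- \<mu> * t) = F t"
    proof -
      have "exp (\<mu> * t) * exp (- \<mu> * t) = 1" by (simp add: exp_add[symmetric])
      moreover have "(exp (\<mu> * t) * F t) * exp (- \<mu> * t) = (exp (\<mu> * t) * exp (- \<mu> * t)) * F t"
        by (simp only: mult_ac)
      ultimately show ?thesis by (simp only: mult_1_left)
    qed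
    show ?thesis using D1 unfolding eq by (rule DERIV_cong) (simp add: b_def)
  qed
  have bd: "\<bar>b t\<bar> \<le> x / (\<mu> + \<gamma>) * exp (\<gamma> * t)" if t: "t \<in> {0..1}" for t
  proof -
    define g where "g t = x / (\<mu> + \<gamma>) * exp ((\<mu> + \<gamma>) * t)" for t
    have Dg: "(g has_real_derivative x * exp ((\<mu> + \<gamma>) * s)) (at s within {0..t})" for s
    proof -
      have "((\<lambda>t. exp ((\<mu> + \<gamma>) * t)) has_real_derivative (\<mu> + \<gamma>) * exp ((\<mu> + \<gamma>) * s)) (at s within {0..t})"
        by (auto intro!: derivative_eq_intros)
      from DERIV_cmult[OF this, of "x / (\<mu> + \<gamma>)"] show ?thesis using \<mu> \<gamma> by (simp add: g_def[abs_def])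
    qed
    have le: "\<bar>exp (\<mu> * s) * F s\<bar> \<le> x * exp ((\<mu> + \<gamma>) * s)" if s: "s \<in> {0..t}" for s
    proof -
      have "\<bar>exp (\<mu> * s) * F s\<bar> = exp (\<mu> * s) * \<bar>F s\<bar>" by (simp add: abs_mult)
      also have "\<dots> \<le> exp (\<mu> * s) * (x * exp (\<gamma> * s))" using s t by (intro mult_left_mono Fb) auto
      also have "\<dots> = x * exp ((\<mu> + \<gamma>) * s)" by (simp add: distrib_right exp_add)
      finally show ?thesis .
    qed
    have "G t - G 0 \<le> g t - g 0"
    proof (rule derivative_le_imp_le[OF _ _ Dg])
      show "(G has_real_derivative exp (\<mu> * s) * F s) (at s within {0..t})" for s
        by (rule has_field_derivative_at_within[OF G(2)])
      show "exp (\<mu> * s) * F s \<le> x * exp ((\<mu> + \<gamma>) * s)" if "s \<in> {0..t}" for s using le[OF that] by simp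
    qed (use t in auto)
    moreover have "(- G t) - (- G 0) \<le> g t - g 0"
    proof (rule derivative_le_imp_le[OF _ _ Dg])
      show "((\<lambda>s. - G s) has_real_derivative - (exp (\<mu> * s) * F s)) (at s within {0..t})" for s
        by (rule DERIV_minus[OF has_field_derivative_at_within[OF G(2)]])
      show "- (exp (\<mu> * s) * F s) \<le> x * exp ((\<mu> + \<gamma>) * s)" if "s \<in> {0..t}" for s
        using le[OF that] by (simp add: abs_le_iff)
    qed (use t in auto)
    moreover have "g 0 \<ge> 0" using x \<mu> \<gamma> by (simp add: g_def)
    ultimately have "\<bar>G t\<bar> \<le> g t" using G(1) by (simp add: abs_le_iff)
    then have "exp (- \<mu> * t) * \<bar>G t\<bar> \<le> exp (- \<mu> * t) * g t" by (rule mult_left_mono) simp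
    moreover have "exp (- \<mu> * t) * g t = x / (\<mu> + \<gamma>) * exp (\<gamma> * t)"
    proof -
      have "exp (- \<mu> * t) * exp ((\<mu> + \<gamma>) * t) = exp (\<gamma> * t)" by (simp add: exp_add[symmetric] algebra_simps)
      then show ?thesis by (simp add: g_def)
    qed
    moreover have "\<bar>b t\<bar> = exp (- \<mu> * t) * \<bar>G t\<bar>" by (simp add: b_def abs_mult)
    ultimately show ?thesis by (simp only:)
  qed
  have "smooth_real b" by (rule smooth_real_linear_ode[OF D F])
  then show ?thesis using D bd G(1) by (intro exI[of _ b]) (auto simp: b_def)
qed


text \<open>The product of \<open>sin A\<close> from a velocity mode and \<open>cos B\<close> from
  the gradient splits into \<open>sin (A + B)\<close> and \<open>sin (A - B)\<close>. Each velocity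
  mode thus contributes two waves, whose amplitudes solve scalar heat equations with a common
  source.\<close>

lemma transport_step_single:
  assumes nu: "\<nu> > 0" and \<gamma>: "\<gamma> > 0" and P: "vwave_bounded M P" and L: "wave_bounded \<gamma> [(c, \<kappa>, \<beta>, x)]"
  shows "\<exists>L'. wave_bounded \<gamma> L' \<and> wave_weight L' \<le> gain M \<nu> \<gamma> P \<kappa> * ((1 + norm \<kappa>)\<^sup>2 * x)
      \<and> (\<forall>X. wave_sum L' 0 X = 0) \<and>
     (\<forall>t X. wave_time L' t X = \<nu> * wave_laplace L' t X - vwave_sum P t X \<bullet> ((c t * cos (\<kappa> \<bullet> X + \<beta>)) *\<^sub>R \<kappa>))"
  using P
proof (induction P)
  case Nil
  show ?case by (rule exI[of _ "[]"]) (simp add: gain_def vwave_sum_def)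
next
  case (Cons p P)
  obtain a \<eta> \<beta>p d where p: "p = (a, \<eta>, \<beta>p, d)" by (metis prod_cases4)
  have a: "smooth_real a" "lattice_vec \<eta>" "\<And>t. t \<in> {0..1} \<Longrightarrow> \<bar>a t\<bar> \<le> M" "0 \<le> M" "vwave_bounded M P"
    using Cons.prems by (auto simp: p vwave_bounded_def)
  have c: "smooth_real c" "lattice_vec \<kappa>" "0 \<le> x" "\<And>t. t \<in> {0..1} \<Longrightarrow> \<bar>c t\<bar> \<le> x * exp (\<gamma> * t)"
    using L by (auto simp: wave_Cons)
  obtain L' where L': "wave_bounded \<gamma> L'" "wave_weight L' \<le> gain M \<nu> \<gamma> P \<kappa> * ((1
      + norm \<kappa>)\<^sup>2 * x)" "\<And>X. wave_sum L' 0 X = 0"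
     "\<And>t X. wave_time L' t X = \<nu> * wave_laplace L' t X - vwave_sum P t X \<bullet> ((c t * cos (\<kappa> \<bullet> X + \<beta>)) *\<^sub>R \<kappa>)"
    using Cons.IH[OF a(5)] by blast
  define y where "y = 1 / 2 * (M * norm d * norm \<kappa>) * x"
  define F where "F = (\<lambda>t. - (1 / 2) * (d \<bullet> \<kappa>) * (a t * c t))"
  have y: "0 \<le> y" using a c by (simp add: y_def)
  have sF: "smooth_real F" unfolding F_def by (intro smooth_real_cmult smooth_real_mult a c)
  have Fb: "\<bar>F t\<bar> \<le> y * exp (\<gamma> * t)" if t: "t \<in> {0..1}" for t
  proof -
    have "\<bar>F t\<bar> = 1 / 2 * \<bar>d \<bullet> \<kappa>\<bar> * (\<bar>a t\<bar> * \<bar>c t\<bar>)" by (simp add: F_def abs_mult)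
    also have "\<dots> \<le> 1 / 2 * (norm d * norm \<kappa>) * (M * (x * exp (\<gamma> * t)))"
      by (intro mult_mono Cauchy_Schwarz_ineq2 a c t) (use a c in auto)
    finally show ?thesis by (simp add: y_def mult_ac)
  qed
  have ex: "\<exists>b. smooth_real b \<and> b 0 = 0 \<and> (\<forall>t. (b has_real_derivative - (\<nu> * (norm \<mu>)\<^sup>2) * b t + F t) (at t)) \<and>
     (\<forall>t\<in>{0..1}. \<bar>b t\<bar> \<le> y / (\<nu> * (norm \<mu>)\<^sup>2 + \<gamma>) * exp (\<gamma> * t))" for \<mu> :: "real^3"
    by (rule heat_amplitude[OF _ \<gamma> sF y Fb]) (use nu in auto)
  obtain b1 where b1: "smooth_real b1" "b1 0 = 0" "\<And>t. (b1 has_real_derivative - (\<nu> * (norm (\<eta>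
      + \<kappa>))\<^sup>2) * b1 t + F t) (at t)"
     "\<And>t. t \<in> {0..1} \<Longrightarrow> \<bar>b1 t\<bar> \<le> y / (\<nu> * (norm (\<eta> + \<kappa>))\<^sup>2 + \<gamma>) * exp (\<gamma> * t)"
    using ex[of "\<eta> + \<kappa>"] by blast
  obtain b2 where b2: "smooth_real b2" "b2 0 = 0" "\<And>t. (b2
      has_real_derivative - (\<nu> * (norm (\<eta> - \<kappa>))\<^sup>2) * b2 t + F t) (at t)"
     "\<And>t. t \<in> {0..1} \<Longrightarrow> \<bar>b2 t\<bar> \<le> y / (\<nu> * (norm (\<eta> - \<kappa>))\<^sup>2 + \<gamma>) * exp (\<gamma> * t)"
    using ex[of "\<eta> - \<kappa>"] by blast
  define x1 where "x1 = y / (\<nu> * (norm (\<eta> + \<kappa>))\<^sup>2 + \<gamma>)"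
  define x2 where "x2 = y / (\<nu> * (norm (\<eta> - \<kappa>))\<^sup>2 + \<gamma>)"
  have pos: "\<nu> * (norm \<mu>)\<^sup>2 + \<gamma> > 0" for \<mu> :: "real^3" using nu \<gamma> by (intro add_nonneg_pos) auto
  have x12: "0 \<le> x1" "0 \<le> x2" unfolding x1_def x2_def using y pos by (auto intro!: divide_nonneg_pos)
  define N where "N = (b1, \<eta> + \<kappa>, \<beta>p + \<beta>, x1) # (b2, \<eta> - \<kappa>, \<beta>p - \<beta>, x2) # L'"
  have db: "deriv b1 t = - (\<nu> * (norm (\<eta> + \<kappa>))\<^sup>2) * b1 t + F t"
    "deriv b2 t = - (\<nu> * (norm (\<eta> - \<kappa>))\<^sup>2) * b2 t + F t" for t
    by (rule DERIV_imp_deriv[OF b1(3)], rule DERIV_imp_deriv[OF b2(3)])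
  have wt: "(1 + norm \<mu>)\<^sup>2 \<le> (1 + norm \<eta>)\<^sup>2 * (1 + norm \<kappa>)\<^sup>2" if "norm \<mu> \<le> norm \<eta> + norm \<kappa>" for \<mu> :: "real^3"
  proof -
    have e: "(1 + norm \<eta>) * (1 + norm \<kappa>) = 1 + norm \<eta> + norm \<kappa> + norm \<eta> * norm \<kappa>" by (simp add: algebra_simps)
    have "0 \<le> norm \<eta> * norm \<kappa>" by simp
    then have "1 + norm \<mu> \<le> (1 + norm \<eta>) * (1 + norm \<kappa>)" unfolding e using that by linarith
    then show ?thesis unfolding power_mult_distrib[symmetric] by (intro power_mono) auto
  qed
  have xb: "(1 + norm \<mu>)\<^sup>2 * (y / D) \<le> M * norm d * norm \<kappa> * (1 + norm \<eta>)\<^sup>2 / D * ((1 + norm \<kappa>)\<^sup>2 * x)"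
    if "norm \<mu> \<le> norm \<eta> + norm \<kappa>" "D > 0" for \<mu> :: "real^3" and D
  proof -
    have "(1 + norm \<mu>)\<^sup>2 * (y / D) \<le> (1 + norm \<eta>)\<^sup>2 * (1 + norm \<kappa>)\<^sup>2 * (2 * y / D)"
      using y that by (intro mult_mono wt divide_right_mono) auto
    then show ?thesis by (simp add: y_def mult_ac)
  qed
  have "wave_bounded \<gamma> N"
    unfolding N_def wave_Cons using L'(1) b1 b2 x12 a c
      by (simp add: x1_def x2_def lattice_vec_add lattice_vec_diff)
  moreover have "wave_weight N \<le> gain M \<nu> \<gamma> (p # P) \<kappa> * ((1 + norm \<kappa>)\<^sup>2 * x)"
    using L'(2) xb[OF norm_triangle_ineq pos[of "\<eta> + \<kappa>"]] xb[OF norm_triangle_ineq4 pos[of "\<eta> - \<kappa>"]]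
    unfolding N_def wave_Cons gain_def p x1_def x2_def by (simp add: distrib_right)
  moreover have "wave_sum N 0 X = 0" for X by (simp add: N_def wave_Cons b1 b2 L'(3))
  moreover have "wave_time N t X = \<nu> * wave_laplace N t X - vwave_sum (p # P) t X \<bullet> ((c t * cos (\<kappa> \<bullet> X
      + \<beta>)) *\<^sub>R \<kappa>)" for t X
  proof -
    define A where "A = \<eta> \<bullet> X + \<beta>p"
    define B where "B = \<kappa> \<bullet> X + \<beta>"
    have s1: "sin ((\<eta> + \<kappa>) \<bullet> X + (\<beta>p + \<beta>)) = sin (A + B)" "sin ((\<eta> - \<kappa>) \<bullet> X + (\<beta>p - \<beta>)) = sin (A - B)"
      by (simp_all add: A_def B_def inner_add_left inner_diff_left algebra_simps)
    have s2: "F t * sin (A + B) + F t * sin (A - B) = - (a t * sin A * (c t * cos B) * (d \<bullet> \<kappa>))"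
    proof -
      have "sin (A + B) + sin (A - B) = 2 * (sin A * cos B)" by (simp add: sin_add sin_diff)
      then show ?thesis unfolding distrib_left[symmetric] by (simp add: F_def)
    qed
    have "wave_time N t X = \<nu> * wave_laplace N t X - vwave_sum P t X \<bullet> ((c t * cos B) *\<^sub>R \<kappa>)
        + (F t * sin (A + B) + F t * sin (A - B))"
      unfolding N_def wave_Cons wave_laplace_Cons db s1 L'(4) B_def[symmetric]
        by (simp add: dot_square_norm algebra_simps)
    moreover have "vwave_sum (p # P) t X = (a t * sin A) *\<^sub>R d + vwave_sum P t X"
      by (simp add: vwave_sum_def p A_def)
    ultimately show ?thesis unfolding s2 B_def[symmetric] by (simp add: inner_add_left algebra_simps)
  qed
  ultimately show ?case by blast
qed

text \<open>One Picard step: a correction driven by the advection of \<open>L\<close>, starting from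
  zero so that the initial datum is untouched. Halving of \<open>wave_weight\<close> is the
  contraction.\<close>

lemma transport_step:
  assumes nu: "\<nu> > 0" and \<gamma>: "\<gamma> > 0" and P: "vwave_bounded M P" and small: "\<And>\<kappa>. gain M \<nu> \<gamma> P \<kappa> \<le> 1 / 2"
    and L: "wave_bounded \<gamma> L"
  shows "\<exists>L'. wave_bounded \<gamma> L' \<and> wave_weight L' \<le> wave_weight L / 2 \<and> (\<forall>X. wave_sum L' 0 X = 0) \<and>
     (\<forall>t X. wave_time L' t X = \<nu> * wave_laplace L' t X - vwave_sum P t X \<bullet> wave_grad L t X)"
  using L
proof (induction L)
  case Nil
  show ?case by (rule exI[of _ "[]"]) simp
next
  case (Cons w L)
  obtain c \<kappa> \<beta> x where w: "w = (c, \<kappa>, \<beta>, x)" by (metis prod_cases4)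
  have g: "wave_bounded \<gamma> [(c, \<kappa>, \<beta>, x)]" "wave_bounded \<gamma> L" "0 \<le> x"
    using Cons.prems by (auto simp: w wave_Cons)
  obtain L1 where L1: "wave_bounded \<gamma> L1" "wave_weight L1 \<le> wave_weight L / 2" "\<And>X. wave_sum L1 0 X = 0"
    "\<And>t X. wave_time L1 t X = \<nu> * wave_laplace L1 t X - vwave_sum P t X \<bullet> wave_grad L t X"
      using Cons.IH[OF g(2)] by blast
  obtain L2 where L2: "wave_bounded \<gamma> L2" "wave_weight L2 \<le> gain M \<nu> \<gamma> P \<kappa> * ((1
      + norm \<kappa>)\<^sup>2 * x)" "\<And>X. wave_sum L2 0 X = 0"
     "\<And>t X. wave_time L2 t X = \<nu> * wave_laplace L2 t X - vwave_sum P t X \<bullet> ((c t * cos (\<kappa> \<bullet> X + \<beta>)) *\<^sub>R \<kappa>)"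
    using transport_step_single[OF nu \<gamma> P g(1)] by blast
  have "gain M \<nu> \<gamma> P \<kappa> * ((1 + norm \<kappa>)\<^sup>2 * x) \<le> 1 / 2 * ((1 + norm \<kappa>)\<^sup>2 * x)"
    using small g(3) by (intro mult_right_mono) auto
  then have "wave_weight L2 \<le> ((1 + norm \<kappa>)\<^sup>2 * x) / 2" using L2(2) by simp
  then have "wave_weight (L2 @ L1) \<le> wave_weight (w # L) / 2" using L1(2) by (simp add: w wave_append wave_Cons)
  moreover have "wave_time (L2 @ L1) t X = \<nu> * wave_laplace (L2 @ L1) t X - vwave_sum P t X \<bullet> wave_grad
      (w # L) t X" for t X
    unfolding w wave_append wave_Cons inner_add_right L1(4) L2(4) distrib_left by simp
  ultimately show ?case
    using L1(1,3) L2(1,3) by (intro exI[of _ "L2 @ L1"]) (simp add: wave_append)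
qed

text \<open>\<open>S\<close> is a partial sum of the corrections and \<open>D\<close> its last term.
  The sum misses the equation exactly by the advection of \<open>D\<close>, which has not yet been
  fed back.\<close>

lemma picard_iterates:
  assumes nu: "\<nu> > 0" and \<gamma>: "\<gamma> > 0" and P: "vwave_bounded M P" and small: "\<And>\<kappa>. gain M \<nu> \<gamma> P \<kappa> \<le> 1 / 2"
    and L0: "wave_bounded \<gamma> L0" "\<And>t X. wave_time L0 t X = \<nu> * wave_laplace L0 t X"
  shows "\<exists>S D. wave_bounded \<gamma> S \<and> wave_bounded \<gamma> D \<and> wave_weight S \<le> 2 * wave_weight L0 * (1 - 1 / 2 ^ (n
      + 1)) \<and> wave_weight D \<le> wave_weight L0 / 2 ^ n \<and>
     (\<forall>X. wave_sum S 0 X = wave_sum L0 0 X) \<and> (\<forall>t X. wave_time S t X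
         = \<nu> * wave_laplace S t X - vwave_sum P t X \<bullet> wave_grad S t X + vwave_sum P t X \<bullet> wave_grad D t X)"
proof (induction n)
  case 0
  show ?case using L0 by (intro exI[of _ L0]) simp
next
  case (Suc n)
  then obtain S D where SD: "wave_bounded \<gamma> S" "wave_bounded \<gamma> D" "wave_weight S
      \<le> 2 * wave_weight L0 * (1 - 1 / 2 ^ (n + 1))" "wave_weight D \<le> wave_weight L0 / 2 ^ n"
     "\<And>X. wave_sum S 0 X = wave_sum L0 0 X" "\<And>t X. wave_time S t X
         = \<nu> * wave_laplace S t X - vwave_sum P t X \<bullet> wave_grad S t X + vwave_sum P t X \<bullet> wave_grad D t X"
    by blast
  obtain D' where D': "wave_bounded \<gamma> D'" "wave_weight D' \<le> wave_weight D / 2" "\<And>X. wave_sum D' 0 X = 0"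
     "\<And>t X. wave_time D' t X = \<nu> * wave_laplace D' t X - vwave_sum P t X \<bullet> wave_grad D t X"
    using transport_step[OF nu \<gamma> P small SD(2)] by blast
  have 1: "wave_weight D' \<le> wave_weight L0 / 2 ^ Suc n"
    using order_trans[OF D'(2) divide_right_mono[OF SD(4), of 2]] by (simp add: mult.commute)
  have "wave_weight (S @ D') \<le> 2 * wave_weight L0 * (1 - 1 / 2 ^ (n + 1)) + wave_weight L0 / 2 ^ Suc n"
    using SD(3) 1 by (simp add: wave_append)
  also have "\<dots> = 2 * wave_weight L0 * (1 - 1 / 2 ^ (Suc n + 1))" by (simp add: field_simps)
  finally have 2: "wave_weight (S @ D') \<le> 2 * wave_weight L0 * (1 - 1 / 2 ^ (Suc n + 1))" .
  have 3: "wave_time (S @ D') t X = \<nu> * wave_laplace (S @ D') t X - vwave_sum P t X \<bullet> wave_grad (S @ D')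
      t X + vwave_sum P t X \<bullet> wave_grad D' t X" for t X
    unfolding wave_append inner_add_right SD(6) D'(4) distrib_left by simp
  have "wave_bounded \<gamma> (S @ D')" "wave_sum (S @ D') 0 X = wave_sum L0 0 X" for X
    using SD D' by (simp_all add: wave_append)
  then show ?case using 1 2 3 D'(1) by blast
qed

definition heat_defect :: "real \<Rightarrow> wave list \<Rightarrow> wave list" where
  "heat_defect \<nu> L = map (\<lambda>(c, \<kappa>, \<beta>, x). (\<lambda>t. - (\<nu> * (\<kappa> \<bullet> \<kappa>)) * c t + - 1 * deriv c t, \<kappa>, \<beta>, x)) L"

lemma wave_sum_heat_defect: "wave_sum (heat_defect \<nu> L) t X = \<nu> * wave_laplace L t X - wave_time L t X"
proof (induction L)
  case (Cons w L)
  obtain c \<kappa> \<beta> x where w: "w = (c, \<kappa>, \<beta>, x)" by (metis prod_cases4)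
  have "heat_defect \<nu> (w # L) = (\<lambda>t. - (\<nu> * (\<kappa> \<bullet> \<kappa>)) * c t + - 1 * deriv c t, \<kappa>, \<beta>, x) # heat_defect \<nu> L"
    by (simp add: heat_defect_def w)
  then show ?case unfolding w using Cons by (simp add: wave_Cons wave_laplace_Cons algebra_simps)
qed (simp add: heat_defect_def)

lemma wave_smooth_heat_defect:
  assumes "wave_smooth L" shows "wave_smooth (heat_defect \<nu> L)"
  unfolding wave_smooth_def
proof
  fix w assume "w \<in> set (heat_defect \<nu> L)"
  then obtain c \<kappa> \<beta> x where w: "(c, \<kappa>, \<beta>, x) \<in> set L"
    "w = (\<lambda>t. - (\<nu> * (\<kappa> \<bullet> \<kappa>)) * c t + - 1 * deriv c t, \<kappa>, \<beta>, x)"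
    by (auto simp: heat_defect_def)
  then have c: "smooth_real c" "lattice_vec \<kappa>" using assms by (auto simp: wave_smooth_def)
  have "smooth_real (\<lambda>t. - (\<nu> * (\<kappa> \<bullet> \<kappa>)) * c t + - 1 * deriv c t)"
    by (rule smooth_real_add[OF smooth_real_cmult[OF c(1)] smooth_real_cmult[OF smooth_real_deriv(2)[OF c(1)]]])
  then show "case w of (c, \<kappa>, \<beta>, x) \<Rightarrow> smooth_real c \<and> lattice_vec \<kappa>" using c by (simp add: w)
qed

text \<open>The residual is made small even against \<open>1 + \<bar>wave_sum L t X\<bar>\<close>,
  because the energy estimate multiplies it by the difference of \<open>wave_sum L\<close> and a
  function bounded by 1. This takes the place of a maximum principle.\<close>

lemma approximate_scalar:
  assumes nu: "\<nu> > 0" and P: "vwave_bounded M P" and eps: "\<epsilon> > 0"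
    and V: "\<And>t X. t \<in> {0..1} \<Longrightarrow> norm (vwave_sum P t X) \<le> C"
      "\<And>t X Y. t \<in> {0..1} \<Longrightarrow> norm (vwave_sum P t X - vwave_sum P t Y) \<le> C * dist X Y"
  shows "\<exists>L R. wave_smooth L \<and> smooth_torus_time R \<and> (\<forall>X. wave_sum L 0 X = sin (2 * pi * X $ 1))
      \<and> (\<exists>\<gamma>. wave_bounded \<gamma> L) \<and>
     (\<forall>t X. wave_time L t X = \<nu> * wave_laplace L t X - vwave_sum P t X \<bullet> wave_grad L t X + R t X) \<and>
     (\<forall>t\<in>{0..1}. \<forall>X. \<bar>R t X\<bar> * (1 + \<bar>wave_sum L t X\<bar>) \<le> \<epsilon>) \<and>
     (\<forall>t\<in>{0..1}. \<forall>X Y. \<bar>R t X - R t Y\<bar> \<le> \<epsilon> * dist X Y)"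
proof -
  obtain \<gamma> where \<gamma>: "\<gamma> > 0" and small: "\<And>\<kappa>. gain M \<nu> \<gamma> P \<kappa> \<le> 1 / 2"
    using gain_small[OF nu, of "1 / 2" M P] by auto
  define \<kappa> where "\<kappa> = (2 * pi) *\<^sub>R ee 1"
  \<comment> \<open>The iteration starts from the heat evolution of the initial sine.\<close>
  define L0 :: "wave list" where "L0 = [(\<lambda>t. exp (- (\<nu> * (\<kappa> \<bullet> \<kappa>)) * t), \<kappa>, 0, 1)]"
  have lat: "lattice_vec \<kappa>" unfolding lattice_vec_def
  proof (intro conjI allI)
    show "\<kappa> $ 3 = 0" by (simp add: \<kappa>_def axis_def)
    fix i show "\<exists>n::int. \<kappa> $ i = 2 * pi * of_int n"
      by (rule exI[of _ "if i = 1 then 1 else 0"]) (simp add: \<kappa>_def axis_def)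
  qed
  have kk: "\<kappa> \<bullet> \<kappa> \<ge> 0" by simp
  have g0: "wave_bounded \<gamma> L0"
    using lat smooth_real_exp[of "- (\<nu> * (\<kappa> \<bullet> \<kappa>))"] nu \<gamma> kk unfolding L0_def wave_Cons
    by (auto intro!: order_trans[OF _ mult_nonneg_nonneg])
  have "deriv (\<lambda>t. exp (- (\<nu> * (\<kappa> \<bullet> \<kappa>)) * t)) t = - (\<nu> * (\<kappa> \<bullet> \<kappa>)) * exp (- (\<nu> * (\<kappa> \<bullet> \<kappa>)) * t)" for t
    by (rule DERIV_imp_deriv) (auto intro!: derivative_eq_intros)
  then have h0: "wave_time L0 t X = \<nu> * wave_laplace L0 t X" for t X
    by (simp add: L0_def wave_Cons wave_laplace_Cons)
  have i0: "wave_sum L0 0 X = sin (2 * pi * X $ 1)" for X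
    by (simp add: L0_def wave_Cons \<kappa>_def inner_axis')
  define N where "N = wave_weight L0"
  have N: "N \<ge> 0" unfolding N_def by (rule wave_weight_nonneg[OF g0])
  have C: "C \<ge> 0" using order_trans[OF norm_ge_zero V(1)[of 0 0]] by simp
  \<comment> \<open>One constant for both residual estimates: \<open>C\<close> bounds the velocity
    and its Lipschitz constant, \<open>2 * N * exp \<gamma>\<close> bounds \<open>S\<close>, and
    \<open>N / 2 ^ n\<close> the weight of \<open>D\<close>.\<close>
  define B where "B = (2 * C + 1) * exp \<gamma> * (1 + 2 * N * exp \<gamma>) * (N + 1)"
  have "((\<lambda>n. B / 2 ^ n) \<longlongrightarrow> 0) sequentially"
    by (rule LIMSEQ_divide_realpow_zero) simp
  then have "\<forall>\<^sub>F n in sequentially. B / 2 ^ n < \<epsilon>" using eps by (rule order_tendstoD)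
  then obtain n where n: "B / 2 ^ n < \<epsilon>" using eventually_happens'[OF sequentially_bot] by blast
  obtain S D where SD: "wave_bounded \<gamma> S" "wave_bounded \<gamma> D" "wave_weight S \<le> 2 * N * (1 - 1 / 2 ^ (n
      + 1))" "wave_weight D \<le> N / 2 ^ n"
     "\<And>X. wave_sum S 0 X = wave_sum L0 0 X" "\<And>t X. wave_time S t X
         = \<nu> * wave_laplace S t X - vwave_sum P t X \<bullet> wave_grad S t X + vwave_sum P t X \<bullet> wave_grad D t X"
    using picard_iterates[OF nu \<gamma> P small g0 h0, of n] unfolding N_def by blast
  \<comment> \<open>The next Picard term exhibits the residual, a product of velocity and gradient,
    as a heat operator applied to a wave sum. It is therefore itself a wave sum, and smooth.\<close>
  obtain E where E: "wave_bounded \<gamma> E" "\<And>t X. wave_time E t X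
      = \<nu> * wave_laplace E t X - vwave_sum P t X \<bullet> wave_grad D t X"
    using transport_step[OF nu \<gamma> P small SD(2)] by blast
  define R where "R t X = vwave_sum P t X \<bullet> wave_grad D t X" for t X
  have RE: "R t X = \<nu> * wave_laplace E t X - wave_time E t X" for t X using E(2)[of t X] by (simp add: R_def)
  have "R = wave_sum (heat_defect \<nu> E)" by (intro ext) (simp only: RE wave_sum_heat_defect)
  then have sR: "smooth_torus_time R"
    using wave_sum_smooth[OF wave_smooth_heat_defect[OF wave_bounded_imp_smooth[OF E(1)]]] by simp
  have SN: "wave_weight S \<le> 2 * N"
  proof -
    have "2 * N * (1 - 1 / 2 ^ (n + 1)) \<le> 2 * N * 1" using N by (intro mult_left_mono) auto
    then show ?thesis using SD(3) by simp
  qed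
  have D0: "0 \<le> wave_weight D" by (rule wave_weight_nonneg[OF SD(2)])
  have key: "C' * (wave_weight D * exp \<gamma>) * (1 + 2 * N * exp \<gamma>) \<le> \<epsilon>" if "0 \<le> C'" "C' \<le> 2 * C + 1" for C'
  proof -
    have "C' * (wave_weight D * exp \<gamma>) * (1 + 2 * N * exp \<gamma>) \<le> (2 * C + 1) * ((N
        + 1) / 2 ^ n * exp \<gamma>) * (1 + 2 * N * exp \<gamma>)"
    proof (intro mult_right_mono mult_mono that order_refl)
      have "N / 2 ^ n \<le> (N + 1) / 2 ^ n" by (intro divide_right_mono) auto
      then show "wave_weight D \<le> (N + 1) / 2 ^ n" using SD(4) by linarith
    qed (use C N D0 in auto)
    also have "\<dots> = B / 2 ^ n" by (simp add: B_def)
    finally show ?thesis using n by linarith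
  qed
  have b1: "\<bar>R t X\<bar> * (1 + \<bar>wave_sum S t X\<bar>) \<le> \<epsilon>" if t: "t \<in> {0..1}" for t X
  proof -
    have "\<bar>R t X\<bar> \<le> norm (vwave_sum P t X) * norm (wave_grad D t X)"
      unfolding R_def by (rule Cauchy_Schwarz_ineq2)
    also have "\<dots> \<le> C * (wave_weight D * exp \<gamma>)"
      using V(1)[OF t] wave_bounds(2)[OF SD(2) t] \<gamma> C by (intro mult_mono) auto
    finally have r: "\<bar>R t X\<bar> \<le> C * (wave_weight D * exp \<gamma>)" .
    have "\<bar>wave_sum S t X\<bar> \<le> wave_weight S * exp \<gamma>" using wave_bounds(1)[OF SD(1) t] \<gamma> by simp
    also have "\<dots> \<le> 2 * N * exp \<gamma>" using SN by (intro mult_right_mono) auto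
    finally have "\<bar>R t X\<bar> * (1 + \<bar>wave_sum S t X\<bar>) \<le> C * (wave_weight D * exp \<gamma>) * (1 + 2 * N * exp \<gamma>)"
      using r C D0 by (intro mult_mono) auto
    then show ?thesis using key[of C] C by linarith
  qed
  have b2: "\<bar>R t X - R t Y\<bar> \<le> \<epsilon> * dist X Y" if t: "t \<in> {0..1}" for t X Y
  proof -
    have "R t X - R t Y = (vwave_sum P t X - vwave_sum P t Y) \<bullet> wave_grad D t X
        + vwave_sum P t Y \<bullet> (wave_grad D t X - wave_grad D t Y)"
      by (simp add: R_def inner_diff_left inner_diff_right)
    also have "\<bar>\<dots>\<bar> \<le> norm (vwave_sum P t X - vwave_sum P t Y) * norm (wave_grad D t X)
        + norm (vwave_sum P t Y) * norm (wave_grad D t X - wave_grad D t Y)"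
      by (rule order_trans[OF abs_triangle_ineq add_mono[OF Cauchy_Schwarz_ineq2 Cauchy_Schwarz_ineq2]])
    also have "\<dots> \<le> (C * dist X Y) * (wave_weight D * exp \<gamma>) + C * (wave_weight D * exp \<gamma> * dist X Y)"
      using V(1)[OF t] V(2)[OF t] wave_bounds(2,3)[OF SD(2) t] \<gamma> C D0 by (intro add_mono mult_mono) auto
    also have "\<dots> = (2 * C * (wave_weight D * exp \<gamma>) * 1) * dist X Y" by (simp add: algebra_simps)
    also have "\<dots> \<le> (2 * C * (wave_weight D * exp \<gamma>) * (1 + 2 * N * exp \<gamma>)) * dist X Y"
      using C D0 N by (intro mult_right_mono mult_left_mono) auto
    also have "\<dots> \<le> \<epsilon> * dist X Y" using key[of "2 * C"] C by (intro mult_right_mono) auto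
    finally show ?thesis .
  qed
  show ?thesis
  proof (rule exI[of _ S], rule exI[of _ R], intro conjI allI ballI)
    show "wave_sum S 0 X = sin (2 * pi * X $ 1)" for X by (simp only: SD(5) i0)
    show "wave_time S t X = \<nu> * wave_laplace S t X - vwave_sum P t X \<bullet> wave_grad S t X + R t X" for t X
      by (simp only: SD(6) R_def)
    show "\<exists>\<gamma>. wave_bounded \<gamma> S" using SD(1) by blast
  qed (use wave_bounded_imp_smooth[OF SD(1)] sR b1 b2 in auto)
qed

section \<open>Dissipation of the scalar\<close>

text \<open>Minkowski's integral inequality in \<open>L^1\<close>, by Fubini.\<close>

lemma torus_int_abs_integral_le:
  fixes F :: "real \<Rightarrow> real^3 \<Rightarrow> real"
  assumes c: "continuous_on ({0..1} \<times> UNIV) (\<lambda>(h, X). F h X)"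
    and B: "\<And>h. h \<in> {0..1} \<Longrightarrow> torus_int (\<lambda>X. \<bar>F h X\<bar>) \<le> B"
  shows "torus_int (\<lambda>X. \<bar>integral {0..1} (\<lambda>h. F h X)\<bar>) \<le> B"
proof -
  have ca: "continuous_on ({0..1} \<times> UNIV) (\<lambda>(h, X). \<bar>F h X\<bar>)"
    using c by (auto simp: split_def intro: continuous_intros)
  have ch: "continuous_on {0..1} (\<lambda>h. F h X)" for X
    using continuous_on_compose2[OF c, of "{0..1}" "\<lambda>h. (h, X)"]
      by (simp add: continuous_on_Pair image_subset_iff)
  have int: "continuous_on UNIV (\<lambda>X. integral {0..1} (\<lambda>h. G h X))"
    if "continuous_on ({0..1} \<times> UNIV) (\<lambda>(h, X). G h X)" for G :: "real \<Rightarrow> real^3 \<Rightarrow> real"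
  proof -
    have "continuous_on (UNIV \<times> cbox 0 1) (\<lambda>z. (\<lambda>(h, X). G h X) (snd z, fst z))"
      by (rule continuous_on_compose2[OF that]) (auto intro!: continuous_intros)
    then have "continuous_on (UNIV \<times> cbox 0 1) (\<lambda>(X, h). G h X)" by (simp add: split_def)
    from integral_continuous_on_param[OF this] show ?thesis by simp
  qed
  have "torus_int (\<lambda>X. \<bar>integral {0..1} (\<lambda>h. F h X)\<bar>) \<le> torus_int (\<lambda>X. integral {0..1} (\<lambda>h. \<bar>F h X\<bar>))"
  proof (rule torus_int_mono)
    show "\<bar>integral {0..1} (\<lambda>h. F h X)\<bar> \<le> integral {0..1} (\<lambda>h. \<bar>F h X\<bar>)" for X
      using integral_norm_bound_integral[OF integrable_continuous_real[OF ch[of X]]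
          integrable_continuous_real[OF continuous_on_rabs[OF ch[of X]]]] by simp
  qed (intro continuous_intros int c ca)+
  also have "\<dots> = integral {0..1} (\<lambda>h. torus_int (\<lambda>X. \<bar>F h X\<bar>))" by (rule torus_int_swap[OF ca, symmetric])
  also have "\<dots> \<le> integral {0..1} (\<lambda>h::real. B)"
    by (intro integral_le integrable_continuous_real torus_int_continuous_param ca B) auto
  finally show ?thesis by simp
qed

lemma torus_int_abs_shift: "continuous_on UNIV f \<Longrightarrow> periodic f \<Longrightarrow> torus_int (\<lambda>X. \<bar>f (X + a *\<^sub>R ee i)\<bar>)
    = torus_int (\<lambda>X. \<bar>f X\<bar>)"
  using torus_int_shift[of "\<lambda>X. \<bar>f X\<bar>" a i] by (auto simp: periodic_def intro: continuous_intros)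

lemma continuous_shift_param:
  assumes "continuous_on UNIV f"
  shows "continuous_on ({0..1} \<times> UNIV) (\<lambda>(h::real, X). f (X + (r * h) *\<^sub>R ee i))"
  unfolding split_def by (rule continuous_on_compose2[OF assms]) (auto intro!: continuous_intros)

lemma torus_int_abs_line_average_le:
  assumes "continuous_on UNIV f" "periodic f"
  shows "torus_int (\<lambda>X. \<bar>line_average r i f X\<bar>) \<le> torus_int (\<lambda>X. \<bar>f X\<bar>)"
  unfolding line_average_def
  by (rule torus_int_abs_integral_le[OF continuous_shift_param[OF assms(1)]]) (simp add:
      torus_int_abs_shift[OF assms])

lemma torus_int_increment_le:
  assumes c: "continuous_on UNIV f'" and p: "periodic f'" and a: "0 \<le> a"
    and D: "\<And>X. ((\<lambda>h. f (X + h *\<^sub>R ee i)) has_real_derivative f' X) (at 0)"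
  shows "torus_int (\<lambda>X. \<bar>f (X + a *\<^sub>R ee i) - f X\<bar>) \<le> a * torus_int (\<lambda>X. \<bar>f' X\<bar>)"
proof -
  have "f (X + a *\<^sub>R ee i) - f X = integral {0..1} (\<lambda>s. a * f' (X + (a * s) *\<^sub>R ee i))" for X
  proof -
    have "((\<lambda>s. f (X + (a * s) *\<^sub>R ee i)) has_real_derivative a * f' (X + (a * s) *\<^sub>R ee i)) (at s)" for s
    proof -
      have "((\<lambda>h. f ((X + (a * s) *\<^sub>R ee i) + h *\<^sub>R ee i)) has_real_derivative f' (X
          + (a * s) *\<^sub>R ee i)) (at (a * s - a * s))"
        using D by simp
      moreover have "((\<lambda>u. a * u - a * s) has_real_derivative a) (at s)" by (auto intro!: derivative_eq_intros)
      ultimately have "((\<lambda>u. f ((X + (a * s) *\<^sub>R ee i) + (a * u - a * s) *\<^sub>R ee i))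
          has_real_derivative f' (X + (a * s) *\<^sub>R ee i) * a) (at s)"
        by (rule DERIV_chain2)
      then show ?thesis by (simp add: algebra_simps)
    qed
    then have "((\<lambda>s. a * f' (X + (a * s) *\<^sub>R ee i)) has_integral f (X + (a * 1) *\<^sub>R ee i) - f (X
        + (a * 0) *\<^sub>R ee i)) {0..1}"
      by (intro fundamental_theorem_of_calculus)
        (auto simp: has_real_derivative_iff_has_vector_derivative[symmetric] intro:
            has_field_derivative_at_within)
    from integral_unique[OF this] show ?thesis by simp
  qed
  then have "torus_int (\<lambda>X. \<bar>f (X + a *\<^sub>R ee i) - f X\<bar>) = torus_int (\<lambda>X. \<bar>integral {0..1} (\<lambda>s. a * f' (X
      + (a * s) *\<^sub>R ee i))\<bar>)"
    by simp
  also have "\<dots> \<le> a * torus_int (\<lambda>X. \<bar>f' X\<bar>)"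
  proof (rule torus_int_abs_integral_le)
    show "continuous_on ({0..1} \<times> UNIV) (\<lambda>(s, X). a * f' (X + (a * s) *\<^sub>R ee i))"
      using continuous_on_mult_left[OF continuous_shift_param[OF c, of a i], of a] by (simp add: split_def)
    show "torus_int (\<lambda>X. \<bar>a * f' (X + (a * h) *\<^sub>R ee i)\<bar>) \<le> a * torus_int (\<lambda>X. \<bar>f' X\<bar>)" for h
      using a by (simp add: abs_mult torus_int_cmult torus_int_abs_shift[OF c p])
  qed
  finally show ?thesis .
qed

text \<open>Used backwards, as a Poincare inequality: a function at distance of order one from its
  averages over segments of length \<open>r\<close> has a derivative of order \<open>1 / r\<close>
  in \<open>L^1\<close>.\<close>

lemma torus_int_diff_line_average_le:
  assumes cf: "continuous_on UNIV f" and c: "continuous_on UNIV f'" and p: "periodic f'" and r: "0 \<le> r"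
    and D: "\<And>X. ((\<lambda>h. f (X + h *\<^sub>R ee i)) has_real_derivative f' X) (at 0)"
  shows "torus_int (\<lambda>X. \<bar>line_average r i f X - f X\<bar>) \<le> r * torus_int (\<lambda>X. \<bar>f' X\<bar>)"
proof -
  have ch: "continuous_on {0..1} (\<lambda>h. f (X + (r * h) *\<^sub>R ee i))" for X
    by (rule continuous_on_compose2[OF cf]) (auto intro!: continuous_intros)
  have "line_average r i f X - f X = integral {0..1} (\<lambda>h. f (X + (r * h) *\<^sub>R ee i) - f X)" for X
    unfolding line_average_def by (subst Henstock_Kurzweil_Integration.integral_diff) (auto intro:
        integrable_continuous_real ch)
  then have "torus_int (\<lambda>X. \<bar>line_average r i f X - f X\<bar>) = torus_int (\<lambda>X. \<bar>integral {0..1} (\<lambda>h. f (X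
      + (r * h) *\<^sub>R ee i) - f X)\<bar>)" by simp
  also have "\<dots> \<le> r * torus_int (\<lambda>X. \<bar>f' X\<bar>)"
  proof (rule torus_int_abs_integral_le)
    show "continuous_on ({0..1} \<times> UNIV) (\<lambda>(h, X). f (X + (r * h) *\<^sub>R ee i) - f X)"
      unfolding split_def by (intro continuous_on_diff continuous_on_compose2[OF cf]) (auto intro!:
          continuous_intros)
    fix h :: real assume h: "h \<in> {0..1}"
    have n: "0 \<le> torus_int (\<lambda>X. \<bar>f' X\<bar>)" by (intro torus_int_nonneg continuous_intros c) auto
    have "torus_int (\<lambda>X. \<bar>f (X + (r * h) *\<^sub>R ee i) - f X\<bar>) \<le> (r * h) * torus_int (\<lambda>X. \<bar>f' X\<bar>)"
      using h r by (intro torus_int_increment_le[OF c p _ D]) auto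
    also have "\<dots> \<le> r * torus_int (\<lambda>X. \<bar>f' X\<bar>)" using h r n by (intro mult_right_mono mult_left_le) auto
    finally show "torus_int (\<lambda>X. \<bar>f (X + (r * h) *\<^sub>R ee i) - f X\<bar>) \<le> r * torus_int (\<lambda>X. \<bar>f' X\<bar>)" .
  qed
  finally show ?thesis .
qed

text \<open>A shear moves along an axis by an amount that does not depend on the coordinate of that
  axis. This is stronger than zero divergence: \<open>vel $ i\<close> acts as a constant under the
  derivative along \<open>ee i\<close>.\<close>

lemma vel_component_invariant: "vel Q t (X + h *\<^sub>R ee i) $ i = vel Q t X $ i"
proof -
  have "(ramp_d1 q t * disp q ((X + h *\<^sub>R ee i) $ stage_axis (Suc q))) * ee (stage_axis q) $ i
      = (ramp_d1 q t * disp q (X $ stage_axis (Suc q))) * ee (stage_axis q) $ i" for q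
    using stage_axis_Suc_neq[of q] by (cases "i = stage_axis q") (auto simp: ee_nth)
  then show ?thesis by (simp only: vel_def sum_component vector_scaleR_component real_scaleR_def)
qed

lemma vel_periodic: "periodic (vel Q t)"
  by (auto simp: periodic_def vel_def ee_nth disp_periodic intro!: sum.cong)

lemma continuous_vel: "continuous_on UNIV (\<lambda>z. vel Q (fst z) (snd z))"
  unfolding vel_def
  by (intro continuous_intros continuous_on_compose2[OF continuous_ramp_d1[of UNIV]]
    continuous_on_compose2[OF continuous_disp[of UNIV]]) auto

lemma continuous_slice: "continuous_on UNIV (\<lambda>z. f (fst z) (snd z)) \<Longrightarrow> continuous_on UNIV (f t)"
  for f :: "real \<Rightarrow> real^3 \<Rightarrow> 'b::topological_space"
  using continuous_on_compose2[of UNIV "\<lambda>z. f (fst z) (snd z)" UNIV "\<lambda>X. (t, X)"]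
    by (simp add: continuous_on_Pair)

lemma continuous_on_spacetime: "continuous_on UNIV (\<lambda>z. f (fst z) (snd z))
    \<Longrightarrow> continuous_on spacetime (\<lambda>(t, X). f t X)"
  for f :: "real \<Rightarrow> real^3 \<Rightarrow> 'b::topological_space"
  by (auto simp: split_def intro: continuous_on_subset)

lemma norm_Psi_grad_le: "norm (Psi_grad Q t X) \<le> 32 * grad_scale Q"
proof -
  have "norm (Psi_grad Q t X) \<le> (\<Sum>i\<in>UNIV. \<bar>Psi_grad Q t X $ i\<bar>)" by (rule norm_le_l1_cart)
  also have "\<dots> = \<bar>Psi_grad Q t X $ stage_axis Q\<bar> + \<bar>Psi_grad Q t X $ stage_axis (Suc Q)\<bar>"
    using Psi_grad_bounds(3)[of Q t X] by (cases "even Q") (auto simp: sum_3 stage_axis_def)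
  also have "\<dots> \<le> 4 * pi * grad_scale Q + 4 * pi * grad_scale Q"
  proof (rule add_mono)
    have c: "2 * pi * (2 - c) * l = 4 * pi * l - 2 * pi * c * l" for c l :: real
      by (simp add: algebra_simps)
    have "0 \<le> 2 * pi * (1 / (real Q + 1)) * grad_scale Q" using grad_scale_ge_1[of Q] by simp
    then show "\<bar>Psi_grad Q t X $ stage_axis Q\<bar> \<le> 4 * pi * grad_scale Q"
      using Psi_grad_bounds(1)[of Q t X] unfolding c by linarith
  qed (rule Psi_grad_bounds(2))
  also have "\<dots> = 8 * pi * grad_scale Q" by simp
  also have "\<dots> \<le> 32 * grad_scale Q" using pi_less_4 grad_scale_ge_1[of Q] by (intro mult_right_mono) auto
  finally show ?thesis .
qed

text \<open>The contradiction is between \<open>1 / 10 ^ 8\<close> and \<open>1 / 32\<close>: a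
  dissipation below the first keeps the scalar close to \<open>Psi\<close>, and closeness enforces a
  dissipation rate of at least \<open>1 / 16\<close> during half of the time.\<close>

lemma scalar_dissipation:
  assumes L: "wave_bounded \<gamma> L" and init: "\<And>X. wave_sum L 0 X = sin (2 * pi * X $ 1)"
    and nu: "\<nu> = 1 / (grad_scale Q)\<^sup>2"
    and eqn: "\<And>t X. wave_time L t X = \<nu> * wave_laplace L t X - vel Q t X \<bullet> wave_grad L t X + R t X"
    and R: "\<And>t X. t \<in> {0..1} \<Longrightarrow> \<bar>R t X\<bar> * (1 + \<bar>wave_sum L t X\<bar>) \<le> 1 / 1000"
  shows "1 / 10 ^ 8 \<le> integral {0..1} (\<lambda>t. \<nu> * torus_int (\<lambda>X. (norm (wave_grad L t X))\<^sup>2))"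
proof (rule ccontr)
  assume contra: "\<not> ?thesis"
  define D where "D t = \<nu> * torus_int (\<lambda>X. (norm (wave_grad L t X))\<^sup>2)" for t
  define w where "w t X = wave_sum L t X - Psi Q t X" for t X
  define wg where "wg t X = wave_grad L t X - Psi_grad Q t X" for t X
  define wt where "wt t X = wave_time L t X - Psi_time Q t X" for t X
  have grad_scale: "grad_scale Q \<ge> 1" by (rule grad_scale_ge_1)
  have nu0: "\<nu> > 0" using grad_scale by (simp add: nu)
  note cF = continuous_wave_sum[OF L] and cG = continuous_wave_grad[OF L]
    and cT = continuous_wave_time[OF L] and cii = continuous_wave_second[OF L]
  have cw: "continuous_on UNIV (\<lambda>z. w (fst z) (snd z))"
    unfolding w_def by (intro continuous_intros cF continuous_Psi)
  have cwt: "continuous_on UNIV (\<lambda>z. wt (fst z) (snd z))"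
    unfolding wt_def by (intro continuous_intros cT continuous_Psi_time)
  have cwg: "continuous_on UNIV (\<lambda>z. wg (fst z) (snd z))"
    unfolding wg_def by (intro continuous_intros cG continuous_Psi_grad)
  note s1 = continuous_slice[OF cw] continuous_slice[OF cwg] continuous_slice[OF cF] continuous_slice[OF
      cG] continuous_slice[OF cii] continuous_slice[OF continuous_vel] continuous_slice[OF continuous_Psi]
    continuous_slice[OF continuous_Psi_grad] continuous_slice[OF cwt]
  have perF: "periodic (wave_sum L t)" for t
  proof -
    have "wave_sum L t (x + ee i) = wave_sum L t x" for x i
      using L by (induction L) (auto simp: wave_Cons lattice_vec_sin_periodic)
    then show ?thesis by (simp add: periodic_def)
  qed
  have perG: "periodic (wave_grad L t)" for t
    unfolding periodic_def
  proof (intro allI)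
    fix x k
    have "(\<lambda>h. wave_sum L t (x + ee k + h *\<^sub>R ee i)) = (\<lambda>h. wave_sum L t (x + h *\<^sub>R ee i))" for i
    proof
      fix h
      have "x + ee k + h *\<^sub>R ee i = (x + h *\<^sub>R ee i) + ee k" by simp
      then show "wave_sum L t (x + ee k + h *\<^sub>R ee i) = wave_sum L t (x + h *\<^sub>R ee i)"
        using perF unfolding periodic_def by metis
    qed
    then have "wave_grad L t (x + ee k) $ i = wave_grad L t x $ i" for i
      using wave_sum_line_derivative[of L t "x
          + ee k" i] wave_sum_line_derivative[of L t x i] DERIV_unique by metis
    then show "wave_grad L t (x + ee k) = wave_grad L t x" by (simp add: vec_eq_iff)
  qed
  have perw: "periodic (w t)" for t
    using perF[of t] Psi_periodic[of Q t] by (simp add: periodic_def w_def)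
  have lw: "((\<lambda>h. w t (X + h *\<^sub>R ee i)) has_real_derivative wg t X $ i) (at 0)" for t X i
    unfolding w_def wg_def using DERIV_diff[OF wave_sum_line_derivative[of L t X i]
        Psi_line_derivative[of Q t X i 0]] by simp
  define E where "E t = torus_int (\<lambda>X. (w t X)\<^sup>2)" for t
  have DE: "(E has_real_derivative torus_int (\<lambda>X. 2 * w t X * wt t X)) (at t within {0..1})"
    if t: "t \<in> {0..1}" for t
    unfolding E_def
  proof (rule torus_int_has_derivative[OF _ _ _ t])
    fix t X
    have "((\<lambda>t. w t X) has_real_derivative wt t X) (at t)"
      unfolding w_def wt_def by (intro DERIV_diff wave_sum_time_derivative[OF L] Psi_time_derivative)
    from DERIV_power[OF this, of 2]
    show "((\<lambda>t. (w t X)\<^sup>2) has_real_derivative 2 * w t X * wt t X) (at t within {0..1})"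
      by (auto intro!: has_field_derivative_at_within simp: mult_ac)
  next
    show "continuous_on UNIV (\<lambda>X. (w t X)\<^sup>2)" for t by (intro continuous_intros s1)
    show "continuous_on spacetime (\<lambda>(t, X). 2 * w t X * wt t X)"
      by (rule continuous_on_spacetime) (intro continuous_intros cw cwt)
  qed
  \<comment> \<open>The parameter of Young's inequality. \<open>32 * k + 1 / 500\<close> equals
    \<open>52 / 10000\<close> and \<open>32 / k / 10 ^ 8\<close> equals \<open>32 / 10000\<close>;
    the sum stays below \<open>1 / 100\<close>, so the \<open>L^1\<close> norm of \<open>w\<close>
    stays below \<open>1 / 10\<close>.\<close>
  define k where "k = (1 / 10000 :: real)"
  have cD: "continuous_on {0..1} D"
    unfolding D_def by (intro continuous_intros torus_int_continuous_param continuous_on_spacetime cG)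
  have bound: "torus_int (\<lambda>X. 2 * w t X * wt t X) \<le> (32 * k + 1 / 500) + 32 / k * D t" if t: "t \<in> {0..1}" for t
  proof -
    \<comment> \<open>The diffusive flux pairs \<open>w\<close> with the gradient of the full scalar
      rather than with that of \<open>w\<close>, since \<open>Psi\<close> is transported without
      diffusion. Thus only first derivatives of \<open>Psi\<close> enter.\<close>
    define F where "F i X = 2 * \<nu> * (w t X * wave_grad L t X $ i) - vel Q t X $ i * (w t X)\<^sup>2" for i X
    define F' where "F' i X = 2 * \<nu> * (wg t X $ i * wave_grad L t X $ i
        + w t X * wave_second i L t X) - vel Q t X $ i * (2 * w t X * wg t X $ i)" for i X
    have "((\<lambda>h. F i (X + h *\<^sub>R ee i)) has_real_derivative F' i X) (at 0)" for i X
    proof -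
      have a: "((\<lambda>h. w t (X + h *\<^sub>R ee i) * wave_grad L t (X + h *\<^sub>R ee i) $ i) has_real_derivative
         (wg t X $ i * wave_grad L t X $ i + w t X * wave_second i L t X)) (at 0)"
        using DERIV_mult[OF lw[of t X i] wave_grad_line_derivative[of L t X i]] by (simp add: mult.commute)
      have b: "((\<lambda>h. (w t (X + h *\<^sub>R ee i))\<^sup>2) has_real_derivative 2 * w t X * wg t X $ i) (at 0)"
        using DERIV_power[OF lw[of t X i], of 2] by (simp add: mult_ac)
      show ?thesis unfolding F_def F'_def vel_component_invariant
        by (intro DERIV_diff DERIV_cmult a b)
    qed
    moreover have "periodic (F i)" for i
      using perw[of t] perG[of t] vel_periodic[of Q t] by (simp add: periodic_def F_def)
    moreover have cF': "continuous_on UNIV (F' i)" for i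
      unfolding F'_def by (intro continuous_intros s1)
    ultimately have F0: "torus_int (F' i) = 0" for i using torus_int_partial_zero by blast
    have eq: "2 * w t X * wt t X = (\<Sum>i\<in>UNIV. F' i X) - 2 * \<nu> * (wg t X \<bullet> wave_grad L t X)
        + 2 * w t X * R t X" for X
    proof -
      have a1: "wt t X = \<nu> * wave_laplace L t X - vel Q t X \<bullet> wg t X + R t X"
        using eqn[of t X] Psi_transport[of Q t X] by (simp add: wt_def wg_def inner_diff_right)
      have a2: "(\<Sum>i\<in>UNIV. F' i X) = 2 * \<nu> * (wg t X \<bullet> wave_grad L t X)
          + 2 * w t X * (\<nu> * wave_laplace L t X) - 2 * w t X * (vel Q t X \<bullet> wg t X)"
        by (simp add: F'_def wave_laplace_def inner_vec_def sum.distrib sum_subtractf sum_distrib_left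
            algebra_simps)
      show ?thesis unfolding a1 a2 by (simp add: algebra_simps)
    qed
    have le: "2 * w t X * wt t X \<le> (\<Sum>i\<in>UNIV. F' i X) + ((32 * k + 1 / 500)
        + 32 / k * (\<nu> * (norm (wave_grad L t X))\<^sup>2))" for X
    proof -
      \<comment> \<open>By the choice of \<open>\<nu>\<close>, the square of \<open>g\<close> is the
        dissipation density, and the cross term with the gradient of \<open>Psi\<close> becomes
        linear in \<open>g\<close> with a constant independent of \<open>Q\<close>.\<close>
      define g where "g = norm (wave_grad L t X) / grad_scale Q"
      have g2: "\<nu> * (norm (wave_grad L t X))\<^sup>2 = g\<^sup>2" by (simp add: g_def nu power_divide)
      have "- (wg t X \<bullet> wave_grad L t X) = Psi_grad Q t X \<bullet> wave_grad L t X - wave_grad L t X \<bullet> wave_grad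
          L t X" by (simp add: wg_def inner_diff_left)
      also have "\<dots> \<le> norm (Psi_grad Q t X) * norm (wave_grad L t X)"
        using norm_cauchy_schwarz[of "Psi_grad Q t X" "wave_grad L t X"] inner_ge_zero[of "wave_grad L t
            X"] by linarith
      also have "\<dots> \<le> 32 * grad_scale Q * norm (wave_grad L t X)"
        by (intro mult_right_mono norm_Psi_grad_le) auto
      finally have "2 * \<nu> * (- (wg t X \<bullet> wave_grad L t X))
          \<le> 2 * \<nu> * (32 * grad_scale Q * norm (wave_grad L t X))"
        using nu0 by (intro mult_left_mono) auto
      also have "\<dots> = 32 * (2 * g)" using grad_scale by (simp add: nu g_def power2_eq_square)
      also have "\<dots> \<le> 32 * (k + g\<^sup>2 / k)"
      proof -
        have "0 \<le> (g - k)\<^sup>2 / k" by (simp add: k_def)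
        also have "\<dots> = g\<^sup>2 / k + k - 2 * g" by (simp add: k_def power2_eq_square algebra_simps)
        finally show ?thesis by simp
      qed
      finally have a: "- (2 * \<nu> * (wg t X \<bullet> wave_grad L t X)) \<le> 32 * k + 32 / k * g\<^sup>2" by (simp add: k_def)
      have "\<bar>w t X * R t X\<bar> \<le> (1 + \<bar>wave_sum L t X\<bar>) * \<bar>R t X\<bar>"
        unfolding abs_mult w_def using abs_Psi_le[of Q t X] by (intro mult_right_mono) auto
      then have "w t X * R t X \<le> 1 / 1000" using R[OF t, of X] by (simp add: mult.commute)
      then show ?thesis unfolding eq g2 using a by simp
    qed
    have "torus_int (\<lambda>X. 2 * w t X * wt t X) \<le> torus_int (\<lambda>X. (\<Sum>i\<in>UNIV. F' i X) + ((32 * k + 1 / 500)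
        + 32 / k * (\<nu> * (norm (wave_grad L t X))\<^sup>2)))"
      by (rule torus_int_mono[OF _ _ le]) (intro continuous_intros s1 cF')+
    also have "\<dots> = (32 * k + 1 / 500) + 32 / k * D t"
      by (subst torus_int_add, (intro continuous_intros s1 cF')+, subst torus_int_add, (intro
          continuous_intros s1)+)
        (simp only: torus_int_cmult torus_int_const D_def, simp add: torus_int_sum cF' F0)
    finally show ?thesis .
  qed
  have E0: "E 0 = 0"
  proof -
    have "Psi q 0 X = sin (2 * pi * X $ 1)" for q X
      by (induction q arbitrary: X) (simp_all add: shear_def ramp_before stage_start_nonneg)
    then show ?thesis using init by (simp add: E_def w_def torus_int_def)
  qed
  define I where "I t = integral {0..t} D" for t
  have DI: "(I has_real_derivative D t) (at t within {0..1})" if "t \<in> {0..1}" for t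
    unfolding I_def by (rule integral_has_real_derivative[OF cD that])
  have D0: "0 \<le> D t" for t unfolding D_def
    using nu0 by (intro mult_nonneg_nonneg torus_int_nonneg continuous_intros s1) auto
  have I1: "I 1 < 1 / 10 ^ 8" using contra unfolding I_def D_def[abs_def] not_le .
  have It: "I t \<le> I 1" if t: "t \<in> {0..1}" for t
    unfolding I_def using t D0
    by (intro integral_subset_le integrable_continuous_real continuous_on_subset[OF cD]) auto
  have Et: "E t \<le> 1 / 100" if t: "t \<in> {0..1}" for t
  proof -
    have "E t - E 0 \<le> ((32 * k + 1 / 500) * t + 32 / k * I t) - ((32 * k + 1 / 500) * 0 + 32 / k * I 0)"
    proof (rule derivative_le_imp_le[where f = E and f' = "\<lambda>t. torus_int (\<lambda>X. 2 * w t X * wt t X)"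
      and g' = "\<lambda>t. (32 * k + 1 / 500) + 32 / k * D t"])
      fix s assume s: "s \<in> {0..t}"
      then have s1: "s \<in> {0..1}" using t by auto
      show "(E has_real_derivative torus_int (\<lambda>X. 2 * w s X * wt s X)) (at s within {0..t})"
        by (rule DERIV_subset[OF DE[OF s1]]) (use t in auto)
      show "((\<lambda>t. (32 * k + 1 / 500) * t + 32 / k * I t) has_real_derivative (32 * k + 1 / 500)
          + 32 / k * D s) (at s within {0..t})"
        by (rule DERIV_subset[of _ _ _ "{0..1}"]) (use t in \<open>auto intro!: derivative_eq_intros DI[OF s1]
            simp: k_def\<close>)
      show "torus_int (\<lambda>X. 2 * w s X * wt s X) \<le> (32 * k + 1 / 500) + 32 / k * D s" by (rule bound[OF s1])
    qed (use t in auto)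
    moreover have "I 0 = 0" by (simp add: I_def)
    moreover have "(32 * k + 1 / 500) * t \<le> 52 / 10000" using t by (simp add: k_def)
    moreover have "32 / k * I t \<le> 32 / 10000" using It[OF t] I1 by (simp add: k_def)
    ultimately show ?thesis using E0 by simp
  qed
  have lower: "1 / 16 \<le> D t" if t: "t \<in> {1/2..1}" for t
  proof -
    define r where "r = 1 / grad_scale Q"
    define i where "i = stage_axis Q"
    have r: "0 \<le> r" using grad_scale by (simp add: r_def)
    have t1: "t \<in> {0..1}" using t by auto
    have w1: "torus_int (\<lambda>X. \<bar>w t X\<bar>) \<le> 1 / 10"
    proof -
      have "(torus_int (\<lambda>X. \<bar>w t X\<bar>))\<^sup>2 \<le> (1 / 10)\<^sup>2"
        using torus_int_cauchy_schwarz[OF s1(1)[of t]] Et[OF t1] by (simp add: E_def power2_eq_square)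
      then show ?thesis by (rule power2_le_imp_le) simp
    qed
    have Psi1: "Psi Q t = Psi Q 1" using Psi_after[of t Q] t by auto
    have m: "torus_int (\<lambda>X. \<bar>line_average r i (Psi Q t) X\<bar>) \<le> 1 / 20"
      using mean_size_le[of Q] by (simp add: mean_size_def r_def i_def Psi1)
    have aw: "torus_int (\<lambda>X. \<bar>line_average r i (w t) X\<bar>) \<le> 1 / 10"
      using torus_int_abs_line_average_le[OF s1(1) perw, of r i t] w1 by simp
    have line_average_add: "line_average r i (wave_sum L t) X = line_average r i (Psi Q t) X
        + line_average r i (w t) X" for X
    proof -
      have "continuous_on {0..1} (\<lambda>h. f (X + (r * h) *\<^sub>R ee i))" if "continuous_on UNIV f"
        for f :: "real^3 \<Rightarrow> real"
        by (rule continuous_on_compose2[OF that]) (auto intro!: continuous_intros)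
      then have "integral {0..1} (\<lambda>h. Psi Q t (X + (r * h) *\<^sub>R ee i)) + integral {0..1} (\<lambda>h. w t (X
          + (r * h) *\<^sub>R ee i))
        = integral {0..1} (\<lambda>h. Psi Q t (X + (r * h) *\<^sub>R ee i) + w t (X + (r * h) *\<^sub>R ee i))"
        using s1 by (intro Henstock_Kurzweil_Integration.integral_add[symmetric]
            integrable_continuous_real) auto
      then show ?thesis by (simp add: line_average_def w_def)
    qed
    have cA: "continuous_on UNIV (line_average r i f)" if "continuous_on UNIV f" for f
      by (rule continuous_line_average[OF that])
    \<comment> \<open>\<open>Psi\<close> is compared with the scalar, the scalar with its own
      average, and that average is the sum of those of \<open>Psi\<close> and \<open>w\<close>. All
      contributions but the second are known to be small.\<close>
    have "torus_int (\<lambda>X. \<bar>Psi Q t X\<bar>) \<le> torus_int (\<lambda>X. \<bar>w t X\<bar>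
        + (\<bar>line_average r i (wave_sum L t) X - wave_sum L t X\<bar> + (\<bar>line_average r i (Psi Q t) X\<bar>
            + \<bar>line_average r i (w t) X\<bar>)))"
    proof (rule torus_int_mono)
      show "\<bar>Psi Q t X\<bar> \<le> \<bar>w t X\<bar> + (\<bar>line_average r i (wave_sum L t) X - wave_sum L t X\<bar>
          + (\<bar>line_average r i (Psi Q t) X\<bar> + \<bar>line_average r i (w t) X\<bar>))" for X
        using line_average_add[of X] w_def[of t X] by linarith
    qed (intro continuous_intros s1 cA)+
    also have "\<dots> = torus_int (\<lambda>X. \<bar>w t X\<bar>) + (torus_int (\<lambda>X. \<bar>line_average r i (wave_sum L t) X -
        wave_sum L t X\<bar>) + (torus_int (\<lambda>X. \<bar>line_average r i (Psi Q t) X\<bar>)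
            + torus_int (\<lambda>X. \<bar>line_average r i (w t) X\<bar>)))"
      by (simp add: torus_int_add continuous_intros s1 cA)
    also have "torus_int (\<lambda>X. \<bar>line_average r i (wave_sum L t) X - wave_sum L t X\<bar>)
        \<le> r * torus_int (\<lambda>X. \<bar>wave_grad L t X $ i\<bar>)"
    proof (rule torus_int_diff_line_average_le[OF s1(3) _ _ r wave_sum_line_derivative])
      show "continuous_on UNIV (\<lambda>X. wave_grad L t X $ i)" by (intro continuous_intros s1)
      show "periodic (\<lambda>X. wave_grad L t X $ i)" using perG[of t] by (simp add: periodic_def)
    qed
    finally have "1 / 2 \<le> 1 / 10 + (r * torus_int (\<lambda>X. \<bar>wave_grad L t X $ i\<bar>) + (1 / 20 + 1 / 10))"
      using torus_int_abs_Psi_ge[of Q t] w1 m aw by linarith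
    then have "1 / 4 \<le> r * torus_int (\<lambda>X. \<bar>wave_grad L t X $ i\<bar>)" by simp
    then have "(1 / 4)\<^sup>2 \<le> (r * torus_int (\<lambda>X. \<bar>wave_grad L t X $ i\<bar>))\<^sup>2" by (intro power_mono) auto
    \<comment> \<open>The segment length satisfies \<open>r\<^sup>2 = \<nu>\<close>, so the
      \<open>L^1\<close> bound of the derivative at scale \<open>r\<close> becomes a bound of the
      dissipation rate without loss in \<open>Q\<close>.\<close>
    also have "\<dots> = \<nu> * (torus_int (\<lambda>X. \<bar>wave_grad L t X $ i\<bar>))\<^sup>2"
      by (simp add: power_mult_distrib r_def nu power_divide)
    also have "\<dots> \<le> \<nu> * torus_int (\<lambda>X. (wave_grad L t X $ i)\<^sup>2)"
      using nu0 by (intro mult_left_mono torus_int_cauchy_schwarz continuous_intros s1) auto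
    also have "\<dots> \<le> D t" unfolding D_def
    proof (intro mult_left_mono torus_int_mono)
      show "(wave_grad L t X $ i)\<^sup>2 \<le> (norm (wave_grad L t X))\<^sup>2" for X
        using component_le_norm_cart[of "wave_grad L t X" i] by (simp add: abs_le_square_iff[symmetric])
    qed (use nu0 in \<open>auto intro!: continuous_intros s1\<close>)
    finally show ?thesis by (simp add: power2_eq_square)
  qed
  have "1 / 32 = integral {1/2..1::real} (\<lambda>t. 1 / 16 :: real)" by simp
  also have "\<dots> \<le> integral {1/2..1} D"
    by (intro integral_le integrable_continuous_real continuous_on_subset[OF cD] lower) auto
  also have "\<dots> \<le> I 1" unfolding I_def
    by (intro integral_subset_le integrable_continuous_real continuous_on_subset[OF cD]) (use D0 in auto)
  finally show False using I1 by simp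
qed

section \<open>Velocity and force\<close>

text \<open>The last entry of these waves is a dummy, since only their smoothness matters.\<close>

definition disp_wave :: "(real \<Rightarrow> real) \<Rightarrow> nat \<Rightarrow> wave list" where
  "disp_wave g q = map (\<lambda>(a, k). (\<lambda>t. real (slope q) / 2 ^ q * (- (2 * pi / kernel_int (slope q) 1) * (a
      / (2 * pi * of_int k)\<^sup>2)) * g t,
      (2 * pi * of_int k * 2 ^ q) *\<^sub>R ee (stage_axis (Suc q)), pi / 2, 0)) (cos_coeffs (slope q))"
definition disp_d2_wave :: "(real \<Rightarrow> real) \<Rightarrow> nat \<Rightarrow> wave list" where
  "disp_d2_wave g q = map (\<lambda>(a, k). (\<lambda>t. real (slope q) * 2 ^ q * (2 * pi / kernel_int (slope q) 1 * a) * g t,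
      (2 * pi * of_int k * 2 ^ q) *\<^sub>R ee (stage_axis (Suc q)), pi / 2, 0)) (cos_coeffs (slope q))"

lemma wave_phase: "sin ((2 * pi * of_int k * 2 ^ q) *\<^sub>R ee j \<bullet> X + pi / 2)
    = cos (of_int k * (2 * pi * (2 ^ q * X $ j)))"
  by (simp add: inner_axis' sin_add mult_ac)

lemma sum_list_factor: "(\<Sum>x\<leftarrow>xs. c * f x * d) = c * (\<Sum>x\<leftarrow>xs. f x) * (d::real)"
  by (induction xs) (auto simp: distrib_left distrib_right)

lemma wave_sum_disp_wave: "wave_sum (disp_wave g q) t X = g t * disp q (X $ stage_axis (Suc q))"
proof -
  have "wave_sum (disp_wave g q) t X = (\<Sum>(a, k)\<leftarrow>cos_coeffs (slope q). real (slope q) / 2 ^ q * (- (2 * pi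
      / kernel_int (slope q) 1) * (a / (2 * pi * of_int k)\<^sup>2)) * g t
      * cos (of_int k * (2 * pi * (2 ^ q * X $ stage_axis (Suc q)))))"
    unfolding wave_sum_def disp_wave_def map_map o_def split_def fst_conv snd_conv wave_phase ..
  also have "\<dots> = (\<Sum>x\<leftarrow>cos_coeffs (slope q). (real (slope q) / 2 ^ q * (- (2 * pi / kernel_int (slope q) 1)))
      * (case x of (a, k) \<Rightarrow> a / (2 * pi * of_int k)\<^sup>2 * cos (of_int k * (2 * pi * (2 ^ q * X $ stage_axis
          (Suc q))))) * g t)"
    by (simp add: split_def mult_ac)
  also have "\<dots> = g t * disp q (X $ stage_axis (Suc q))"
    unfolding sum_list_factor disp_def profile_def by (simp only: mult_ac)
  finally show ?thesis .
qed

lemma wave_sum_disp_d2_wave: "wave_sum (disp_d2_wave g q) t X = g t * disp_d2 q (X $ stage_axis (Suc q))"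
proof -
  have "wave_sum (disp_d2_wave g q) t X = (\<Sum>(a, k)\<leftarrow>cos_coeffs (slope q). real (slope q) * 2 ^ q * (2 * pi
      / kernel_int (slope q) 1 * a) * g t
      * cos (of_int k * (2 * pi * (2 ^ q * X $ stage_axis (Suc q)))))"
    unfolding wave_sum_def disp_d2_wave_def map_map o_def split_def fst_conv snd_conv wave_phase ..
  also have "\<dots> = (\<Sum>x\<leftarrow>cos_coeffs (slope q). (real (slope q) * 2 ^ q * (2 * pi / kernel_int (slope q) 1))
      * (case x of (a, k) \<Rightarrow> a * cos (of_int k * (2 * pi * (2 ^ q * X $ stage_axis (Suc q))))) * g t)"
    by (simp add: split_def mult_ac)
  also have "\<dots> = g t * disp_d2 q (X $ stage_axis (Suc q))"
    unfolding sum_list_factor disp_d2_def profile_d2_def cos_coeffs(2) by (simp only: mult_ac)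
  finally show ?thesis .
qed

lemma lattice_vec_axis: "lattice_vec ((2 * pi * of_int k * 2 ^ q) *\<^sub>R ee (stage_axis p))"
  unfolding lattice_vec_def
proof (intro conjI allI)
  show "((2 * pi * of_int k * 2 ^ q) *\<^sub>R ee (stage_axis p)) $ 3 = 0"
    using stage_axis_neq_3[of p] by (simp add: ee_nth)
  show "\<exists>n::int. ((2 * pi * of_int k * 2 ^ q) *\<^sub>R ee (stage_axis p)) $ i = 2 * pi * of_int n" for i
    by (rule exI[of _ "if i = stage_axis p then k * 2 ^ q else 0"]) (simp add: ee_nth)
qed

lemma wave_smooth_disp_wave:
  assumes "smooth_real g" shows "wave_smooth (disp_wave g q)"
  unfolding wave_smooth_def
proof
  fix w assume "w \<in> set (disp_wave g q)"
  then obtain z where z: "w = (case z of (a, k) \<Rightarrow> (\<lambda>t. real (slope q) / 2 ^ q * (- (2 * pi / kernel_int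
      (slope q) 1) * (a / (2 * pi * of_int k)\<^sup>2)) * g t,
      (2 * pi * of_int k * 2 ^ q) *\<^sub>R ee (stage_axis (Suc q)), pi / 2, 0))"
    unfolding disp_wave_def set_map by (rule imageE)
  show "case w of (c, \<kappa>, \<beta>, x) \<Rightarrow> smooth_real c \<and> lattice_vec \<kappa>"
    unfolding z split_def fst_conv snd_conv by (rule conjI[OF smooth_real_cmult[OF assms] lattice_vec_axis])
qed

lemma wave_smooth_disp_d2_wave:
  assumes "smooth_real g" shows "wave_smooth (disp_d2_wave g q)"
  unfolding wave_smooth_def
proof
  fix w assume "w \<in> set (disp_d2_wave g q)"
  then obtain z where z: "w = (case z of (a, k) \<Rightarrow> (\<lambda>t. real (slope q) * 2 ^ q * (2 * pi / kernel_int
      (slope q) 1 * a) * g t,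
      (2 * pi * of_int k * 2 ^ q) *\<^sub>R ee (stage_axis (Suc q)), pi / 2, 0))"
    unfolding disp_d2_wave_def set_map by (rule imageE)
  show "case w of (c, \<kappa>, \<beta>, x) \<Rightarrow> smooth_real c \<and> lattice_vec \<kappa>"
    unfolding z split_def fst_conv snd_conv by (rule conjI[OF smooth_real_cmult[OF assms] lattice_vec_axis])
qed

definition vel_waves :: "nat \<Rightarrow> vwave list" where
  "vel_waves Q = concat (map (\<lambda>q. map (\<lambda>(c, \<kappa>, \<beta>, x). (c, \<kappa>, \<beta>, ee (stage_axis q))) (disp_wave (ramp_d1
      q) q)) [0..<Q])"

lemma vwave_sum_append: "vwave_sum (P @ P') t X = vwave_sum P t X + vwave_sum P' t X"
  by (simp add: vwave_sum_def)

lemma vwave_sum_map: "vwave_sum (map (\<lambda>(c, \<kappa>, \<beta>, x). (c, \<kappa>, \<beta>, e)) L) t X = wave_sum L t X *\<^sub>R e"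
proof (induction L)
  case (Cons w L)
  obtain c \<kappa> \<beta> x where w: "w = (c, \<kappa>, \<beta>, x)" by (metis prod_cases4)
  show ?case using Cons unfolding w by (simp add: vwave_sum_def wave_Cons scaleR_left_distrib)
qed (simp add: vwave_sum_def)

lemma vwave_sum_vel_waves: "vwave_sum (vel_waves Q) t X = vel Q t X"
proof (induction Q)
  case (Suc Q)
  then show ?case by (simp add: vel_waves_def vwave_sum_append vwave_sum_map wave_sum_disp_wave vel_def)
qed (simp add: vel_waves_def vwave_sum_def vel_def)

lemma vel_waves_smooth: "(c, \<kappa>, \<beta>, d) \<in> set (vel_waves Q) \<Longrightarrow> smooth_real c \<and> lattice_vec \<kappa>"
proof -
  assume "(c, \<kappa>, \<beta>, d) \<in> set (vel_waves Q)"
  then obtain q x where "(c, \<kappa>, \<beta>, x) \<in> set (disp_wave (ramp_d1 q) q)" by (auto simp: vel_waves_def)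
  then show ?thesis using wave_smooth_disp_wave[OF smooth_real_ramp_d1, of q q] by (auto simp: wave_smooth_def)
qed

lemma smooth_real_bounded: "smooth_real c \<Longrightarrow> \<exists>M\<ge>0. \<forall>t\<in>{0..1}. \<bar>c t\<bar> \<le> M"
proof -
  assume "smooth_real c"
  then have "compact (c ` {0..1})" by (intro compact_continuous_image smooth_real_continuous) auto
  then obtain M where "\<And>z. z \<in> c ` {0..1} \<Longrightarrow> \<bar>z\<bar> \<le> M"
    using compact_imp_bounded bounded_iff real_norm_def by metis
  then show ?thesis by (intro exI[of _ "max 0 M"]) (auto simp: le_max_iff_disj)
qed

lemma vwave_bounded_exists:
  "(\<And>c \<kappa> \<beta> d. (c, \<kappa>, \<beta>, d) \<in> set P \<Longrightarrow> smooth_real c \<and> lattice_vec \<kappa>) \<Longrightarrow> \<exists>M. vwave_bounded M P"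
proof (induction P)
  case Nil
  show ?case by (rule exI[of _ 0]) (simp add: vwave_bounded_def)
next
  case (Cons p P)
  obtain c \<kappa> \<beta> d where p: "p = (c, \<kappa>, \<beta>, d)" by (metis prod_cases4)
  obtain M where M: "vwave_bounded M P" using Cons.IH Cons.prems by (meson list.set_intros(2))
  have c: "smooth_real c" "lattice_vec \<kappa>" using Cons.prems[of c \<kappa> \<beta> d] p by auto
  obtain M' where M': "M' \<ge> 0" "\<And>t. t \<in> {0..1} \<Longrightarrow> \<bar>c t\<bar> \<le> M'" using smooth_real_bounded[OF c(1)] by auto
  have "vwave_bounded (max M M') (p # P)"
    using M M' c unfolding vwave_bounded_def p by (fastforce simp: le_max_iff_disj)
  then show ?case by blast
qed

lemma vwave_bounded_bounds:
  "vwave_bounded M P \<Longrightarrow> \<exists>C\<ge>0. \<forall>t\<in>{0..1}. \<forall>X Y. norm (vwave_sum P t X) \<le> C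
      \<and> norm (vwave_sum P t X - vwave_sum P t Y) \<le> C * dist X Y"
proof (induction P)
  case Nil
  show ?case by (rule exI[of _ 0]) (simp add: vwave_sum_def)
next
  case (Cons p P)
  obtain c \<kappa> \<beta> d where p: "p = (c, \<kappa>, \<beta>, d)" by (metis prod_cases4)
  have M: "0 \<le> M" "\<And>t. t \<in> {0..1} \<Longrightarrow> \<bar>c t\<bar> \<le> M" "vwave_bounded M P"
    using Cons.prems by (auto simp: vwave_bounded_def p)
  obtain C where C: "C \<ge> 0" "\<And>t X Y. t \<in> {0..1} \<Longrightarrow> norm (vwave_sum P t X) \<le> C"
    "\<And>t X Y. t \<in> {0..1} \<Longrightarrow> norm (vwave_sum P t X - vwave_sum P t Y) \<le> C * dist X Y"
    using Cons.IH[OF M(3)] by blast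
  define B where "B = M * norm d * (1 + norm \<kappa>)"
  have B: "B \<ge> 0" "M * norm d \<le> B" using M(1) by (auto simp: B_def mult_left_le distrib_left)
  have cons: "vwave_sum (p # P) t X = (c t * sin (\<kappa> \<bullet> X + \<beta>)) *\<^sub>R d + vwave_sum P t X" for t X
    by (simp add: vwave_sum_def p)
  have 1: "norm ((c t * sin (\<kappa> \<bullet> X + \<beta>)) *\<^sub>R d) \<le> B" if t: "t \<in> {0..1}" for t X
  proof -
    have "\<bar>c t\<bar> * \<bar>sin (\<kappa> \<bullet> X + \<beta>)\<bar> * norm d \<le> M * 1 * norm d"
      using M t by (intro mult_mono) auto
    then show ?thesis using B(2) by (simp add: abs_mult)
  qed
  have 2: "norm ((c t * sin (\<kappa> \<bullet> X + \<beta>)) *\<^sub>R d - (c t * sin (\<kappa> \<bullet> Y + \<beta>)) *\<^sub>R d) \<le> B * dist X Y"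
    if t: "t \<in> {0..1}" for t X Y
  proof -
    have "\<bar>sin (\<kappa> \<bullet> X + \<beta>) - sin (\<kappa> \<bullet> Y + \<beta>)\<bar> \<le> 1 * \<bar>(\<kappa> \<bullet> X + \<beta>) - (\<kappa> \<bullet> Y + \<beta>)\<bar>"
      by (rule real_lipschitz[OF DERIV_sin]) simp
    also have "\<dots> \<le> norm \<kappa> * dist X Y"
      using Cauchy_Schwarz_ineq2[of \<kappa> "X - Y"] by (simp add: dist_norm inner_diff_right)
    finally have s: "\<bar>sin (\<kappa> \<bullet> X + \<beta>) - sin (\<kappa> \<bullet> Y + \<beta>)\<bar> \<le> norm \<kappa> * dist X Y" .
    have "norm ((c t * sin (\<kappa> \<bullet> X + \<beta>)) *\<^sub>R d - (c t * sin (\<kappa> \<bullet> Y + \<beta>)) *\<^sub>R d)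
       = \<bar>c t\<bar> * \<bar>sin (\<kappa> \<bullet> X + \<beta>) - sin (\<kappa> \<bullet> Y + \<beta>)\<bar> * norm d"
      unfolding scaleR_left_diff_distrib[symmetric] right_diff_distrib[symmetric] norm_scaleR abs_mult ..
    also have "\<dots> \<le> M * (norm \<kappa> * dist X Y) * norm d" using M t by (intro mult_mono s) auto
    also have "\<dots> = (M * norm d * norm \<kappa>) * dist X Y" by (simp add: mult_ac)
    also have "\<dots> \<le> B * dist X Y" using M(1) by (intro mult_right_mono) (auto simp: B_def distrib_left)
    finally show ?thesis .
  qed
  show ?case
  proof (intro exI[of _ "B + C"] conjI ballI allI)
    fix t :: real and X Y :: "real^3" assume t: "t \<in> {0..1}"
    show "norm (vwave_sum (p # P) t X) \<le> B + C"
      unfolding cons by (rule norm_triangle_le) (intro add_mono 1 C t)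
    have "vwave_sum (p # P) t X - vwave_sum (p # P) t Y = ((c t * sin (\<kappa> \<bullet> X
        + \<beta>)) *\<^sub>R d - (c t * sin (\<kappa> \<bullet> Y + \<beta>)) *\<^sub>R d) + (vwave_sum P t X - vwave_sum P t Y)"
      unfolding cons by simp
    also have "norm \<dots> \<le> B * dist X Y + C * dist X Y"
      by (rule norm_triangle_le) (intro add_mono 2 C t)
    finally show "norm (vwave_sum (p # P) t X - vwave_sum (p # P) t Y) \<le> (B + C) * dist X Y"
      by (simp add: distrib_right)
  qed (use B C in auto)
qed

lemma smooth_time_add:
  assumes "smooth_torus_time F" "smooth_torus_time G"
  shows "smooth_torus_time (\<lambda>t X. F t X + G t X)"
proof -
  have "C_k_on k spacetime (\<lambda>z. F (fst z) (snd z) + G (fst z) (snd z))" for k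
    by (rule C_k_on_add[OF unique_deriv_set_spacetime])
      (use assms in \<open>simp_all add: smooth_torus_time_def smooth_on_def split_def\<close>)
  then show ?thesis using assms by (simp add: smooth_torus_time_def smooth_on_def split_def periodic_def)
qed

lemma smooth_time_linear:
  assumes "bounded_linear h" "smooth_torus_time F"
  shows "smooth_torus_time (\<lambda>t X. h (F t X))"
proof -
  have "C_k_on k spacetime (\<lambda>z. h (F (fst z) (snd z)))" for k
    by (rule C_k_on_linear_comp[OF unique_deriv_set_spacetime assms(1)])
      (use assms in \<open>simp add: smooth_torus_time_def smooth_on_def split_def\<close>)
  then show ?thesis using assms by (simp add: smooth_torus_time_def smooth_on_def split_def periodic_def)
qed

lemma smooth_time_scaleR: "smooth_torus_time F \<Longrightarrow> smooth_torus_time (\<lambda>t X. F t X *\<^sub>R e)"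
  by (rule smooth_time_linear[OF bounded_linear_scaleR_left])

lemma smooth_time_zero: "smooth_torus_time (\<lambda>t X. 0)"
  unfolding smooth_torus_time_def smooth_on_def split_def
  by (auto intro!: C_k_on_const[OF unique_deriv_set_spacetime] simp: periodic_def)

lemma smooth_time_sum: "(\<And>i. i \<in> A \<Longrightarrow> smooth_torus_time (F i)) \<Longrightarrow> smooth_torus_time (\<lambda>t X. \<Sum>i\<in>A. F i t X)"
  by (induction A rule: infinite_finite_induct) (auto intro: smooth_time_add smooth_time_zero)

text \<open>Once smoothness is known, differentiation along a line identifies
  \<open>partial_deriv\<close>; the formulas for the flow are obtained in this way.\<close>

lemma partial_deriv_line:
  fixes u :: "real \<Rightarrow> real^3 \<Rightarrow> 'b::real_normed_vector"
  assumes "smooth_torus_time u" "t \<in> {0..1}" "((\<lambda>h. u t (x + h *\<^sub>R ee i)) has_vector_derivative D) (at 0)"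
  shows "partial_deriv i (u t) x = D"
  using vector_derivative_unique_at[OF smooth_time_partial_line[OF assms(1,2)] assms(3)] .

section \<open>The three-dimensional flow as a solution\<close>

definition flow :: "nat \<Rightarrow> wave list \<Rightarrow> real \<Rightarrow> real^3 \<Rightarrow> real^3" where
  "flow Q L t X = vel Q t X + wave_sum L t X *\<^sub>R ee 3"

definition force :: "nat \<Rightarrow> real \<Rightarrow> (real \<Rightarrow> real^3 \<Rightarrow> real) \<Rightarrow> real \<Rightarrow> real^3 \<Rightarrow> real^3" where
  "force Q \<nu> R t X = (\<Sum>q<Q. (ramp_d2 q t * disp q (X $ stage_axis (Suc q)) - \<nu> * ramp_d1 q t * disp_d2 q
      (X $ stage_axis (Suc q))) *\<^sub>R ee (stage_axis q))
     + R t X *\<^sub>R ee 3"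

text \<open>The factor \<open>ee (stage_axis (Suc q)) $ i\<close> is the indicator of the one
  coordinate on which shear \<open>q\<close> depends. It is idempotent, so the second derivative in
  \<open>flow_dd\<close> has the same form.\<close>

definition flow_d :: "nat \<Rightarrow> wave list \<Rightarrow> 3 \<Rightarrow> real \<Rightarrow> real^3 \<Rightarrow> real^3" where
  "flow_d Q L i t X = (\<Sum>q<Q. (ramp_d1 q t * disp_d1 q (X $ stage_axis (Suc q)) * ee (stage_axis (Suc q))
      $ i) *\<^sub>R ee (stage_axis q)) + wave_grad L t X $ i *\<^sub>R ee 3"

definition flow_dd :: "nat \<Rightarrow> wave list \<Rightarrow> 3 \<Rightarrow> real \<Rightarrow> real^3 \<Rightarrow> real^3" where
  "flow_dd Q L i t X = (\<Sum>q<Q. (ramp_d1 q t * disp_d2 q (X $ stage_axis (Suc q)) * ee (stage_axis (Suc q))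
      $ i) *\<^sub>R ee (stage_axis q)) + wave_second i L t X *\<^sub>R ee 3"

lemma flow_smooth: "wave_smooth L \<Longrightarrow> smooth_torus_time (flow Q L)"
proof -
  assume L: "wave_smooth L"
  have "flow Q L = (\<lambda>t X. (\<Sum>q<Q. wave_sum (disp_wave (ramp_d1 q) q) t X *\<^sub>R ee (stage_axis q))
      + wave_sum L t X *\<^sub>R ee 3)"
    by (intro ext) (simp add: flow_def vel_def wave_sum_disp_wave)
  moreover have "smooth_torus_time \<dots>"
    by (intro smooth_time_add smooth_time_sum smooth_time_scaleR wave_sum_smooth L wave_smooth_disp_wave
        smooth_real_ramp_d1)
  ultimately show ?thesis by simp
qed

lemma force_smooth: "smooth_torus_time R \<Longrightarrow> smooth_torus_time (force Q \<nu> R)"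
proof -
  assume R: "smooth_torus_time R"
  have "force Q \<nu> R = (\<lambda>t X. (\<Sum>q<Q. (wave_sum (disp_wave (ramp_d2 q) q) t X
      + wave_sum (disp_d2_wave (\<lambda>t. - \<nu> * ramp_d1 q t) q) t X) *\<^sub>R ee (stage_axis q)) + R t X *\<^sub>R ee 3)"
    by (intro ext) (simp add: force_def wave_sum_disp_wave wave_sum_disp_d2_wave)
  moreover have "smooth_torus_time \<dots>"
    by (intro smooth_time_add smooth_time_sum smooth_time_scaleR wave_sum_smooth R wave_smooth_disp_wave
        wave_smooth_disp_d2_wave smooth_real_ramp_d2 smooth_real_ramp_d1 smooth_real_cmult)
  ultimately show ?thesis by simp
qed

lemma ee_sym: "ee i $ j = ee j $ i" by (auto simp: ee_nth)
lemma ee_idem: "ee i $ j * ee i $ j = ee i $ j" by (simp add: ee_nth)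

lemma coordinate_line:
  assumes "\<And>y. (f has_real_derivative f' y) (at y)"
  shows "((\<lambda>h. f ((X + h *\<^sub>R ee i) $ j)) has_real_derivative f' (X $ j) * ee j $ i) (at 0)"
proof -
  have "((\<lambda>h. (X + h *\<^sub>R ee i) $ j) has_real_derivative ee j $ i) (at 0)"
    by (auto intro!: derivative_eq_intros simp: ee_sym)
  moreover have "(f has_real_derivative f' (X $ j)) (at ((X + 0 *\<^sub>R ee i) $ j))" using assms by simp
  ultimately show ?thesis by (rule DERIV_chain2[rotated])
qed

lemma scaleR_has_vector_derivative:
  "(f has_real_derivative f') (at t within S) \<Longrightarrow> ((\<lambda>t. f t *\<^sub>R e) has_vector_derivative f' *\<^sub>R e) (at t
      within S)"
  unfolding has_real_derivative_iff_has_vector_derivative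
  by (rule bounded_linear.has_vector_derivative[OF bounded_linear_scaleR_left])

lemma flow_partial:
  assumes L: "wave_smooth L" and t: "t \<in> {0..1}"
  shows "partial_deriv i (flow Q L t) X = flow_d Q L i t X"
proof (rule partial_deriv_line[OF flow_smooth[OF L] t])
  have "((\<lambda>h. ramp_d1 q t * disp q ((X + h *\<^sub>R ee i) $ stage_axis (Suc q)))
      has_real_derivative ramp_d1 q t * disp_d1 q (X $ stage_axis (Suc q)) * ee (stage_axis (Suc q)) $ i)
          (at 0)" for q
    using DERIV_cmult[OF coordinate_line[of "disp q" "disp_d1 q", OF disp_deriv]] by (simp add: mult.assoc)
  then show "((\<lambda>h. flow Q L t (X + h *\<^sub>R ee i)) has_vector_derivative flow_d Q L i t X) (at 0)"
    unfolding flow_def vel_def flow_d_def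
    by (intro has_vector_derivative_add has_vector_derivative_sum scaleR_has_vector_derivative
        wave_sum_line_derivative)
qed

lemma flow_partial2:
  assumes L: "wave_smooth L" and t: "t \<in> {0..1}"
  shows "partial_deriv i (partial_deriv i (flow Q L t)) X = flow_dd Q L i t X"
proof (rule partial_deriv_line[OF smooth_time_partial[OF flow_smooth[OF L]] t])
  have "((\<lambda>h. ramp_d1 q t * disp_d1 q ((X + h *\<^sub>R ee i) $ stage_axis (Suc q)) * ee (stage_axis (Suc q)) $
      i) has_real_derivative ramp_d1 q t * disp_d2 q (X $ stage_axis (Suc q)) * ee (stage_axis (Suc q)) $
          i) (at 0)" for q
    using DERIV_cmult_right[OF DERIV_cmult[OF coordinate_line[of "disp_d1 q" "disp_d2 q", OF
        disp_d1_deriv]], of "ramp_d1 q t" X i "stage_axis (Suc q)" "ee (stage_axis (Suc q)) $ i"]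
    by (simp add: mult.assoc ee_idem)
  then show "((\<lambda>h. partial_deriv i (flow Q L t) (X
      + h *\<^sub>R ee i)) has_vector_derivative flow_dd Q L i t X) (at 0)"
    unfolding flow_partial[OF L t] flow_d_def flow_dd_def
    by (intro has_vector_derivative_add has_vector_derivative_sum scaleR_has_vector_derivative
        wave_grad_line_derivative)
qed

lemma flow_time_deriv:
  assumes L: "wave_bounded \<gamma> L" and t: "t \<in> {0..1}"
  shows "time_deriv (flow Q L) t X = (\<Sum>q<Q. (ramp_d2 q t * disp q (X $ stage_axis (Suc q))) *\<^sub>R ee
      (stage_axis q)) + wave_time L t X *\<^sub>R ee 3"
  unfolding time_deriv_def
proof (rule vector_derivative_within_closed_interval[of 0 1 t "\<lambda>s. flow Q L s X"])
  have "((\<lambda>s. ramp_d1 q s * disp q (X $ stage_axis (Suc q)))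
      has_real_derivative ramp_d2 q t * disp q (X $ stage_axis (Suc q))) (at t within {0..1})" for q
    by (rule has_field_derivative_at_within[OF DERIV_cmult_right[OF ramp_d1_deriv]])
  moreover have "((\<lambda>s. wave_sum L s X) has_real_derivative wave_time L t X) (at t within {0..1})"
    by (rule has_field_derivative_at_within[OF wave_sum_time_derivative[OF L]])
  ultimately show "((\<lambda>s. flow Q L s X) has_vector_derivative (\<Sum>q<Q. (ramp_d2 q t * disp q (X $ stage_axis
      (Suc q))) *\<^sub>R ee (stage_axis q)) + wave_time L t X *\<^sub>R ee 3) (at t within {0..1})"
    unfolding flow_def vel_def
    by (intro has_vector_derivative_add has_vector_derivative_sum scaleR_has_vector_derivative)
qed (use t in auto)

lemma ramp_d1_disjoint: "q \<noteq> r \<Longrightarrow> ramp_d1 q t * ramp_d1 r t = 0"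
proof (induction q r rule: linorder_wlog)
  case (le q r)
  then have "stage_start (Suc q) \<le> stage_start r" by (intro stage_start_mono) auto
  then show ?case using ramp_d1_off[of t q] ramp_d1_off[of t r] by (cases "t \<le> stage_start r") auto
qed (simp add: mult.commute)

text \<open>Shear \<open>q\<close> varies along \<open>stage_axis (Suc q)\<close> only, and velocity
  in that direction comes from other stages, which are at rest while stage \<open>q\<close> is
  active. Hence the planar flow does not advect itself.\<close>

lemma ramp_d1_vel: "ramp_d1 q t * vel Q t X $ stage_axis (Suc q) = 0"
proof -
  have "ramp_d1 q t * (ramp_d1 r t * disp r (X $ stage_axis (Suc r)) * ee (stage_axis r) $ stage_axis
      (Suc q)) = 0" for r
    using ramp_d1_disjoint[of q r t] stage_axis_Suc_neq[of q]
      by (cases "q = r") (auto simp: ee_nth mult.assoc[symmetric])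
  then show ?thesis
    unfolding vel_def sum_component sum_distrib_left vector_scaleR_component real_scaleR_def
    by (intro sum.neutral ballI)
qed

text \<open>By \<open>ramp_d1_vel\<close>, advection acts on the third component alone, where the
  balance is \<open>eqn\<close>. In the planar components the force is exactly the time derivative
  minus the viscous term, so zero pressure works.\<close>

lemma flow_solves:
  assumes L: "wave_bounded \<gamma> L" and R: "smooth_torus_time R"
    and eqn: "\<And>t X. wave_time L t X = \<nu> * wave_laplace L t X - vel Q t X \<bullet> wave_grad L t X + R t X"
  shows "navier_stokes_solution \<nu> (force Q \<nu> R) (flow Q L 0) (flow Q L) (\<lambda>t X. 0)"
  unfolding navier_stokes_solution_def
proof (intro conjI ballI allI)
  note wave_laplace = wave_bounded_imp_smooth[OF L]
  show "smooth_torus_time (flow Q L)" by (rule flow_smooth[OF wave_laplace])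
  show "smooth_torus_time (\<lambda>t X. 0 :: real)" by (rule smooth_time_zero)
  fix t :: real and X :: "real^3" assume t: "t \<in> {0..1}"
  have e1: "(\<Sum>i\<in>UNIV. c * ee j $ i * x $ i) = c * x $ j" for c j and x :: "real^3"
    using exhaust_3[of j] by (auto simp: sum_3 ee_nth)
  have adv: "advection (flow Q L t) (flow Q L t) X = (vel Q t X \<bullet> wave_grad L t X) *\<^sub>R ee 3"
  proof -
    have u: "flow Q L t X $ stage_axis (Suc q) = vel Q t X $ stage_axis (Suc q)" for q
      using stage_axis_neq_3[of "Suc q"] by (simp add: flow_def ee_nth)
    have 1: "(\<Sum>i\<in>UNIV. flow Q L t X $ i * wave_grad L t X $ i) = vel Q t X \<bullet> wave_grad L t X"
      using wave_grad_third[OF L] by (simp add: sum_3 inner_vec_def flow_def ee_nth)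
    have "(\<Sum>i\<in>UNIV. flow Q L t X $ i *\<^sub>R (\<Sum>q<Q. (ramp_d1 q t * disp_d1 q (X $ stage_axis (Suc q)) * ee
        (stage_axis (Suc q)) $ i) *\<^sub>R ee (stage_axis q)))
       = (\<Sum>q<Q. (\<Sum>i\<in>UNIV. ramp_d1 q t * disp_d1 q (X $ stage_axis (Suc q)) * ee (stage_axis (Suc q)) $ i
           * flow Q L t X $ i) *\<^sub>R ee (stage_axis q))"
      unfolding scaleR_sum_right scaleR_sum_left by (subst sum.swap) (simp add: mult_ac)
    also have "\<dots> = 0"
      unfolding e1 u using ramp_d1_vel[of _ t Q X] by (intro sum.neutral) (auto simp: mult_ac)
    finally show ?thesis
      unfolding advection_def flow_partial[OF wave_laplace t] flow_d_def scaleR_add_right sum.distrib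
      by (simp add: 1 scaleR_sum_left[symmetric])
  qed
  have lap: "laplacian (flow Q L t) X = (\<Sum>q<Q. (ramp_d1 q t * disp_d2 q (X $ stage_axis (Suc q))) *\<^sub>R ee
      (stage_axis q)) + wave_laplace L t X *\<^sub>R ee 3"
  proof -
    \<comment> \<open>The all-ones vector is inserted to match the form of
      \<open>e1\<close>.\<close>
    have "(\<Sum>i\<in>UNIV. \<Sum>q<Q. (ramp_d1 q t * disp_d2 q (X $ stage_axis (Suc q)) * ee (stage_axis (Suc q)) $
        i) *\<^sub>R ee (stage_axis q))
       = (\<Sum>q<Q. (\<Sum>i\<in>UNIV. ramp_d1 q t * disp_d2 q (X $ stage_axis (Suc q)) * ee (stage_axis (Suc q)) $ i
           * (\<chi> i. 1) $ i) *\<^sub>R ee (stage_axis q))"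
      unfolding scaleR_sum_left by (subst sum.swap) simp
    then show ?thesis
      unfolding laplacian_def flow_partial2[OF wave_laplace t] flow_dd_def sum.distrib e1
        by (simp add: wave_laplace_def scaleR_sum_left)
  qed
  have grad: "gradient (\<lambda>X. 0 :: real) X = 0"
    by (simp add: gradient_def partial_deriv_def vec_eq_iff)
  show "time_deriv (flow Q L) t X + advection (flow Q L t) (flow Q L t) X + gradient (\<lambda>X. 0) X
      = \<nu> *\<^sub>R laplacian (flow Q L t) X + force Q \<nu> R t X"
    unfolding adv lap grad flow_time_deriv[OF L t] force_def eqn
    by (simp add: scaleR_diff_left sum_subtractf scaleR_sum_right scaleR_add_right scaleR_left_distrib
        mult.assoc)
  have "ramp_d1 q t * disp_d1 q (X $ stage_axis (Suc q)) * ee (stage_axis (Suc q)) $ i * ee (stage_axis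
      q) $ i = 0" for q i
    using stage_axis_Suc_neq[of q] by (auto simp: ee_nth)
  then have "(\<Sum>q<Q. (ramp_d1 q t * disp_d1 q (X $ stage_axis (Suc q)) * ee (stage_axis (Suc q)) $ i) *\<^sub>R
      ee (stage_axis q)) $ i = 0" for i
    unfolding sum_component vector_scaleR_component real_scaleR_def by (intro sum.neutral ballI)
  moreover have "(\<Sum>i\<in>UNIV. (wave_grad L t X $ i *\<^sub>R ee 3) $ i) = 0"
    using wave_grad_third[OF L] by (simp add: sum_3 ee_nth)
  ultimately show "divergence (flow Q L t) X = 0"
    unfolding divergence_def flow_partial[OF wave_laplace t] flow_d_def vector_add_component sum.distrib by simp
qed simp

text \<open>The gradient of the scalar is the third row of the velocity gradient; the planar rows
  only add to the Frobenius norm.\<close>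

lemma flow_dissipation:
  assumes L: "wave_bounded \<gamma> L" and nu: "\<nu> \<ge> 0"
  shows "integral {0..1} (\<lambda>t. \<nu> * torus_int (\<lambda>X. (norm (wave_grad L t X))\<^sup>2)) \<le> dissipation \<nu> (flow Q L)"
proof -
  note wave_laplace = wave_bounded_imp_smooth[OF L]
  have cp: "continuous_on spacetime (\<lambda>(t, X). partial_deriv i (flow Q L t) X)" for i
    by (rule smooth_time_continuous[OF smooth_time_partial[OF flow_smooth[OF wave_laplace]]])
  have cs: "continuous_on spacetime (\<lambda>(t, X). \<Sum>i\<in>UNIV. (norm (partial_deriv i (flow Q L t) X))\<^sup>2)"
    using cp unfolding split_def by (intro continuous_intros)
  have cG: "continuous_on spacetime (\<lambda>(t, X). (norm (wave_grad L t X))\<^sup>2)"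
    by (rule continuous_on_spacetime) (intro continuous_intros continuous_wave_grad[OF L])
  have ct: "continuous_on UNIV (F t)" if "continuous_on spacetime (\<lambda>(t, X). F t X)" "t \<in> {0..1}"
    for F :: "real \<Rightarrow> real^3 \<Rightarrow> real" and t
    using continuous_on_compose2[OF that(1), of UNIV "\<lambda>X. (t, X)"] that(2)
      by (simp add: continuous_on_Pair image_subset_iff)
  have "integral {0..1} (\<lambda>t. torus_int (\<lambda>X. (norm (wave_grad L t X))\<^sup>2))
     \<le> integral {0..1} (\<lambda>t. torus_int (\<lambda>X. \<Sum>i\<in>UNIV. (norm (partial_deriv i (flow Q L t) X))\<^sup>2))"
  proof (intro integral_le integrable_continuous_real torus_int_continuous_param cs cG)
    fix t :: real assume t: "t \<in> {0..1}"
    show "torus_int (\<lambda>X. (norm (wave_grad L t X))\<^sup>2)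
        \<le> torus_int (\<lambda>X. \<Sum>i\<in>UNIV. (norm (partial_deriv i (flow Q L t) X))\<^sup>2)"
    proof (intro torus_int_mono ct[OF cs t] ct[OF cG t])
      fix X
      have "(wave_grad L t X $ i)\<^sup>2 \<le> (norm (flow_d Q L i t X))\<^sup>2" for i
      proof -
        have "flow_d Q L i t X $ 3 = wave_grad L t X $ i"
          using stage_axis_neq_3 by (simp add: flow_d_def ee_nth sum.neutral)
        then show ?thesis using component_le_norm_cart[of "flow_d Q L i t X" 3]
          by (simp add: abs_le_square_iff[symmetric])
      qed
      then have "(\<Sum>i\<in>UNIV. (wave_grad L t X $ i)\<^sup>2) \<le> (\<Sum>i\<in>UNIV. (norm (flow_d Q L i t X))\<^sup>2)"
        by (intro sum_mono)
      moreover have "(norm (wave_grad L t X))\<^sup>2 = (\<Sum>i\<in>UNIV. (wave_grad L t X $ i)\<^sup>2)"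
        unfolding power2_norm_eq_inner inner_vec_def by (simp add: power2_eq_square)
      ultimately show "(norm (wave_grad L t X))\<^sup>2 \<le> (\<Sum>i\<in>UNIV. (norm (partial_deriv i (flow Q L t) X))\<^sup>2)"
        by (simp add: flow_partial[OF wave_laplace t])
    qed
  qed
  from mult_left_mono[OF this nu] show ?thesis
    by (simp add: dissipation_def torus_int_def)
qed

section \<open>Hoelder bounds of the force\<close>

text \<open>With \<open>x = N * d\<close> the hypotheses bound \<open>z\<close> by
  \<open>A * min 2 x\<close>. For \<open>x \<le> 1\<close> one has
  \<open>x \<le> x powr \<alpha>\<close>, for larger \<open>x\<close> one has
  \<open>1 \<le> x powr \<alpha>\<close>. Here \<open>A\<close> plays the amplitude and
  \<open>N\<close> the frequency.\<close>

lemma holder_interpolation: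
  fixes z :: real
  assumes "0 \<le> A" "0 < d" "0 < N" "0 < \<alpha>" "\<alpha> < 1" "z \<le> 2 * A" "z \<le> A * (N * d)"
  shows "z \<le> 2 * A * (N powr \<alpha>) * d powr \<alpha>"
proof -
  define x where "x = N * d"
  have x: "x > 0" using assms by (simp add: x_def)
  have "z \<le> 2 * A * x powr \<alpha>"
  proof (cases "x \<le> 1")
    case True
    have "x powr 1 \<le> x powr \<alpha>" using True x assms by (intro powr_mono') auto
    then have "A * x \<le> A * x powr \<alpha>" using x assms by (intro mult_left_mono) auto
    moreover have "0 \<le> A * x powr \<alpha>" using assms by simp
    ultimately show ?thesis using assms(7) by (simp add: x_def)
  next
    case False
    then have "1 \<le> x powr \<alpha>" using assms by (intro ge_one_powr_ge_zero) auto
    then have "2 * A * 1 \<le> 2 * A * x powr \<alpha>" using assms by (intro mult_left_mono) auto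
    then show ?thesis using assms(6) by simp
  qed
  then show ?thesis using assms by (simp add: x_def powr_mult mult_ac)
qed

lemma holder_norm_le:
  assumes "\<And>x. norm (g x) \<le> K0" "\<And>x y. x \<noteq> y \<Longrightarrow> dist (g x) (g y) \<le> K1 * dist x y powr \<alpha>"
  shows "holder_norm \<alpha> g \<le> ennreal K0 + ennreal K1"
  unfolding holder_norm_def
proof (rule add_mono)
  show "(SUP x. ennreal (norm (g x))) \<le> ennreal K0"
    by (rule SUP_least) (intro ennreal_leI assms)
  show "(SUP (x, y)\<in>{(x, y). x \<noteq> y}. ennreal (dist (g x) (g y) / dist x y powr \<alpha>)) \<le> ennreal K1"
    by (rule SUP_least) (use assms(2) in \<open>auto intro!: ennreal_leI simp: divide_le_eq\<close>)
qed

lemma stage_bounds: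
  assumes C: "\<And>t. \<bar>step_deriv t\<bar> \<le> C \<and> \<bar>step_deriv2 t\<bar> \<le> C"
  shows "\<bar>ramp_d1 q t\<bar> \<le> C * (4 * (real q + 1)\<^sup>2)" "\<bar>ramp_d2 q t\<bar> \<le> C * (16 * (real q + 1) ^ 4)"
proof -
  have C0: "0 \<le> C" using C[of 0] by auto
  have "(real q + 1) * (real q + 2) \<le> (real q + 1) * (2 * (real q + 1))" by (intro mult_left_mono) auto
  then have p: "(real q + 1) * (real q + 2) \<le> 2 * (real q + 1)\<^sup>2" by (simp add: power2_eq_square)
  have it: "1 / stage_len q = 2 * ((real q + 1) * (real q + 2))" by (simp add: stage_len_def)
  have t: "1 / stage_len q \<le> 4 * (real q + 1)\<^sup>2" using p unfolding it by linarith
  have t0: "0 \<le> 1 / stage_len q" using stage_len_pos[of q] by simp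
  have "\<bar>ramp_d1 q t\<bar> = \<bar>step_deriv ((t - stage_start q) / stage_len q)\<bar> * (1 / stage_len q)"
    using stage_len_pos[of q] by (simp add: ramp_d1_def abs_divide)
  also have "\<dots> \<le> C * (4 * (real q + 1)\<^sup>2)" using C C0 t t0 by (intro mult_mono) auto
  finally show "\<bar>ramp_d1 q t\<bar> \<le> C * (4 * (real q + 1)\<^sup>2)" .
  have "\<bar>ramp_d2 q t\<bar> = \<bar>step_deriv2 ((t - stage_start q) / stage_len q)\<bar> * (1 / stage_len q)\<^sup>2"
    by (simp add: ramp_d2_def abs_divide power_divide)
  also have "\<dots> \<le> C * (4 * (real q + 1)\<^sup>2)\<^sup>2" using C C0 t t0 by (intro mult_mono power_mono) auto
  finally show "\<bar>ramp_d2 q t\<bar> \<le> C * (16 * (real q + 1) ^ 4)"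
    by (simp add: power2_eq_square power4_eq_xxxx)
qed

lemma real_slope: "real (slope q) = 10 ^ 8 * (real q + 1) ^ 4"
  by (simp add: slope_def root_slope_def power_mult_distrib add.commute flip: power_mult)

text \<open>One term of the exponential series. The exponent 8 is made of 4 from the second time
  derivative of the ramp and 4 from the slope.\<close>

lemma geometric_beats_polynomial:
  assumes "\<beta> > 0" shows "\<exists>K\<ge>0. \<forall>q::nat. (real q + 1) ^ 8 * (2 ^ q) powr (- \<beta>) \<le> K"
proof -
  define c where "c = \<beta> * ln 2"
  have c: "c > 0" using assms by (simp add: c_def)
  have "(real q + 1) ^ 8 * (2 ^ q) powr (- \<beta>) \<le> fact 8 / c ^ 8 * exp c" for q :: nat
  proof -
    have "(c * (real q + 1)) ^ 8 / fact 8 \<le> exp (c * (real q + 1))"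
      using c by (intro power_div_fact_le_exp) auto
    then have "c ^ 8 * (real q + 1) ^ 8 \<le> exp (c * (real q + 1)) * fact 8"
      unfolding power_mult_distrib by (simp add: divide_le_eq del: fact_numeral)
    then have A: "(real q + 1) ^ 8 \<le> fact 8 / c ^ 8 * exp (c * (real q + 1))"
      using c by (simp add: pos_le_divide_eq mult.commute del: fact_numeral)
    have B: "(2 ^ q) powr (- \<beta>) = exp (- (c * real q))"
      by (simp add: powr_def c_def ln_realpow)
    have "(real q + 1) ^ 8 * (2 ^ q) powr (- \<beta>) \<le> (fact 8 / c ^ 8 * exp (c * (real q
        + 1))) * exp (- (c * real q))"
      unfolding B by (rule mult_right_mono[OF A]) simp
    also have "\<dots> = fact 8 / c ^ 8 * (exp (c * (real q + 1)) * exp (- (c * real q)))" by (simp only: mult.assoc)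
    also have "exp (c * (real q + 1)) * exp (- (c * real q)) = exp c"
      by (simp add: exp_add[symmetric] algebra_simps)
    finally show ?thesis .
  qed
  then show ?thesis using c by (intro exI[of _ "fact 8 / c ^ 8 * exp c"]) auto
qed

text \<open>The displacement has amplitude \<open>slope q / 2 ^ q\<close> and Lipschitz constant
  \<open>slope q\<close>. Interpolation turns the gain \<open>2 ^ (- q)\<close> into
  \<open>2 ^ (- q * (1 - \<alpha>))\<close>, which still beats the polynomial factors precisely
  because \<open>\<alpha> < 1\<close>.\<close>

lemma transport_force_bound:
  assumes C: "\<And>t. \<bar>step_deriv t\<bar> \<le> C \<and> \<bar>step_deriv2 t\<bar> \<le> C" and \<alpha>: "0 < \<alpha>" "\<alpha> < 1"
  shows "\<exists>K\<ge>0. \<forall>q t y y'. \<bar>ramp_d2 q t * disp q y\<bar> \<le> K \<and>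
     (\<forall>d>0. \<bar>y - y'\<bar> \<le> d \<longrightarrow> \<bar>ramp_d2 q t * disp q y - ramp_d2 q t * disp q y'\<bar> \<le> K * d powr \<alpha>)"
proof -
  obtain K where K: "K \<ge> 0" "\<And>q::nat. (real q + 1) ^ 8 * (2 ^ q) powr (- (1 - \<alpha>)) \<le> K"
    using geometric_beats_polynomial[of "1 - \<alpha>"] \<alpha> by auto
  have C0: "0 \<le> C" using C[of 0] by auto
  have key: "\<bar>ramp_d2 q t\<bar> * (2 * (real (slope q) / 2 ^ q) * (2 ^ q) powr \<alpha>) \<le> C * 32 * 10 ^ 8 * K" for q t
  proof -
    have p: "(2 ^ q) powr \<alpha> / 2 ^ q = (2 ^ q) powr (- (1 - \<alpha>) :: real)"
      by (simp add: powr_diff[symmetric] powr_minus_divide powr_diff field_simps)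
    have "\<bar>ramp_d2 q t\<bar> * (2 * (real (slope q) / 2 ^ q) * (2 ^ q) powr \<alpha>)
      = \<bar>ramp_d2 q t\<bar> * (2 * real (slope q) * ((2 ^ q) powr \<alpha> / 2 ^ q))" by simp
    also have "\<dots> \<le> (C * (16 * (real q + 1) ^ 4)) * (2 * real (slope q) * ((2 ^ q) powr \<alpha> / 2 ^ q))"
      by (intro mult_right_mono stage_bounds(2)[OF C]) auto
    also have "\<dots> = C * 32 * 10 ^ 8 * ((real q + 1) ^ 8 * (2 ^ q) powr (- (1 - \<alpha>)))"
      unfolding p real_slope by (simp flip: power_add)
    also have "\<dots> \<le> C * 32 * 10 ^ 8 * K" using C0 K(2) by (intro mult_left_mono) auto
    finally show ?thesis .
  qed
  define K' where "K' = C * 32 * 10 ^ 8 * K"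
  have A: "\<bar>disp q y\<bar> \<le> real (slope q) / 2 ^ q" for q y
    using abs_profile_le[OF slope_pos[of q], of "2 ^ q * y"]
      by (simp add: disp_def abs_mult divide_right_mono mult_left_le)
  show ?thesis
  proof (intro exI[of _ K'] conjI allI impI)
    show "0 \<le> K'" using C0 K(1) by (simp add: K'_def)
    fix q t y y'
    have "1 \<le> (2 ^ q :: real) powr \<alpha>" using \<alpha> by (intro ge_one_powr_ge_zero) auto
    then have "\<bar>disp q y\<bar> * 1 \<le> (2 * (real (slope q) / 2 ^ q)) * (2 ^ q) powr \<alpha>"
      using A[of q y] by (intro mult_mono) auto
    then have "\<bar>ramp_d2 q t\<bar> * \<bar>disp q y\<bar> \<le> \<bar>ramp_d2 q t\<bar> * (2 * (real (slope q) / 2 ^ q) * (2 ^ q) powr \<alpha>)"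
      by (intro mult_left_mono) auto
    then show "\<bar>ramp_d2 q t * disp q y\<bar> \<le> K'" using key[of q t] by (simp add: abs_mult K'_def)
    fix d :: real assume d: "d > 0" "\<bar>y - y'\<bar> \<le> d"
    have "\<bar>disp q y - disp q y'\<bar> \<le> 2 * (real (slope q) / 2 ^ q) * (2 ^ q) powr \<alpha> * d powr \<alpha>"
    proof (rule holder_interpolation[OF _ d(1) _ \<alpha>])
      show "\<bar>disp q y - disp q y'\<bar> \<le> 2 * (real (slope q) / 2 ^ q)" using A[of q y] A[of q y'] by linarith
      have "\<bar>disp q y - disp q y'\<bar> \<le> slope q * \<bar>y - y'\<bar>" by (rule real_lipschitz[OF disp_deriv abs_disp_d1_le])
      also have "\<dots> \<le> slope q * d" using d by (intro mult_left_mono) auto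
      finally show "\<bar>disp q y - disp q y'\<bar> \<le> real (slope q) / 2 ^ q * (2 ^ q * d)" by simp
    qed auto
    then have "\<bar>ramp_d2 q t\<bar> * \<bar>disp q y - disp q y'\<bar>
        \<le> \<bar>ramp_d2 q t\<bar> * (2 * (real (slope q) / 2 ^ q) * (2 ^ q) powr \<alpha> * d powr \<alpha>)"
      by (intro mult_left_mono) auto
    also have "\<dots> = (\<bar>ramp_d2 q t\<bar> * (2 * (real (slope q) / 2 ^ q) * (2 ^ q) powr \<alpha>)) * d powr \<alpha>" by simp
    also have "\<dots> \<le> K' * d powr \<alpha>" unfolding K'_def by (intro mult_right_mono key) auto
    finally show "\<bar>ramp_d2 q t * disp q y - ramp_d2 q t * disp q y'\<bar> \<le> K' * d powr \<alpha>"
      by (simp add: abs_mult right_diff_distrib[symmetric])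
  qed
qed

lemma grad_scale_mono: "q \<le> r \<Longrightarrow> grad_scale q \<le> grad_scale r"
proof (induction r rule: dec_induct)
  case (step n)
  have "1 * grad_scale n \<le> real (slope n) * grad_scale n"
    using slope_pos[of n] grad_scale_ge_1[of n] by (intro mult_right_mono) auto
  then show ?case using step by simp
qed simp

text \<open>The small viscosity pays for the sharp corners. Both derivatives of the displacement are
  at most \<open>B\<close>; since \<open>q < Q\<close>, the square of \<open>grad_scale Q\<close>
  contains that of \<open>slope q * grad_scale q\<close>, whose first factor cancels against
  \<open>B\<close>, while \<open>(grad_scale q)\<^sup>2 \<ge> 10 ^ (8 * q)\<close> beats the powers
  of \<open>q\<close> and \<open>4 ^ q\<close>.\<close>

lemma viscous_force_bound:
  assumes C: "\<And>t. \<bar>step_deriv t\<bar> \<le> C \<and> \<bar>step_deriv2 t\<bar> \<le> C" and q: "q < Q"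
  shows "\<bar>1 / (grad_scale Q)\<^sup>2 * ramp_d1 q t * disp_d2 q y\<bar> \<le> C * 10 ^ 8"
    "\<bar>1 / (grad_scale Q)\<^sup>2 * ramp_d1 q t * disp_d2 q y - 1 / (grad_scale Q)\<^sup>2 * ramp_d1 q t * disp_d2 q
        y'\<bar> \<le> C * 10 ^ 8 * \<bar>y - y'\<bar>"
proof -
  have C0: "0 \<le> C" using C[of 0] by auto
  define B where "B = 300 * (real (slope q))\<^sup>2 * real (root_slope q) * 4 ^ q"
  have sl: "real (slope q) \<ge> 1" using slope_pos[of q] by linarith
  have sq: "sqrt (real (slope q)) = real (root_slope q)" by (simp add: slope_def)
  have d3: "\<bar>disp_d3 q y\<bar> \<le> B" for y
  proof -
    have "\<bar>disp_d3 q y\<bar> = real (slope q) * 2 ^ q * 2 ^ q * \<bar>profile_d3 (slope q) (2 ^ q * y)\<bar>"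
      by (simp add: disp_d3_def abs_mult)
    also have "\<dots> \<le> real (slope q) * 2 ^ q * 2 ^ q * (300 * slope q * sqrt (slope q))"
      using abs_profile_d3_le[OF slope_pos[of q], of "2 ^ q * y"] by (intro mult_left_mono) auto
    also have "\<dots> = B" unfolding B_def sq by (simp add: power2_eq_square flip: power_mult_distrib)
    finally show ?thesis .
  qed
  have d2: "\<bar>disp_d2 q y\<bar> \<le> B" for y
  proof -
    have "\<bar>disp_d2 q y\<bar> = real (slope q) * 2 ^ q * \<bar>profile_d2 (slope q) (2 ^ q * y)\<bar>"
      by (simp add: disp_d2_def abs_mult)
    also have "\<dots> \<le> real (slope q) * 2 ^ q * (12 * sqrt (slope q))"
      by (intro mult_left_mono abs_profile_d2_le slope_pos) auto
    also have "\<dots> \<le> real (slope q) * (2 ^ q * 2 ^ q) * ((300 * slope q) * sqrt (slope q))"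
      using sl by (intro mult_mono) (auto simp: mult_ge1_I)
    also have "\<dots> = B" unfolding B_def sq by (simp add: power2_eq_square flip: power_mult_distrib)
    finally show ?thesis .
  qed
  have small: "1 / (grad_scale Q)\<^sup>2 * \<bar>ramp_d1 q t\<bar> * B \<le> C * 10 ^ 8"
  proof -
    have "grad_scale (Suc q) \<le> grad_scale Q" using q by (intro grad_scale_mono) auto
    then have "real (slope q) * grad_scale q \<le> grad_scale Q" by simp
    then have l: "(real (slope q) * grad_scale q)\<^sup>2 \<le> (grad_scale Q)\<^sup>2"
      using grad_scale_ge_1[of q] by (intro power_mono) auto
    have lp: "0 < real (slope q) * grad_scale q" using sl grad_scale_ge_1[of q] by simp
    have pp: "0 < (grad_scale Q)\<^sup>2 * (real (slope q) * grad_scale q)\<^sup>2"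
      using lp grad_scale_ge_1[of Q] by (intro mult_pos_pos[OF zero_less_power zero_less_power]) linarith+
    have e8: "(10 ^ 8 :: real) = 10000 ^ 2" by simp
    have "(10 ^ 8 :: real) ^ q = (10000 ^ q)\<^sup>2" unfolding e8 by (simp only: power_mult[symmetric] mult.commute)
    also have "\<dots> \<le> (grad_scale q)\<^sup>2" using grad_scale_ge[of q] by (intro power_mono) auto
    finally have lq: "(10 ^ 8 :: real) ^ q \<le> (grad_scale q)\<^sup>2" .
    have q4: "(real q + 1) ^ 4 \<le> 16 ^ q"
    proof -
      have "real q + 1 \<le> 2 ^ q" using Bernoulli_inequality[of 1 q] by (simp add: add.commute)
      then have "(real q + 1) ^ 4 \<le> (2 ^ q) ^ 4" by (intro power_mono) auto
      also have "(2 ^ q :: real) ^ 4 = (2 ^ 4) ^ q" by (simp only: power_mult[symmetric] mult.commute)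
      finally show ?thesis by simp
    qed
    have "1 / (grad_scale Q)\<^sup>2 * \<bar>ramp_d1 q t\<bar> * B
        \<le> 1 / (real (slope q) * grad_scale q)\<^sup>2 * (C * (4 * (real q + 1)\<^sup>2)) * B"
      using l pp stage_bounds(1)[OF C] C0
      by (intro mult_right_mono mult_mono divide_left_mono) (simp_all add: B_def)
    \<comment> \<open>\<open>12000000 = 4 * 300 * 10000\<close>, with one factor each from the ramp,
      from \<open>B\<close> and from \<open>root_slope\<close>.\<close>
    also have "\<dots> = C * 12000000 * ((real q + 1) ^ 4 * 4 ^ q) / (grad_scale q)\<^sup>2"
    proof -
      have sg: "real (root_slope q) = 10000 * (real q + 1)\<^sup>2" by (simp add: root_slope_def add.commute)
      have "1 / (s * l)\<^sup>2 * (C * (4 * p\<^sup>2)) * (300 * s\<^sup>2 * (10000 * p\<^sup>2) * r)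
          = C * 12000000 * (p ^ 4 * r) / l\<^sup>2"
        if "s \<noteq> 0" for s l p r :: real
        using that by (simp add: power_mult_distrib power2_eq_square power4_eq_xxxx)
      then show ?thesis unfolding B_def sg using sl by auto
    qed
    also have "\<dots> \<le> C * 12000000 * (16 ^ q * 4 ^ q) / (10 ^ 8) ^ q"
      using C0 lq q4 by (intro frac_le mult_left_mono mult_right_mono) auto
    also have "\<dots> = C * 12000000 * (64 / 10 ^ 8) ^ q"
    proof -
      have "(16 ^ q * 4 ^ q :: real) = 64 ^ q" by (simp flip: power_mult_distrib)
      then show ?thesis by (simp only: power_divide times_divide_eq_right)
    qed
    also have "\<dots> \<le> C * 12000000 * 1" using C0 by (intro mult_left_mono power_le_one) auto
    also have "\<dots> \<le> C * 10 ^ 8" using C0 by simp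
    finally show ?thesis .
  qed
  have n: "0 \<le> 1 / (grad_scale Q)\<^sup>2 * \<bar>ramp_d1 q t\<bar>" by simp
  have "\<bar>1 / (grad_scale Q)\<^sup>2 * ramp_d1 q t * disp_d2 q y\<bar>
      = 1 / (grad_scale Q)\<^sup>2 * \<bar>ramp_d1 q t\<bar> * \<bar>disp_d2 q y\<bar>" by (simp add: abs_mult)
  also have "\<dots> \<le> 1 / (grad_scale Q)\<^sup>2 * \<bar>ramp_d1 q t\<bar> * B" by (rule mult_left_mono[OF d2 n])
  finally show "\<bar>1 / (grad_scale Q)\<^sup>2 * ramp_d1 q t * disp_d2 q y\<bar> \<le> C * 10 ^ 8" using small by linarith
  have "\<bar>1 / (grad_scale Q)\<^sup>2 * ramp_d1 q t * disp_d2 q y - 1 / (grad_scale Q)\<^sup>2 * ramp_d1 q t * disp_d2 q y'\<bar>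
      = 1 / (grad_scale Q)\<^sup>2 * \<bar>ramp_d1 q t\<bar> * \<bar>disp_d2 q y - disp_d2 q y'\<bar>"
    unfolding right_diff_distrib[symmetric] abs_mult by simp
  also have "\<dots> \<le> 1 / (grad_scale Q)\<^sup>2 * \<bar>ramp_d1 q t\<bar> * (B * \<bar>y - y'\<bar>)"
    by (intro mult_left_mono n real_lipschitz[OF disp_d2_deriv d3])
  also have "\<dots> = (1 / (grad_scale Q)\<^sup>2 * \<bar>ramp_d1 q t\<bar> * B) * \<bar>y - y'\<bar>" by simp
  also have "\<dots> \<le> C * 10 ^ 8 * \<bar>y - y'\<bar>" by (intro mult_right_mono small) auto
  finally show "\<bar>1 / (grad_scale Q)\<^sup>2 * ramp_d1 q t * disp_d2 q y - 1 / (grad_scale Q)\<^sup>2 * ramp_d1 q t *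
      disp_d2 q y'\<bar> \<le> C * 10 ^ 8 * \<bar>y - y'\<bar>" .
qed

text \<open>The stages are disjoint in time, so a sum over them has at most one nonzero term; this
  makes the force bounds independent of the number of stages.\<close>

lemma active_stage: "\<exists>q0. \<forall>q. q \<noteq> q0 \<longrightarrow> ramp_d1 q t = 0 \<and> ramp_d2 q t = 0"
proof (cases "\<exists>q0. stage_start q0 < t \<and> t < stage_start (Suc q0)")
  case True
  then obtain q0 where q0: "stage_start q0 < t" "t < stage_start (Suc q0)" by blast
  have "ramp_d1 q t = 0 \<and> ramp_d2 q t = 0" if "q \<noteq> q0" for q
  proof (cases "q < q0")
    case True
    then have "stage_start (Suc q) \<le> stage_start q0" by (intro stage_start_mono) auto
    then show ?thesis using q0 by (simp add: ramp_d1_off ramp_d2_off)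
  next
    case False
    then have "stage_start (Suc q0) \<le> stage_start q" using that by (intro stage_start_mono) auto
    then show ?thesis using q0 by (simp add: ramp_d1_off ramp_d2_off)
  qed
  then show ?thesis by blast
next
  case False
  then have "t \<le> stage_start q \<or> t \<ge> stage_start (Suc q)" for q by (meson not_le)
  then show ?thesis by (auto simp: ramp_d1_off ramp_d2_off)
qed

lemma sum_one_active:
  assumes "\<And>q. q \<noteq> q0 \<Longrightarrow> f q = 0" "\<And>q. q < Q \<Longrightarrow> norm (f q) \<le> B" "0 \<le> (B::real)"
  shows "norm (\<Sum>q<(Q::nat). f q) \<le> B"
proof -
  have "(\<Sum>q<Q. f q) = (\<Sum>q<Q. if q = q0 then f q0 else 0)" using assms(1) by (intro sum.cong) auto
  then show ?thesis using assms(2,3) by (simp add: sum.delta)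
qed

text \<open>The order of quantifiers matters: the constant depends on \<open>\<alpha>\<close> but is
  fixed before \<open>Q\<close>, hence before the viscosity.\<close>

lemma force_bound:
  assumes \<alpha>: "0 < \<alpha>" "\<alpha> < 1"
  shows "\<exists>K. \<forall>Q R. (\<forall>t\<in>{0..1}. \<forall>X Y. \<bar>R t X\<bar> \<le> 1 \<and> \<bar>R t X - R t Y\<bar> \<le> dist X Y) \<longrightarrow>
     C_holder_norm \<alpha> (force Q (1 / (grad_scale Q)\<^sup>2) R) \<le> ennreal K + ennreal K"
proof -
  obtain C where C: "\<And>t. \<bar>step_deriv t\<bar> \<le> C \<and> \<bar>step_deriv2 t\<bar> \<le> C" using step_deriv_bounded by blast
  have C0: "0 \<le> C" using C[of 0] by auto
  obtain K where K: "K \<ge> 0" "\<And>q t y. \<bar>ramp_d2 q t * disp q y\<bar> \<le> K"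
     "\<And>q t y y' d. d > 0 \<Longrightarrow> \<bar>y - y'\<bar> \<le> d \<Longrightarrow> \<bar>ramp_d2 q t * disp q y - ramp_d2 q t * disp q y'\<bar> \<le> K * d powr \<alpha>"
    using transport_force_bound[OF C \<alpha>] by blast
  define B where "B = C * 10 ^ 8"
  have B: "0 \<le> B" using C0 by (simp add: B_def)
  \<comment> \<open>\<open>K\<close> for the time derivative of the velocity, \<open>2 * B\<close>
    for the viscous term after interpolation, and \<open>2\<close> for the residual, which is
    bounded by 1 and 1-Lipschitz.\<close>
  define K' where "K' = (K + 2 * B) + 2"
  show ?thesis
  proof (intro exI[of _ K'] allI impI)
    fix Q :: nat and R :: "real \<Rightarrow> real^3 \<Rightarrow> real"
    assume R: "\<forall>t\<in>{0..1}. \<forall>X Y. \<bar>R t X\<bar> \<le> 1 \<and> \<bar>R t X - R t Y\<bar> \<le> dist X Y"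
    define \<nu> where "\<nu> = 1 / (grad_scale Q)\<^sup>2"
    have "holder_norm \<alpha> (force Q \<nu> R t) \<le> ennreal K' + ennreal K'" if t: "t \<in> {0..1}" for t
    proof (rule holder_norm_le)
      obtain q0 where q0: "\<And>q. q \<noteq> q0 \<Longrightarrow> ramp_d1 q t = 0" "\<And>q. q \<noteq> q0 \<Longrightarrow> ramp_d2 q t = 0"
        using active_stage[of t] by blast
      define g where "g q X = ramp_d2 q t * disp q (X $ stage_axis (Suc q)) - \<nu> * ramp_d1 q t * disp_d2 q
          (X $ stage_axis (Suc q))" for q and X :: "real^3"
      have f: "force Q \<nu> R t X = (\<Sum>q<Q. g q X *\<^sub>R ee (stage_axis q)) + R t X *\<^sub>R ee 3" for X
        by (simp add: force_def g_def)
      have g0: "g q X = 0" if "q \<noteq> q0" for q X using q0 that by (simp add: g_def)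
      fix X :: "real^3"
      have "norm (\<Sum>q<Q. g q X *\<^sub>R ee (stage_axis q)) \<le> K + 2 * B"
      proof (rule sum_one_active[of q0])
        fix q assume "q < Q"
        then have "\<bar>\<nu> * ramp_d1 q t * disp_d2 q (X $ stage_axis (Suc q))\<bar> \<le> B"
          unfolding \<nu>_def B_def by (rule viscous_force_bound(1)[OF C])
        then show "norm (g q X *\<^sub>R ee (stage_axis q)) \<le> K + 2 * B"
          using K(2)[of q t "X $ stage_axis (Suc q)"] B by (simp add: g_def)
      qed (use g0 K B in auto)
      then show "norm (force Q \<nu> R t X) \<le> K'"
        unfolding f K'_def using R t by (intro norm_triangle_le add_mono) (auto intro: order_trans[of _ 1])
      fix Y :: "real^3" assume XY: "X \<noteq> Y"
      define d where "d = dist X Y"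
      have d: "d > 0" using XY by (simp add: d_def)
      have dj: "\<bar>X $ j - Y $ j\<bar> \<le> d" for j
        using component_le_norm_cart[of "X - Y" j] by (simp add: d_def dist_norm)
      have a: "norm (\<Sum>q<Q. (g q X - g q Y) *\<^sub>R ee (stage_axis q)) \<le> (K + 2 * B) * d powr \<alpha>"
      proof (rule sum_one_active[of q0])
        fix q assume q: "q < Q"
        let ?v = "\<lambda>X. \<nu> * ramp_d1 q t * disp_d2 q (X $ stage_axis (Suc q))"
        have "\<bar>?v X - ?v Y\<bar> \<le> 2 * B * 1 powr \<alpha> * d powr \<alpha>"
        proof (rule holder_interpolation[OF B d _ \<alpha>])
          have "\<bar>?v X\<bar> \<le> B" "\<bar>?v Y\<bar> \<le> B"
            unfolding \<nu>_def B_def by (rule viscous_force_bound(1)[OF C q])+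
          then show "\<bar>?v X - ?v Y\<bar> \<le> 2 * B" by linarith
          have "\<bar>?v X - ?v Y\<bar> \<le> B * \<bar>X $ stage_axis (Suc q) - Y $ stage_axis (Suc q)\<bar>"
            unfolding \<nu>_def B_def by (rule viscous_force_bound(2)[OF C q])
          also have "\<dots> \<le> B * (1 * d)" using dj B by (intro mult_left_mono) auto
          finally show "\<bar>?v X - ?v Y\<bar> \<le> B * (1 * d)" .
        qed simp
        then have "\<bar>g q X - g q Y\<bar> \<le> K * d powr \<alpha> + 2 * B * d powr \<alpha>"
          using K(3)[where q = q and t = t, OF d dj[of "stage_axis (Suc q)"]] unfolding g_def by simp
        then show "norm ((g q X - g q Y) *\<^sub>R ee (stage_axis q)) \<le> (K + 2 * B) * d powr \<alpha>"
          by (simp add: distrib_right)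
      qed (use g0 K B in auto)
      have b: "norm ((R t X - R t Y) *\<^sub>R ee 3) \<le> 2 * d powr \<alpha>"
      proof -
        have "\<bar>R t X - R t Y\<bar> \<le> 2 * 1 * 1 powr \<alpha> * d powr \<alpha>"
        proof (rule holder_interpolation[OF _ d _ \<alpha>])
          have "\<bar>R t X\<bar> \<le> 1" "\<bar>R t Y\<bar> \<le> 1" using R t by auto
          then show "\<bar>R t X - R t Y\<bar> \<le> 2 * 1" by linarith
          show "\<bar>R t X - R t Y\<bar> \<le> 1 * (1 * d)" using R t by (simp add: d_def)
        qed auto
        then show ?thesis by simp
      qed
      have c: "force Q \<nu> R t X - force Q \<nu> R t Y = (\<Sum>q<Q. (g q X - g q Y) *\<^sub>R ee (stage_axis q))
          + (R t X - R t Y) *\<^sub>R ee 3"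
        unfolding f by (simp add: scaleR_left_diff_distrib sum_subtractf)
      have "norm (force Q \<nu> R t X - force Q \<nu> R t Y) \<le> (K + 2 * B) * d powr \<alpha> + 2 * d powr \<alpha>"
        unfolding c by (rule norm_triangle_le[OF add_mono[OF a b]])
      then show "dist (force Q \<nu> R t X) (force Q \<nu> R t Y) \<le> K' * dist X Y powr \<alpha>"
        by (simp add: dist_norm K'_def d_def distrib_right)
    qed
    then show "C_holder_norm \<alpha> (force Q (1 / (grad_scale Q)\<^sup>2) R) \<le> ennreal K' + ennreal K'"
      unfolding C_holder_norm_def \<nu>_def by (intro SUP_least)
  qed
qed

lemma smooth_torus_initial: "smooth_torus (\<lambda>X. sin (2 * pi * X $ 1) *\<^sub>R ee 3)"
proof -
  have "C_k_on k UNIV (\<lambda>X::real^3. sin (((2 * pi) *\<^sub>R ee 1) \<bullet> X + 0) *\<^sub>R ee 3)" for k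
    by (rule C_k_on_linear_comp[OF unique_deriv_set_UNIV bounded_linear_scaleR_left C_k_on_sine])
  then have "C_k_on k UNIV (\<lambda>X::real^3. sin (2 * pi * X $ 1) *\<^sub>R ee 3)" for k
    by (simp add: inner_axis')
  moreover have "periodic (\<lambda>X. sin (2 * pi * X $ 1) *\<^sub>R ee 3)"
    using Psi_periodic[of 0 0] by (simp add: periodic_def)
  ultimately show ?thesis by (simp add: smooth_torus_def smooth_on_def)
qed

text \<open>All shears are at rest at time 0, so the initial datum is the same for every number of
  stages.\<close>

lemma flow_initial: "(\<And>X. wave_sum L 0 X = sin (2 * pi * X $ 1)) \<Longrightarrow> flow Q L 0
    = (\<lambda>X. sin (2 * pi * X $ 1) *\<^sub>R ee 3)"
  using ramp_d1_off[of 0] stage_start_nonneg by (intro ext) (simp add: flow_def vel_def)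

lemma scalar_exists:
  "\<exists>L R. (\<exists>\<gamma>. wave_bounded \<gamma> L) \<and> smooth_torus_time R \<and> (\<forall>X. wave_sum L 0 X = sin (2 * pi * X $ 1)) \<and>
     (\<forall>t X. wave_time L t X = 1 / (grad_scale Q)\<^sup>2 * wave_laplace L t X - vel Q t X \<bullet> wave_grad L t X + R t X) \<and>
     (\<forall>t\<in>{0..1}. \<forall>X. \<bar>R t X\<bar> * (1 + \<bar>wave_sum L t X\<bar>) \<le> 1 / 1000) \<and>
     (\<forall>t\<in>{0..1}. \<forall>X Y. \<bar>R t X - R t Y\<bar> \<le> 1 / 1000 * dist X Y)"
proof -
  obtain M where M: "vwave_bounded M (vel_waves Q)"
    using vwave_bounded_exists[of "vel_waves Q"] vel_waves_smooth by blast
  obtain C where C: "\<And>t X. t \<in> {0..1} \<Longrightarrow> norm (vwave_sum (vel_waves Q) t X) \<le> C"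
    "\<And>t X Y. t \<in> {0..1} \<Longrightarrow> norm (vwave_sum (vel_waves Q) t X - vwave_sum (vel_waves Q) t Y) \<le> C * dist X Y"
    using vwave_bounded_bounds[OF M] by blast
  have nu: "1 / (grad_scale Q)\<^sup>2 > 0" using grad_scale_ge_1[of Q] by simp
  from approximate_scalar[OF nu M _ C, of "1 / 1000"] show ?thesis
    unfolding vwave_sum_vel_waves by auto
qed

theorem theorem1p1:
  shows "\<exists>(\<nu> :: nat \<Rightarrow> real) (f :: nat \<Rightarrow> real \<Rightarrow> real^3 \<Rightarrow> real^3) (u0 :: real^3 \<Rightarrow> real^3).
    (\<forall>m. \<nu> m > 0) \<and> decseq \<nu> \<and> \<nu> \<longlonglongrightarrow> 0 \<and>
    (\<forall>m. smooth_torus_time (f m)) \<and>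
    smooth_torus u0 \<and>
    (\<forall>\<alpha>\<in>{0<..<1}. (SUP m. C_holder_norm \<alpha> (f m)) < \<infinity>) \<and>
    (\<exists>u :: nat \<Rightarrow> real \<Rightarrow> real^3 \<Rightarrow> real^3.
      (\<forall>m. (\<exists>p. navier_stokes_solution (\<nu> m) (f m) u0 (u m) p) \<and>
           (\<forall>v q. navier_stokes_solution (\<nu> m) (f m) u0 v q \<longrightarrow>
              (\<forall>t\<in>{0..1}. \<forall>x. v t x = u m t x))) \<and>
      liminf (\<lambda>m. ereal (dissipation (\<nu> m) (u m))) > 0)"
proof -
  obtain L :: "nat \<Rightarrow> wave list" and R :: "nat \<Rightarrow> real \<Rightarrow> real^3 \<Rightarrow> real" where
    LR: "\<And>Q. (\<exists>\<gamma>. wave_bounded \<gamma> (L Q))" "\<And>Q. smooth_torus_time (R Q)" "\<And>Q X. wave_sum (L Q) 0 X = sin (2 * pi * X $ 1)"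
     "\<And>Q t X. wave_time (L Q) t X = 1 / (grad_scale Q)\<^sup>2 * wave_laplace (L Q) t X - vel Q t X \<bullet> wave_grad (L Q) t X + R Q t X"
     "\<And>Q t X. t \<in> {0..1} \<Longrightarrow> \<bar>R Q t X\<bar> * (1 + \<bar>wave_sum (L Q) t X\<bar>) \<le> 1 / 1000"
     "\<And>Q t X Y. t \<in> {0..1} \<Longrightarrow> \<bar>R Q t X - R Q t Y\<bar> \<le> 1 / 1000 * dist X Y"
    using scalar_exists by metis
  obtain \<gamma> where \<gamma>: "\<And>Q. wave_bounded (\<gamma> Q) (L Q)" using LR(1) by metis
  \<comment> \<open>The index of the sequence is the number of shears.\<close>
  define \<nu> where "\<nu> m = 1 / (grad_scale m)\<^sup>2" for m
  define f where "f m = force m (\<nu> m) (R m)" for m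
  define u0 :: "real^3 \<Rightarrow> real^3" where "u0 = (\<lambda>X. sin (2 * pi * X $ 1) *\<^sub>R ee 3)"
  define u where "u m = flow m (L m)" for m
  have nu: "\<nu> m > 0" for m using grad_scale_ge_1[of m] by (simp add: \<nu>_def)
  have "decseq \<nu>"
    unfolding decseq_def
  proof (intro allI impI)
    fix m n :: nat assume "m \<le> n"
    then have "(grad_scale m)\<^sup>2 \<le> (grad_scale n)\<^sup>2" using grad_scale_ge_1[of m] by (intro power_mono grad_scale_mono) auto
    then show "\<nu> n \<le> \<nu> m" unfolding \<nu>_def using grad_scale_ge_1[of m] grad_scale_ge_1[of n] by (intro divide_left_mono) auto
  qed
  moreover have "\<nu> \<longlonglongrightarrow> 0"
  proof (rule tendsto_sandwich)
    show "\<forall>\<^sub>F m in sequentially. 0 \<le> \<nu> m" by (simp add: nu less_imp_le)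
    show "\<forall>\<^sub>F m in sequentially. \<nu> m \<le> (1 / 10000) ^ m"
    proof (intro always_eventually allI)
      fix m
      have "10000 ^ m * 1 \<le> grad_scale m * grad_scale m" using grad_scale_ge[of m] grad_scale_ge_1[of m] by (intro mult_mono) auto
      then have "1 / (grad_scale m)\<^sup>2 \<le> 1 / 10000 ^ m" using grad_scale_ge_1[of m] by (intro divide_left_mono) (auto simp: power2_eq_square)
      then show "\<nu> m \<le> (1 / 10000) ^ m" by (simp add: \<nu>_def power_divide)
    qed
    show "(\<lambda>m. (1 / 10000 :: real) ^ m) \<longlonglongrightarrow> 0" by (rule LIMSEQ_realpow_zero) auto
  qed simp
  moreover have "smooth_torus_time (f m)" for m unfolding f_def by (rule force_smooth[OF LR(2)])
  moreover have "smooth_torus u0" unfolding u0_def by (rule smooth_torus_initial)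
  moreover have "(SUP m. C_holder_norm \<alpha> (f m)) < \<infinity>" if \<alpha>: "\<alpha> \<in> {0<..<1}" for \<alpha>
  proof -
    obtain K where K: "\<And>Q R. (\<forall>t\<in>{0..1}. \<forall>X Y. \<bar>R t X\<bar> \<le> 1 \<and> \<bar>R t X - R t Y\<bar> \<le> dist X Y) \<Longrightarrow>
       C_holder_norm \<alpha> (force Q (1 / (grad_scale Q)\<^sup>2) R) \<le> ennreal K + ennreal K"
      using force_bound[of \<alpha>] \<alpha> by auto
    have "C_holder_norm \<alpha> (f m) \<le> ennreal K + ennreal K" for m
      unfolding f_def \<nu>_def
    proof (intro K ballI allI conjI)
      fix t :: real and X Y :: "real^3" assume t: "t \<in> {0..1}"
      have "\<bar>R m t X\<bar> * 1 \<le> \<bar>R m t X\<bar> * (1 + \<bar>wave_sum (L m) t X\<bar>)" by (intro mult_left_mono) auto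
      then show "\<bar>R m t X\<bar> \<le> 1" using LR(5)[OF t, of m X] by linarith
      show "\<bar>R m t X - R m t Y\<bar> \<le> dist X Y" using LR(6)[OF t, of m X Y] zero_le_dist[of X Y] by linarith
    qed
    then have "(SUP m. C_holder_norm \<alpha> (f m)) \<le> ennreal K + ennreal K" by (intro SUP_least)
    also have "\<dots> < \<infinity>" by simp
    finally show ?thesis .
  qed
  moreover have sol: "navier_stokes_solution (\<nu> m) (f m) u0 (u m) (\<lambda>t X. 0)" for m
    using flow_solves[OF \<gamma>[of m] LR(2)[of m] LR(4)[of m]] flow_initial[OF LR(3)[of m], of m]
    by (simp add: f_def u_def u0_def \<nu>_def)
  moreover have "v t x = u m t x" if "navier_stokes_solution (\<nu> m) (f m) u0 v q" "t \<in> {0..1}" for m v q t x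
    by (rule navier_stokes_unique[OF less_imp_le[OF nu] sol that])
  moreover have "liminf (\<lambda>m. ereal (dissipation (\<nu> m) (u m))) > 0"
  proof -
    have "1 / 10 ^ 8 \<le> dissipation (\<nu> m) (u m)" for m
    proof -
      have "1 / 10 ^ 8 \<le> integral {0..1} (\<lambda>t. \<nu> m * torus_int (\<lambda>X. (norm (wave_grad (L m) t X))\<^sup>2))"
      proof (rule scalar_dissipation[OF \<gamma>[of m] LR(3)[of m], where Q = m and R = "R m"])
        show "\<nu> m = 1 / (grad_scale m)\<^sup>2" by (simp add: \<nu>_def)
        show "wave_time (L m) t X = \<nu> m * wave_laplace (L m) t X - vel m t X \<bullet> wave_grad (L m) t X + R m t X" for t X
          unfolding \<nu>_def by (rule LR(4))
      qed (rule LR(5))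
      also have "\<dots> \<le> dissipation (\<nu> m) (u m)"
        unfolding u_def by (rule flow_dissipation[OF \<gamma>[of m] less_imp_le[OF nu]])
      finally show ?thesis .
    qed
    then have "ereal (1 / 10 ^ 8) \<le> liminf (\<lambda>m. ereal (dissipation (\<nu> m) (u m)))"
      by (intro Liminf_bounded always_eventually) auto
    moreover have "0 < ereal (1 / 10 ^ 8)" by simp
    ultimately show ?thesis by (rule order_less_le_trans[rotated])
  qed
  ultimately show ?thesis using nu
    by (intro exI[of _ \<nu>] exI[of _ f] exI[of _ u0] conjI exI[of _ u]) blast+
qed

end
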